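(* Let $(M,g)$ be a closed Riemannian manifold and let $X_t$ be a solution of the flow $$\partial_t (X_t)^i=\Delta (X_t)^i+\nabla^i\operatorname{div}(X_t)+R^i{}_j (X_t)^j,\qquad X_0=X,$$ with $X$ a smooth vector field on $M$. Set $\mathcal{I}(X):=\int_M\langle\nabla R,X\rangle\,dV$ for any vector field $X$, where $R$ is the scalar curvature of $g$. Then $$\frac{d}{dt}\mathcal{I}(X_t)=2\int_M\left(-\Delta R+\frac{R^2}{4}\right)\operatorname{div}(X_t)\,dV-2\int_M R\,\langle\operatorname{Ric},\mathbf{Def}(X_t)\rangle\,dV .$$ In particular, $$\lim_{t\to\infty}\frac{d}{dt}\mathcal{I}(X_t)=0 .$$
   Context: Closed means compact without boundary; all manifolds and vector fields are smooth. $\nabla$ is the Levi-Civita connection of $g$, $dV$ the volume form, $\Delta=g^{k\ell}\nabla_k\nabla_\ell$ (acting on functions or on vector fields), $\operatorname{div}(X)=\nabla_iX^i$, and $\operatorname{Ric}=(R_{ij})$ is the Ricci curvature. Indices are raised and lowered with $g$, and repeated indices are summed. $\mathbf{Def}(X)$ is the symmetric 2-tensor $\mathbf{Def}(X)_{ij}=\tfrac12(\nabla_iX_j+\nabla_jX_i)$, and $\langle A,B\rangle=A_{ij}B^{ij}$ for 2-tensors. *)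

theory Defs
  imports "HOL-Analysis.Analysis"
begin

section \<open>Smooth functions on subsets of Euclidean space\<close>

primrec Ck_on :: "nat \<Rightarrow> ('a::euclidean_space \<Rightarrow> 'b::real_normed_vector) \<Rightarrow> 'a set \<Rightarrow> bool" where
  "Ck_on 0 f S \<longleftrightarrow> continuous_on S f"
| "Ck_on (Suc k) f S \<longleftrightarrow> f differentiable_on S \<and>
     (\<forall>v\<in>Basis. Ck_on k (\<lambda>x. frechet_derivative f (at x within S) v) S)"

text \<open>
  Used only for open \<open>S\<close> and for \<open>S = {0..} \<times> V\<close> with \<open>V\<close> open. In both cases the derivative
  within \<open>S\<close> is unique at every point of \<open>S\<close>; in the second case it is one-sided in the first
  variable on the boundary, so that this is smoothness up to the boundary.
\<close>

definition smooth_on :: "('a::euclidean_space \<Rightarrow> 'b::real_normed_vector) \<Rightarrow> 'a set \<Rightarrow> bool" where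
  "smooth_on f S \<longleftrightarrow> (\<forall>k. Ck_on k f S)"

definition pd :: "'n \<Rightarrow> (real^'n::finite \<Rightarrow> real) \<Rightarrow> real^'n \<Rightarrow> real" where
  "pd i f x = frechet_derivative f (at x) (axis i 1)"


section \<open>Smooth manifolds\<close>

text \<open>A chart is a domain together with a coordinate map, whose values off the domain are
  irrelevant.\<close>

type_synonym ('m, 'n) chart = "'m set \<times> ('m \<Rightarrow> real^'n)"

abbreviation chart_dom :: "('m, 'n) chart \<Rightarrow> 'm set" where
  "chart_dom c \<equiv> fst c"

abbreviation chart_map :: "('m, 'n) chart \<Rightarrow> 'm \<Rightarrow> real^'n" where
  "chart_map c \<equiv> snd c"

definition chart_img :: "('m, 'n) chart \<Rightarrow> (real^'n) set" where
  "chart_img c = chart_map c ` chart_dom c"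

definition chart_inv :: "('m, 'n) chart \<Rightarrow> real^'n \<Rightarrow> 'm" where
  "chart_inv c = inv_into (chart_dom c) (chart_map c)"

definition transition :: "('m, 'n) chart \<Rightarrow> ('m, 'n) chart \<Rightarrow> real^'n \<Rightarrow> real^'n" where
  "transition c d = chart_map d \<circ> chart_inv c"

definition overlap :: "('m, 'n) chart \<Rightarrow> ('m, 'n) chart \<Rightarrow> (real^'n) set" where
  "overlap c d = chart_map c ` (chart_dom c \<inter> chart_dom d)"

definition is_chart :: "'m topology \<Rightarrow> ('m, 'n::finite) chart \<Rightarrow> bool" where
  "is_chart M c \<longleftrightarrow> openin M (chart_dom c) \<and> open (chart_img c) \<and>
     homeomorphic_map (subtopology M (chart_dom c)) (top_of_set (chart_img c)) (chart_map c)"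

definition smooth_atlas :: "'m topology \<Rightarrow> ('m, 'n::finite) chart set \<Rightarrow> bool" where
  "smooth_atlas M A \<longleftrightarrow> (\<forall>c\<in>A. is_chart M c) \<and> (\<Union>c\<in>A. chart_dom c) = topspace M \<and>
     (\<forall>c\<in>A. \<forall>d\<in>A. smooth_on (transition c d) (overlap c d))"

text \<open>Second countability follows from compactness.\<close>

definition closed_manifold :: "'m topology \<Rightarrow> ('m, 'n::finite) chart set \<Rightarrow> bool" where
  "closed_manifold M A \<longleftrightarrow> Hausdorff_space M \<and> compact_space M \<and> smooth_atlas M A"

definition smooth_fun :: "('m, 'n::finite) chart set \<Rightarrow> ('m \<Rightarrow> real) \<Rightarrow> bool" where
  "smooth_fun A f \<longleftrightarrow> (\<forall>c\<in>A. smooth_on (f \<circ> chart_inv c) (chart_img c))"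

text \<open>
  A tensor field is given by its components: to each chart \<open>c\<close> it assigns a function of the
  coordinates \<open>x \<in> chart_img c\<close>, and the functions belonging to different charts are related by
  the transformation law of the tensor type. Values at \<open>x \<notin> chart_img c\<close> are irrelevant.
\<close>

definition smooth_vector_field ::
  "('m, 'n::finite) chart set \<Rightarrow> (('m, 'n) chart \<Rightarrow> real^'n \<Rightarrow> real^'n) \<Rightarrow> bool" where
  "smooth_vector_field A X \<longleftrightarrow>
     (\<forall>c\<in>A. smooth_on (X c) (chart_img c)) \<and>
     (\<forall>c\<in>A. \<forall>d\<in>A. \<forall>x\<in>overlap c d.
        X d (transition c d x) = frechet_derivative (transition c d) (at x) (X c x))"

definition smooth_vector_field_family ::
  "('m, 'n::finite) chart set \<Rightarrow> (real \<Rightarrow> ('m, 'n) chart \<Rightarrow> real^'n \<Rightarrow> real^'n) \<Rightarrow> bool" where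
  "smooth_vector_field_family A X \<longleftrightarrow>
     (\<forall>t\<ge>0. smooth_vector_field A (X t)) \<and>
     (\<forall>c\<in>A. smooth_on (\<lambda>(t, x). X t c x) ({0..} \<times> chart_img c))"

definition riemannian_metric ::
  "('m, 'n::finite) chart set \<Rightarrow> (('m, 'n) chart \<Rightarrow> real^'n \<Rightarrow> real^'n^'n) \<Rightarrow> bool" where
  "riemannian_metric A g \<longleftrightarrow>
     (\<forall>c\<in>A. smooth_on (g c) (chart_img c)) \<and>
     (\<forall>c\<in>A. \<forall>x\<in>chart_img c. transpose (g c x) = g c x \<and> (\<forall>v. v \<noteq> 0 \<longrightarrow> v \<bullet> (g c x *v v) > 0)) \<and>
     (\<forall>c\<in>A. \<forall>d\<in>A. \<forall>x\<in>overlap c d. \<forall>v w.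
        (let J = frechet_derivative (transition c d) (at x)
         in J v \<bullet> (g d (transition c d x) *v J w) = v \<bullet> (g c x *v w)))"

definition closed_riemannian_manifold ::
  "'m topology \<Rightarrow> ('m, 'n::finite) chart set \<Rightarrow> (('m, 'n) chart \<Rightarrow> real^'n \<Rightarrow> real^'n^'n) \<Rightarrow> bool" where
  "closed_riemannian_manifold M A g \<longleftrightarrow> closed_manifold M A \<and> riemannian_metric A g"


section \<open>Tensor calculus in a chart\<close>

text \<open>
  Throughout, \<open>G\<close> is the matrix of components of the metric in one chart, as a function of the
  coordinates. Each operator returns the components, in that chart, of the tensor in question.
\<close>

type_synonym 'n local_metric = "real^'n \<Rightarrow> real^'n^'n"

definition ginv :: "'n::finite local_metric \<Rightarrow> 'n \<Rightarrow> 'n \<Rightarrow> real^'n \<Rightarrow> real" where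
  "ginv G i j x = matrix_inv (G x) $ i $ j"

text \<open>\<open>christoffel G k i j\<close> is \<open>\<Gamma>\<^sup>k\<^sub>i\<^sub>j\<close>, i.e. \<open>\<nabla>\<^sub>i \<partial>\<^sub>j = \<Gamma>\<^sup>k\<^sub>i\<^sub>j \<partial>\<^sub>k\<close>.\<close>

definition christoffel :: "'n::finite local_metric \<Rightarrow> 'n \<Rightarrow> 'n \<Rightarrow> 'n \<Rightarrow> real^'n \<Rightarrow> real" where
  "christoffel G k i j x = (1/2) * (\<Sum>l\<in>UNIV. ginv G k l x *
     (pd i (\<lambda>y. G y $ j $ l) x + pd j (\<lambda>y. G y $ i $ l) x - pd l (\<lambda>y. G y $ i $ j) x))"

text \<open>Covariant derivatives; the first index is that of the differentiation:
  \<open>\<nabla>\<^sub>i \<omega>\<^sub>j\<close>, \<open>\<nabla>\<^sub>i X\<^sup>j\<close> and \<open>\<nabla>\<^sub>k T\<^sub>l\<^sup>i\<close>.\<close>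

definition nabla_covec ::
  "'n::finite local_metric \<Rightarrow> ('n \<Rightarrow> real^'n \<Rightarrow> real) \<Rightarrow> 'n \<Rightarrow> 'n \<Rightarrow> real^'n \<Rightarrow> real" where
  "nabla_covec G \<omega> i j x = pd i (\<omega> j) x - (\<Sum>k\<in>UNIV. christoffel G k i j x * \<omega> k x)"

definition nabla_vec ::
  "'n::finite local_metric \<Rightarrow> (real^'n \<Rightarrow> real^'n) \<Rightarrow> 'n \<Rightarrow> 'n \<Rightarrow> real^'n \<Rightarrow> real" where
  "nabla_vec G X i j x = pd i (\<lambda>y. X y $ j) x + (\<Sum>k\<in>UNIV. christoffel G j i k x * X x $ k)"

definition nabla_mixed ::
  "'n::finite local_metric \<Rightarrow> ('n \<Rightarrow> 'n \<Rightarrow> real^'n \<Rightarrow> real) \<Rightarrow> 'n \<Rightarrow> 'n \<Rightarrow> 'n \<Rightarrow> real^'n \<Rightarrow> real" where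
  "nabla_mixed G T k l i x = pd k (T l i) x
     - (\<Sum>m\<in>UNIV. christoffel G m k l x * T m i x)
     + (\<Sum>m\<in>UNIV. christoffel G i k m x * T l m x)"

definition grad :: "'n::finite local_metric \<Rightarrow> (real^'n \<Rightarrow> real) \<Rightarrow> real^'n \<Rightarrow> real^'n" where
  "grad G f x = (\<chi> i. \<Sum>j\<in>UNIV. ginv G i j x * pd j f x)"

definition divergence :: "'n::finite local_metric \<Rightarrow> (real^'n \<Rightarrow> real^'n) \<Rightarrow> real^'n \<Rightarrow> real" where
  "divergence G X x = (\<Sum>i\<in>UNIV. nabla_vec G X i i x)"

definition laplace_fun :: "'n::finite local_metric \<Rightarrow> (real^'n \<Rightarrow> real) \<Rightarrow> real^'n \<Rightarrow> real" where
  "laplace_fun G f x =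
     (\<Sum>k\<in>UNIV. \<Sum>l\<in>UNIV. ginv G k l x * nabla_covec G (\<lambda>j. pd j f) k l x)"

definition laplace_vec :: "'n::finite local_metric \<Rightarrow> (real^'n \<Rightarrow> real^'n) \<Rightarrow> real^'n \<Rightarrow> real^'n" where
  "laplace_vec G X x =
     (\<chi> i. \<Sum>k\<in>UNIV. \<Sum>l\<in>UNIV. ginv G k l x * nabla_mixed G (nabla_vec G X) k l i x)"

text \<open>\<open>riemann G l i j k\<close> is the \<open>\<partial>\<^sub>l\<close>-component of
  \<open>\<nabla>\<^sub>i \<nabla>\<^sub>j \<partial>\<^sub>k - \<nabla>\<^sub>j \<nabla>\<^sub>i \<partial>\<^sub>k\<close>; with the contraction below, round spheres have positive
  Ricci curvature.\<close>

definition riemann :: "'n::finite local_metric \<Rightarrow> 'n \<Rightarrow> 'n \<Rightarrow> 'n \<Rightarrow> 'n \<Rightarrow> real^'n \<Rightarrow> real" where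
  "riemann G l i j k x =
     pd i (christoffel G l j k) x - pd j (christoffel G l i k) x
     + (\<Sum>m\<in>UNIV. christoffel G l i m x * christoffel G m j k x)
     - (\<Sum>m\<in>UNIV. christoffel G l j m x * christoffel G m i k x)"

definition ricci :: "'n::finite local_metric \<Rightarrow> 'n \<Rightarrow> 'n \<Rightarrow> real^'n \<Rightarrow> real" where
  "ricci G j k x = (\<Sum>i\<in>UNIV. riemann G i i j k x)"

text \<open>The vector field \<open>R\<^sup>i\<^sub>j X\<^sup>j\<close>.\<close>

definition ricci_vec :: "'n::finite local_metric \<Rightarrow> (real^'n \<Rightarrow> real^'n) \<Rightarrow> real^'n \<Rightarrow> real^'n" where
  "ricci_vec G X x = (\<chi> i. \<Sum>j\<in>UNIV. (\<Sum>k\<in>UNIV. ginv G i k x * ricci G k j x) * X x $ j)"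

definition scalar_curvature :: "'n::finite local_metric \<Rightarrow> real^'n \<Rightarrow> real" where
  "scalar_curvature G x = (\<Sum>i\<in>UNIV. \<Sum>j\<in>UNIV. ginv G i j x * ricci G i j x)"

definition lower :: "'n::finite local_metric \<Rightarrow> (real^'n \<Rightarrow> real^'n) \<Rightarrow> 'n \<Rightarrow> real^'n \<Rightarrow> real" where
  "lower G X i x = (\<Sum>k\<in>UNIV. G x $ i $ k * X x $ k)"

definition Def :: "'n::finite local_metric \<Rightarrow> (real^'n \<Rightarrow> real^'n) \<Rightarrow> 'n \<Rightarrow> 'n \<Rightarrow> real^'n \<Rightarrow> real" where
  "Def G X i j x = (1/2) * (nabla_covec G (lower G X) i j x + nabla_covec G (lower G X) j i x)"

definition inner_vec ::
  "'n::finite local_metric \<Rightarrow> (real^'n \<Rightarrow> real^'n) \<Rightarrow> (real^'n \<Rightarrow> real^'n) \<Rightarrow> real^'n \<Rightarrow> real" where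
  "inner_vec G X Y x = (\<Sum>i\<in>UNIV. \<Sum>j\<in>UNIV. G x $ i $ j * X x $ i * Y x $ j)"

definition inner_tensor :: "'n::finite local_metric \<Rightarrow> ('n \<Rightarrow> 'n \<Rightarrow> real^'n \<Rightarrow> real) \<Rightarrow>
    ('n \<Rightarrow> 'n \<Rightarrow> real^'n \<Rightarrow> real) \<Rightarrow> real^'n \<Rightarrow> real" where
  "inner_tensor G S T x = (\<Sum>i\<in>UNIV. \<Sum>j\<in>UNIV. S i j x *
     (\<Sum>k\<in>UNIV. \<Sum>l\<in>UNIV. ginv G i k x * ginv G j l x * T k l x))"

text \<open>The connection defined by the Christoffel symbols is torsion-free and metric, so it is the
  Levi-Civita connection.\<close>

lemma pd_cong:
  fixes f h :: "real^'n::finite \<Rightarrow> real"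
  assumes "open V" "x \<in> V" "\<And>y. y \<in> V \<Longrightarrow> f y = h y"
  shows "pd i f x = pd i h x"
proof -
  have "(f has_derivative D) (at x) \<longleftrightarrow> (h has_derivative D) (at x)" for D
    using assms by (metis has_derivative_transform_within_open)
  then show ?thesis
    by (simp add: pd_def frechet_derivative_def)
qed

lemma pd_metric_symmetric:
  fixes G :: "'n::finite local_metric"
  assumes "open V" "x \<in> V" "\<And>y. y \<in> V \<Longrightarrow> transpose (G y) = G y"
  shows "pd k (\<lambda>y. G y $ i $ j) x = pd k (\<lambda>y. G y $ j $ i) x"
proof (rule pd_cong[OF assms(1,2)])
  fix y assume "y \<in> V"
  then have "transpose (G y) $ j $ i = G y $ j $ i"
    using assms(3) by simp
  then show "G y $ i $ j = G y $ j $ i"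
    by (simp add: transpose_def)
qed

lemma christoffel_torsion_free:
  fixes G :: "'n::finite local_metric"
  assumes "open V" "x \<in> V" "\<And>y. y \<in> V \<Longrightarrow> transpose (G y) = G y"
  shows "christoffel G k i j x = christoffel G k j i x"
proof -
  have sym: "pd l (\<lambda>y. G y $ i $ j) x = pd l (\<lambda>y. G y $ j $ i) x" for l
    using pd_metric_symmetric[of V x G l i j] assms by blast
  show ?thesis
    by (simp add: christoffel_def sym add.commute)
qed

lemma christoffel_metric:
  fixes G :: "'n::finite local_metric"
  assumes V: "open V" "x \<in> V" and sym: "\<And>y. y \<in> V \<Longrightarrow> transpose (G y) = G y"
    and inv: "invertible (G x)"
  shows "pd k (\<lambda>y. G y $ i $ j) x =
    (\<Sum>l\<in>UNIV. christoffel G l k i x * G x $ l $ j + christoffel G l k j x * G x $ i $ l)"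
proof -
  define C where "C k i m =
    pd k (\<lambda>y. G y $ i $ m) x + pd i (\<lambda>y. G y $ k $ m) x - pd m (\<lambda>y. G y $ k $ i) x" for k i m
  have G: "G x $ a $ b = G x $ b $ a" for a b
    using sym[OF V(2)] by (metis transpose_def vec_lambda_beta)
  have id: "(\<Sum>l\<in>UNIV. G x $ a $ l * ginv G l m x) = (if a = m then 1 else 0)" for a m
  proof -
    have "G x ** matrix_inv (G x) = mat 1"
      using inv by (metis (mono_tags, lifting) invertible_def matrix_inv_def someI_ex)
    then have "(G x ** matrix_inv (G x)) $ a $ m = (mat 1 :: real^'n^'n) $ a $ m"
      by simp
    then show ?thesis
      by (simp add: matrix_matrix_mult_def mat_def ginv_def)
  qed
  have low: "(\<Sum>l\<in>UNIV. christoffel G l k i x * G x $ a $ l) = C k i a / 2" for k i a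
  proof -
    have "(\<Sum>l\<in>UNIV. christoffel G l k i x * G x $ a $ l) =
        (\<Sum>l\<in>UNIV. \<Sum>m\<in>UNIV. (G x $ a $ l * ginv G l m x) * (C k i m / 2))"
      unfolding christoffel_def C_def
      by (simp add: sum_distrib_left sum_distrib_right algebra_simps add_divide_distrib diff_divide_distrib)
    also have "\<dots> = (\<Sum>m\<in>UNIV. (\<Sum>l\<in>UNIV. G x $ a $ l * ginv G l m x) * (C k i m / 2))"
      by (subst sum.swap) (simp add: sum_distrib_right sum_divide_distrib)
    also have "\<dots> = C k i a / 2"
      by (simp add: id if_distrib[of "\<lambda>z. z * _"] flip: sum_divide_distrib cong: if_cong)
    finally show ?thesis .
  qed
  have "(\<Sum>l\<in>UNIV. christoffel G l k i x * G x $ l $ j + christoffel G l k j x * G x $ i $ l) =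
      C k i j / 2 + C k j i / 2"
    using low[of k i j] low[of k j i] by (simp add: sum.distrib G[of _ j])
  also have "\<dots> = pd k (\<lambda>y. G y $ i $ j) x"
    using pd_metric_symmetric[of V x G k i j] V sym by (simp add: C_def field_simps)
  finally show ?thesis by simp
qed


section \<open>Integration over the manifold\<close>

definition partition_of_unity :: "'m topology \<Rightarrow> ('m, 'n::finite) chart set \<Rightarrow>
    ('m, 'n) chart set \<Rightarrow> (('m, 'n) chart \<Rightarrow> 'm \<Rightarrow> real) \<Rightarrow> bool" where
  "partition_of_unity M A F \<rho> \<longleftrightarrow> finite F \<and> F \<subseteq> A \<and>
     (\<forall>c\<in>F. smooth_fun A (\<rho> c) \<and> (\<forall>p\<in>topspace M. \<rho> c p \<ge> 0) \<and>
        M closure_of {p \<in> topspace M. \<rho> c p \<noteq> 0} \<subseteq> chart_dom c) \<and>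
     (\<forall>p\<in>topspace M. (\<Sum>c\<in>F. \<rho> c p) = 1)"

text \<open>
  The integral with respect to the Riemannian volume \<open>dV = sqrt (det g) dx\<close> of a scalar field
  given by its coordinate expressions \<open>f\<close>. As usual, it is computed from a partition of unity;
  one exists on a closed manifold, and the value does not depend on which one is selected.
  No orientation is involved.
\<close>

definition manifold_integral :: "'m topology \<Rightarrow> ('m, 'n::finite) chart set \<Rightarrow>
    (('m, 'n) chart \<Rightarrow> 'n local_metric) \<Rightarrow> (('m, 'n) chart \<Rightarrow> real^'n \<Rightarrow> real) \<Rightarrow> real" where
  "manifold_integral M A g f =
     (let (F, \<rho>) = (SOME (F, \<rho>). partition_of_unity M A F \<rho>) in
      \<Sum>c\<in>F. LINT x:chart_img c|lborel. \<rho> c (chart_inv c x) * f c x * sqrt (det (g c x)))"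


section \<open>The flow and the functional\<close>

text \<open>\<open>t\<close>-derivatives are taken within \<open>[0,\<infinity>)\<close>, hence one-sided at \<open>t = 0\<close>.\<close>

definition flow_solution :: "('m, 'n::finite) chart set \<Rightarrow> (('m, 'n) chart \<Rightarrow> 'n local_metric) \<Rightarrow>
    (('m, 'n) chart \<Rightarrow> real^'n \<Rightarrow> real^'n) \<Rightarrow>
    (real \<Rightarrow> ('m, 'n) chart \<Rightarrow> real^'n \<Rightarrow> real^'n) \<Rightarrow> bool" where
  "flow_solution A g X0 X \<longleftrightarrow>
     smooth_vector_field_family A X \<and>
     (\<forall>c\<in>A. \<forall>x\<in>chart_img c. X 0 c x = X0 c x) \<and>
     (\<forall>t\<ge>0. \<forall>c\<in>A. \<forall>x\<in>chart_img c. \<forall>i.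
        ((\<lambda>s. X s c x $ i) has_real_derivative
           (laplace_vec (g c) (X t c) x $ i
            + grad (g c) (divergence (g c) (X t c)) x $ i
            + ricci_vec (g c) (X t c) x $ i)) (at t within {0..}))"

definition I_functional :: "'m topology \<Rightarrow> ('m, 'n::finite) chart set \<Rightarrow>
    (('m, 'n) chart \<Rightarrow> 'n local_metric) \<Rightarrow> (('m, 'n) chart \<Rightarrow> real^'n \<Rightarrow> real^'n) \<Rightarrow> real" where
  "I_functional M A g X =
     manifold_integral M A g (\<lambda>c. inner_vec (g c) (grad (g c) (scalar_curvature (g c))) (X c))"

end

theory Submission
  imports Defs
begin

text \<open>
  Write \<open>L\<close> for the operator \<open>\<Delta> X + \<nabla> div X + Ric X\<close> and \<open>A = \<nabla>X\<close> for the endomorphism given by the covariant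
  derivative, with \<open>g\<close>-adjoint \<open>A\<^sup>*\<close>. The Ricci identity gives \<open>L X = div (A + A\<^sup>*)\<close>, so the
  divergence of \<open>(A + A\<^sup>*) Y\<close> is \<open>\<langle>L X, Y\<rangle>\<close> plus a symmetric, positive semidefinite form in
  \<open>(\<nabla>X, \<nabla>Y)\<close>. By the divergence theorem \<open>L\<close> is symmetric and nonpositive in \<open>L\<^sup>2\<close>. Hence the
  derivative of \<open>\<I> (X t)\<close> is \<open>\<integral> \<langle>L \<nabla>R, X t\<rangle>\<close>; here \<open>L \<nabla>f = 2 \<nabla>\<Delta>f + 2 Ric \<nabla>f\<close> because the Hessian is
  symmetric, and one integration by parts with the contracted Bianchi identity gives the formula.

  No spectral theory is needed for the limit. Symmetry of \<open>L\<close> makes \<open>\<langle>X t, X s\<rangle>\<close> a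
  function of \<open>t + s\<close>, so that \<open>\<parallel>X t - X s\<parallel>\<^sup>2 = \<phi> t + \<phi> s - 2 \<phi> ((t + s) / 2)\<close> for \<open>\<phi> t = \<parallel>X t\<parallel>\<^sup>2\<close>, which is
  nonincreasing because \<open>L\<close> is nonpositive. Thus \<open>X t\<close> is Cauchy in \<open>L\<^sup>2\<close>, both \<open>\<I> (X t)\<close> and its
  derivative converge, and the limit of the derivative can only be \<open>0\<close>.
\<close>

section \<open>Calculus of smooth functions\<close>

text \<open>The obstacle is that all data are components in charts while the argument is global.
  Pointwise identities are proved inside one chart, in matrix form. Coordinate changes matter only
  for the divergence theorem, which is applied to two fields: \<open>def_vec\<close>, which carries
  the symmetry of the flow operator L, and \<open>flux\<close>, which carries the integration by
  parts. One fixed partition of unity serves for all integrals; in the divergence theorem the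
  derivatives of its members cancel because they sum to 1.

  The coefficient of R^2 comes from the contracted Bianchi identity: div(Ric X) contains <\<nabla>R,
  X> / 2, and multiplied by R this is a derivative of R^2 along X, which one more integration by
  parts turns into a multiple of R^2 div X.

  The limit needs no bound on derivatives of \<open>X t\<close>. Both \<I>(X t) and its time
  derivative are pairings of \<open>X t\<close> with fixed fields, \<nabla>R and L \<nabla>R, so by
  Cauchy-Schwarz the L2 Cauchy property is all that is required.\<close>

lemma Ck_on_cong:
  assumes "\<And>x. x \<in> S \<Longrightarrow> f x = h x"
  shows "Ck_on k f S \<longleftrightarrow> Ck_on k h S"
  using assms
proof (induction k arbitrary: f h)
  case 0
  then show ?case by (auto cong: continuous_on_cong)
next
  case (Suc k)
  have der: "(f has_derivative D) (at x within S) \<longleftrightarrow> (h has_derivative D) (at x within S)"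
    if "x \<in> S" for D x
    using Suc.prems that by (metis has_derivative_transform)
  then have "frechet_derivative f (at x within S) = frechet_derivative h (at x within S)" if "x \<in> S" for x
    unfolding frechet_derivative_def using that by simp
  then have "Ck_on k (\<lambda>x. frechet_derivative f (at x within S) v) S
      \<longleftrightarrow> Ck_on k (\<lambda>x. frechet_derivative h (at x within S) v) S" for v
    by (intro Suc.IH) simp
  moreover have "f differentiable_on S \<longleftrightarrow> h differentiable_on S"
    unfolding differentiable_on_def differentiable_def using der by blast
  ultimately show ?case by simp
qed

text \<open>At a point of an open set the derivative within the set is the full one. This rule and
  \<open>Ck_on_SucD\<close> encapsulate that, so later inductions may use any derivative
  \<open>f'\<close>.\<close>

lemma Ck_on_SucI:
  assumes "open S" "\<And>x. x \<in> S \<Longrightarrow> (f has_derivative f' x) (at x)"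
    and "\<And>v. v \<in> Basis \<Longrightarrow> Ck_on k (\<lambda>x. f' x v) S"
  shows "Ck_on (Suc k) f S"
proof -
  have "frechet_derivative f (at x within S) = f' x" if "x \<in> S" for x
    using assms(1,2) that by (metis at_within_open frechet_derivative_at)
  then have "Ck_on k (\<lambda>x. frechet_derivative f (at x within S) v) S" if "v \<in> Basis" for v
    using assms(3)[OF that] by (subst Ck_on_cong[where h = "\<lambda>x. f' x v"]) auto
  moreover have "f differentiable_on S"
    using assms(1,2) by (meson differentiableI differentiable_at_imp_differentiable_on)
  ultimately show ?thesis by simp
qed

lemma Ck_on_SucD:
  assumes "open S" "Ck_on (Suc k) f S"
  shows "x \<in> S \<Longrightarrow> (f has_derivative frechet_derivative f (at x)) (at x)"
    and "v \<in> Basis \<Longrightarrow> Ck_on k (\<lambda>x. frechet_derivative f (at x) v) S"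
proof -
  show "(f has_derivative frechet_derivative f (at x)) (at x)" if "x \<in> S"
    using assms that by (auto simp: differentiable_on_def at_within_open[OF _ assms(1)] frechet_derivative_works)
  assume "v \<in> Basis"
  then have "Ck_on k (\<lambda>x. frechet_derivative f (at x within S) v) S" using assms(2) by simp
  then show "Ck_on k (\<lambda>x. frechet_derivative f (at x) v) S"
    by (subst Ck_on_cong[where h = "\<lambda>x. frechet_derivative f (at x within S) v"])
      (auto simp: at_within_open[OF _ assms(1)])
qed

lemma Ck_on_Suc_imp:
  assumes "open S" "Ck_on (Suc k) f S"
  shows "Ck_on k f S"
  using assms(2)
proof (induction k arbitrary: f)
  case 0
  then show ?case by (auto simp: differentiable_imp_continuous_on)
next
  case (Suc k)
  show ?case
    by (rule Ck_on_SucI[OF assms(1) Ck_on_SucD(1)[OF assms(1) Suc.prems]])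
      (auto intro: Suc.IH Ck_on_SucD(2)[OF assms(1) Suc.prems])
qed

lemma Ck_on_subset:
  assumes "open S" "open T" "T \<subseteq> S" "Ck_on k f S"
  shows "Ck_on k f T"
  using assms(4)
proof (induction k arbitrary: f)
  case 0
  then show ?case using assms(3) continuous_on_subset by auto
next
  case (Suc k)
  show ?case
    using assms(3) by (intro Ck_on_SucI[OF assms(2) Ck_on_SucD(1)[OF assms(1) Suc.prems]])
      (auto intro: Suc.IH Ck_on_SucD(2)[OF assms(1) Suc.prems])
qed

text \<open>Being C^k on open sets is a local property. This is what glues a function to 0 outside
  its support, for zero extensions as well as for bump functions on the manifold.\<close>

lemma Ck_on_Union:
  assumes "\<And>T. T \<in> \<T> \<Longrightarrow> open T" "\<And>T. T \<in> \<T> \<Longrightarrow> Ck_on k f T"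
  shows "Ck_on k f (\<Union>\<T>)"
  using assms(2)
proof (induction k arbitrary: f)
  case 0
  then have "\<forall>x\<in>\<Union>\<T>. isCont f x"
    using assms(1) by (metis Ck_on.simps(1) UnionE continuous_on_eq_continuous_at)
  then show ?case by (simp add: continuous_at_imp_continuous_on)
next
  case (Suc k)
  show ?case
  proof (rule Ck_on_SucI)
    show "open (\<Union>\<T>)" using assms(1) by auto
    show "(f has_derivative frechet_derivative f (at x)) (at x)" if "x \<in> \<Union>\<T>" for x
      using that Ck_on_SucD(1)[OF assms(1) Suc.prems] by blast
    show "Ck_on k (\<lambda>x. frechet_derivative f (at x) v) (\<Union>\<T>)" if "v \<in> Basis" for v
      using that Ck_on_SucD(2)[OF assms(1) Suc.prems] by (intro Suc.IH) auto
  qed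
qed

lemma Ck_on_const: "open S \<Longrightarrow> Ck_on k (\<lambda>x. c) S"
proof (induction k arbitrary: c)
  case (Suc k)
  then show ?case by (intro Ck_on_SucI[where f' = "\<lambda>x v. 0"]) auto
qed auto

lemma Ck_on_bounded_linear:
  assumes "open S" "bounded_linear L" "Ck_on k f S"
  shows "Ck_on k (\<lambda>x. L (f x)) S"
  using assms(3)
proof (induction k arbitrary: f)
  case 0
  then show ?case using assms(2) by (auto intro: bounded_linear.continuous_on)
next
  case (Suc k)
  show ?case
    by (rule Ck_on_SucI[OF assms(1) bounded_linear.has_derivative[OF assms(2) Ck_on_SucD(1)[OF assms(1) Suc.prems]]])
      (auto intro: Suc.IH Ck_on_SucD(2)[OF assms(1) Suc.prems])
qed

lemma Ck_on_linear:
  fixes L :: "'a::euclidean_space \<Rightarrow> 'b::real_normed_vector"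
  assumes "open S" "bounded_linear L"
  shows "Ck_on k L S"
proof (cases k)
  case (Suc m)
  show ?thesis unfolding Suc
    by (rule Ck_on_SucI[OF assms(1)]) (auto intro: bounded_linear_imp_has_derivative assms Ck_on_const)
qed (auto intro: assms linear_continuous_on)

lemma Ck_on_add:
  assumes "open S" "Ck_on k f S" "Ck_on k h S"
  shows "Ck_on k (\<lambda>x. f x + h x) S"
  using assms(2,3)
proof (induction k arbitrary: f h)
  case 0
  then show ?case by (auto intro: continuous_on_add)
next
  case (Suc k)
  note f = Ck_on_SucD[OF assms(1) Suc.prems(1)] and h = Ck_on_SucD[OF assms(1) Suc.prems(2)]
  show ?case
    by (rule Ck_on_SucI[OF assms(1) has_derivative_add[OF f(1) h(1)] Suc.IH[OF f(2) h(2)]])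
qed

text \<open>The product rule yields two terms of the same bilinear form, so one induction covers
  scalar, inner and matrix products; \<open>Ck_on_Suc_imp\<close> lowers the undifferentiated factor
  to order \<open>k\<close>.\<close>

lemma Ck_on_bilinear:
  assumes "open S" "bounded_bilinear B" "Ck_on k f S" "Ck_on k h S"
  shows "Ck_on k (\<lambda>x. B (f x) (h x)) S"
  using assms(3,4)
proof (induction k arbitrary: f h)
  case 0
  then show ?case using bounded_bilinear.continuous_on[OF assms(2)] by auto
next
  case (Suc k)
  note f = Ck_on_SucD[OF assms(1) Suc.prems(1)] and h = Ck_on_SucD[OF assms(1) Suc.prems(2)]
  show ?case
  proof (rule Ck_on_SucI[OF assms(1)])
    show "((\<lambda>x. B (f x) (h x)) has_derivative (\<lambda>v. B (f x) (frechet_derivative h (at x) v) +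
        B (frechet_derivative f (at x) v) (h x))) (at x)" if "x \<in> S" for x
      by (rule bounded_bilinear.FDERIV[OF assms(2) f(1)[OF that] h(1)[OF that]])
    show "Ck_on k (\<lambda>x. B (f x) (frechet_derivative h (at x) v) + B (frechet_derivative f (at x) v) (h x)) S"
      if "v \<in> Basis" for v
      by (rule Ck_on_add[OF assms(1) Suc.IH[OF Ck_on_Suc_imp[OF assms(1) Suc.prems(1)] h(2)[OF that]]
            Suc.IH[OF f(2)[OF that] Ck_on_Suc_imp[OF assms(1) Suc.prems(2)]]])
  qed
qed

lemma Ck_on_sum:
  assumes "open S" "\<And>i. i \<in> I \<Longrightarrow> Ck_on k (f i) S"
  shows "Ck_on k (\<lambda>x. \<Sum>i\<in>I. f i x) S"
  using assms(2) by (induction I rule: infinite_finite_induct)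
    (auto intro: Ck_on_const Ck_on_add assms(1))

lemma Ck_on_compose:
  fixes f :: "'b::euclidean_space \<Rightarrow> 'c::real_normed_vector" and h :: "'a::euclidean_space \<Rightarrow> 'b"
  assumes "open S" "open T" "h ` S \<subseteq> T" "Ck_on k f T" "Ck_on k h S"
  shows "Ck_on k (\<lambda>x. f (h x)) S"
  using assms(4,5)
proof (induction k arbitrary: f)
  case 0
  then show ?case using assms(3) by (auto intro: continuous_on_compose2)
next
  case (Suc k)
  note f = Ck_on_SucD[OF assms(2) Suc.prems(1)] and h = Ck_on_SucD[OF assms(1) Suc.prems(2)]
  have lin: "bounded_linear (frechet_derivative f (at y))" if "y \<in> T" for y
    using f(1)[OF that] has_derivative_bounded_linear by blast
  \<comment> \<open>The chain rule differentiates \<open>f\<close> in a direction that varies with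
    \<open>x\<close>, whereas the induction hypothesis speaks of fixed basis directions. Expanding
    the direction in the basis separates the two dependences.\<close>
  have eq: "frechet_derivative f (at (h x)) (frechet_derivative h (at x) v) =
      (\<Sum>b\<in>Basis. (frechet_derivative h (at x) v \<bullet> b) *\<^sub>R frechet_derivative f (at (h x)) b)" if "x \<in> S" for x v
  proof -
    have "frechet_derivative f (at (h x)) (\<Sum>b\<in>Basis. (frechet_derivative h (at x) v \<bullet> b) *\<^sub>R b) =
      (\<Sum>b\<in>Basis. (frechet_derivative h (at x) v \<bullet> b) *\<^sub>R frechet_derivative f (at (h x)) b)"
      using lin[of "h x"] assms(3) that
      by (simp add: bounded_linear.linear linear_sum linear_cmul image_subset_iff)
    then show ?thesis by (simp add: euclidean_representation)
  qed
  show ?case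
  proof (rule Ck_on_SucI[OF assms(1)])
    show "((\<lambda>x. f (h x)) has_derivative (\<lambda>v. frechet_derivative f (at (h x)) (frechet_derivative h (at x) v))) (at x)"
      if "x \<in> S" for x
      using has_derivative_compose[OF h(1)[OF that] f(1)] assms(3) that by auto
    show "Ck_on k (\<lambda>x. frechet_derivative f (at (h x)) (frechet_derivative h (at x) v)) S" if v: "v \<in> Basis" for v
    proof (subst Ck_on_cong[OF eq])
      show "Ck_on k (\<lambda>x. \<Sum>b\<in>Basis. (frechet_derivative h (at x) v \<bullet> b) *\<^sub>R frechet_derivative f (at (h x)) b) S"
        by (intro Ck_on_sum Ck_on_bilinear[OF assms(1) bounded_bilinear_scaleR]
            Ck_on_bounded_linear[OF assms(1) bounded_linear_inner_left] h(2) v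
            Suc.IH f(2) assms(1) Ck_on_Suc_imp[OF assms(1) Suc.prems(2)])
    qed
  qed
qed

lemma smooth_onD: "smooth_on f S \<Longrightarrow> Ck_on k f S"
  by (simp add: smooth_on_def)

lemma smooth_on_cong: "(\<And>x. x \<in> S \<Longrightarrow> f x = h x) \<Longrightarrow> smooth_on f S \<longleftrightarrow> smooth_on h S"
  using Ck_on_cong[of S f h] by (simp add: smooth_on_def)

lemma smooth_on_imp_continuous_on: "smooth_on f S \<Longrightarrow> continuous_on S f"
  using smooth_onD[of f S 0] by simp

lemma smooth_on_has_derivative:
  "smooth_on f S \<Longrightarrow> open S \<Longrightarrow> x \<in> S \<Longrightarrow> (f has_derivative frechet_derivative f (at x)) (at x)"
  using Ck_on_SucD(1) smooth_onD by blast

lemma smooth_on_differentiable: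
  "smooth_on f S \<Longrightarrow> open S \<Longrightarrow> x \<in> S \<Longrightarrow> f differentiable (at x)"
  using smooth_on_has_derivative differentiableI by blast

lemma smooth_on_subset: "smooth_on f S \<Longrightarrow> open S \<Longrightarrow> open T \<Longrightarrow> T \<subseteq> S \<Longrightarrow> smooth_on f T"
  using Ck_on_subset unfolding smooth_on_def by blast

lemma smooth_on_Union:
  "(\<And>T. T \<in> \<T> \<Longrightarrow> open T) \<Longrightarrow> (\<And>T. T \<in> \<T> \<Longrightarrow> smooth_on f T) \<Longrightarrow> smooth_on f (\<Union>\<T>)"
  using Ck_on_Union unfolding smooth_on_def by blast

lemma smooth_on_const [intro]: "open S \<Longrightarrow> smooth_on (\<lambda>x. c) S"
  using Ck_on_const unfolding smooth_on_def by blast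

lemma smooth_on_linear: "open S \<Longrightarrow> bounded_linear L \<Longrightarrow> smooth_on L S"
  using Ck_on_linear unfolding smooth_on_def by blast

lemma smooth_on_bounded_linear: "smooth_on f S \<Longrightarrow> open S \<Longrightarrow> bounded_linear L \<Longrightarrow> smooth_on (\<lambda>x. L (f x)) S"
  using Ck_on_bounded_linear unfolding smooth_on_def by blast

lemma smooth_on_add: "smooth_on f S \<Longrightarrow> smooth_on h S \<Longrightarrow> open S \<Longrightarrow> smooth_on (\<lambda>x. f x + h x) S"
  using Ck_on_add unfolding smooth_on_def by blast

lemma smooth_on_scaleR: "smooth_on f S \<Longrightarrow> smooth_on h S \<Longrightarrow> open S \<Longrightarrow> smooth_on (\<lambda>x. f x *\<^sub>R h x) S"
  using Ck_on_bilinear[OF _ bounded_bilinear_scaleR] unfolding smooth_on_def by blast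

lemma smooth_on_mult:
  fixes f :: "'a::euclidean_space \<Rightarrow> 'b::real_normed_algebra"
  shows "smooth_on f S \<Longrightarrow> smooth_on h S \<Longrightarrow> open S \<Longrightarrow> smooth_on (\<lambda>x. f x * h x) S"
  using Ck_on_bilinear[OF _ bounded_bilinear_mult] unfolding smooth_on_def by blast

lemma smooth_on_inner:
  fixes f :: "'a::euclidean_space \<Rightarrow> 'b::real_inner"
  shows "smooth_on f S \<Longrightarrow> smooth_on h S \<Longrightarrow> open S \<Longrightarrow> smooth_on (\<lambda>x. f x \<bullet> h x) S"
  using Ck_on_bilinear[OF _ bounded_bilinear_inner] unfolding smooth_on_def by blast

lemma smooth_on_minus: "smooth_on f S \<Longrightarrow> open S \<Longrightarrow> smooth_on (\<lambda>x. - f x) S"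
  by (rule smooth_on_bounded_linear) (auto intro: bounded_linear_minus bounded_linear_ident)

lemma smooth_on_diff:
  assumes "smooth_on f S" "smooth_on h S" "open S" shows "smooth_on (\<lambda>x. f x - h x) S"
  using smooth_on_add[OF assms(1) smooth_on_minus[OF assms(2,3)] assms(3)] by simp

lemma smooth_on_sum:
  "open S \<Longrightarrow> (\<And>i. i \<in> I \<Longrightarrow> smooth_on (f i) S) \<Longrightarrow> smooth_on (\<lambda>x. \<Sum>i\<in>I. f i x) S"
  by (simp add: smooth_on_def Ck_on_sum)

lemma smooth_on_prod:
  fixes f :: "'i \<Rightarrow> 'a::euclidean_space \<Rightarrow> real"
  shows "open S \<Longrightarrow> (\<And>i. i \<in> I \<Longrightarrow> smooth_on (f i) S) \<Longrightarrow> smooth_on (\<lambda>x. \<Prod>i\<in>I. f i x) S"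
  by (induction I rule: infinite_finite_induct) (simp_all add: smooth_on_mult smooth_on_const)

lemma smooth_on_compose:
  fixes f :: "'b::euclidean_space \<Rightarrow> 'c::real_normed_vector" and h :: "'a::euclidean_space \<Rightarrow> 'b"
  assumes "smooth_on f T" "smooth_on h S" "open S" "open T" "h ` S \<subseteq> T"
  shows "smooth_on (\<lambda>x. f (h x)) S"
  using assms Ck_on_compose unfolding smooth_on_def by blast

lemma smooth_on_nth: "smooth_on f S \<Longrightarrow> open S \<Longrightarrow> smooth_on (\<lambda>x. f x $ i) S"
  by (rule smooth_on_bounded_linear) (auto intro: bounded_linear_vec_nth)

lemma smooth_on_frechet:
  "smooth_on f S \<Longrightarrow> open S \<Longrightarrow> v \<in> Basis \<Longrightarrow> smooth_on (\<lambda>x. frechet_derivative f (at x) v) S"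
  unfolding smooth_on_def using Ck_on_SucD(2) by blast

lemma smooth_on_pd: "smooth_on f S \<Longrightarrow> open S \<Longrightarrow> smooth_on (pd i f) S"
  using smooth_on_frechet[of f S "axis i 1"] by (auto simp: pd_def[abs_def] axis_in_Basis_iff)

lemma smooth_on_vec:
  fixes f :: "'a::euclidean_space \<Rightarrow> real^'n::finite"
  assumes "\<And>i. smooth_on (\<lambda>x. f x $ i) S" "open S"
  shows "smooth_on f S"
proof -
  have "smooth_on (\<lambda>x. \<Sum>i\<in>UNIV. (f x $ i) *\<^sub>R axis i 1) S"
    by (intro smooth_on_sum smooth_on_scaleR smooth_on_const assms)
  also have "(\<lambda>x. \<Sum>i\<in>UNIV. (f x $ i) *\<^sub>R axis i 1) = f"
    by (simp add: fun_eq_iff vec_eq_iff axis_def if_distrib cong: if_cong)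
  finally show ?thesis .
qed

text \<open>A class of functions closed under differentiation consists of smooth functions. It is
  applied to multiples of powers and to the functions p(1/t) exp(-1/t).\<close>

lemma smooth_on_real_deriv_induct:
  fixes P :: "(real \<Rightarrow> real) \<Rightarrow> bool"
  assumes "open S" "\<And>f. P f \<Longrightarrow> \<exists>f'. P f' \<and> (\<forall>x\<in>S. (f has_real_derivative f' x) (at x))" "P f"
  shows "smooth_on f S"
proof -
  have "Ck_on k f S" if "P f" for k f
    using that
  proof (induction k arbitrary: f)
    case 0
    then show ?case
      using assms(2) by (metis Ck_on.simps(1) DERIV_continuous_on assms(1) at_within_open)
  next
    case (Suc k)
    obtain f' where "P f'" "\<forall>x\<in>S. (f has_real_derivative f' x) (at x)"
      using assms(2)[OF Suc.prems] by blast
    then show ?case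
      using Suc.IH[of f'] by (intro Ck_on_SucI[OF assms(1), where f' = "\<lambda>x v. f' x * v"])
        (auto simp: has_field_derivative_def)
  qed
  then show ?thesis using assms(3) by (simp add: smooth_on_def)
qed

text \<open>Multiples of powers are closed under differentiation on the positive axis. The exponents
  1/2 and -1 then give smooth square roots and quotients.\<close>

lemma smooth_on_powr: "smooth_on (\<lambda>x::real. x powr a) {0<..}"
proof (rule smooth_on_real_deriv_induct[where P = "\<lambda>f. \<exists>c b. \<forall>x>0. f x = c * x powr b"])
  fix f :: "real \<Rightarrow> real"
  assume "\<exists>c b. \<forall>x>0. f x = c * x powr b"
  then obtain c b where f: "\<And>x. x > 0 \<Longrightarrow> f x = c * x powr b" by blast
  have "(f has_real_derivative (c * b) * x powr (b - 1)) (at x)" if "x > 0" for x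
  proof (rule has_field_derivative_transform_within_open[of "\<lambda>x. c * x powr b" _ _ "{0<..}"])
    show "((\<lambda>x. c * x powr b) has_real_derivative c * b * x powr (b - 1)) (at x)"
      using that by (auto intro!: derivative_eq_intros simp: powr_diff)
  qed (use that f in auto)
  then show "\<exists>f'. (\<exists>c b. \<forall>x>0. f' x = c * x powr b) \<and> (\<forall>x\<in>{0<..}. (f has_real_derivative f' x) (at x))"
    by (intro exI[of _ "\<lambda>x. (c * b) * x powr (b - 1)"]) auto
qed (simp, rule exI[of _ 1], rule exI[of _ a], simp)

lemma smooth_on_sqrt:
  assumes "smooth_on f S" "open S" "\<And>x. x \<in> S \<Longrightarrow> f x > (0::real)"
  shows "smooth_on (\<lambda>x. sqrt (f x)) S"
proof -
  have "smooth_on (\<lambda>x. f x powr (1/2)) S"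
    using assms by (intro smooth_on_compose[OF smooth_on_powr]) auto
  then show ?thesis
    using smooth_on_cong[of S "\<lambda>x. sqrt (f x)" "\<lambda>x. f x powr (1/2)"] assms(3)
    by (simp add: powr_half_sqrt less_imp_le)
qed

lemma smooth_on_divide_pos:
  assumes "smooth_on f S" "smooth_on h S" "open S" "\<And>x. x \<in> S \<Longrightarrow> h x > (0::real)"
  shows "smooth_on (\<lambda>x. f x / h x) S"
proof -
  have "smooth_on (\<lambda>x. h x powr (-1)) S"
    using assms by (intro smooth_on_compose[OF smooth_on_powr]) auto
  then have "smooth_on (\<lambda>x. f x * h x powr (-1)) S" by (intro smooth_on_mult assms)
  then show ?thesis
    using smooth_on_cong[of S "\<lambda>x. f x / h x" "\<lambda>x. f x * h x powr (-1)"] assms(4)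
    by (simp add: powr_minus_divide less_imp_le)
qed

section \<open>Partial derivatives and their symmetry\<close>

lemma pd_eqI: "(f has_derivative D) (at x) \<Longrightarrow> pd i f x = D (axis i 1)"
  by (simp add: pd_def frechet_derivative_at[symmetric])

lemma pd_const [simp]: "pd i (\<lambda>x. c) x = 0"
  by (simp add: pd_def)

lemma pd_mult:
  assumes "f differentiable (at x)" "h differentiable (at x)"
  shows "pd i (\<lambda>x. f x * h x) x = f x * pd i h x + pd i f x * h x"
  using pd_eqI[OF has_derivative_mult[OF iffD1[OF frechet_derivative_works assms(1)] iffD1[OF frechet_derivative_works assms(2)]]]
  by (simp add: pd_def)

lemma pd_sum:
  assumes "\<And>a. a \<in> I \<Longrightarrow> f a differentiable (at x)"
  shows "pd i (\<lambda>x. \<Sum>a\<in>I. f a x) x = (\<Sum>a\<in>I. pd i (f a) x)"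
  using pd_eqI[OF has_derivative_sum[OF iffD1[OF frechet_derivative_works assms]], of I]
  by (simp add: pd_def)

lemma pd_cmult:
  assumes "f differentiable (at x)"
  shows "pd i (\<lambda>x. c * f x) x = c * pd i f x"
  using pd_mult[of "\<lambda>x. c" x f i] assms by simp

lemma sum_axis: "(\<Sum>i\<in>UNIV. (v::real^'n::finite) $ i *\<^sub>R axis i 1) = v"
  by (simp add: vec_eq_iff axis_def if_distrib cong: if_cong)

lemma DERIV_line:
  fixes f :: "real^'n::finite \<Rightarrow> real"
  assumes "f differentiable (at (p + s *\<^sub>R axis i 1))"
  shows "((\<lambda>s. f (p + s *\<^sub>R axis i 1)) has_real_derivative pd i f (p + s *\<^sub>R axis i 1)) (at s)"
proof -
  have "((\<lambda>s. p + s *\<^sub>R axis i 1) has_derivative (\<lambda>h. h *\<^sub>R axis i 1)) (at s)"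
    by (auto intro!: derivative_eq_intros)
  then have "((\<lambda>s. f (p + s *\<^sub>R axis i 1)) has_derivative
      (\<lambda>h. frechet_derivative f (at (p + s *\<^sub>R axis i 1)) (h *\<^sub>R axis i 1))) (at s)"
    by (rule has_derivative_compose) (use assms frechet_derivative_works in blast)
  moreover have "frechet_derivative f (at (p + s *\<^sub>R axis i 1)) (h *\<^sub>R axis i 1) =
      pd i f (p + s *\<^sub>R axis i 1) * h" for h
  proof -
    have "linear (frechet_derivative f (at (p + s *\<^sub>R axis i 1)))"
      using assms frechet_derivative_works has_derivative_linear by blast
    then show ?thesis by (simp add: linear_cmul pd_def)
  qed
  ultimately show ?thesis by (simp add: has_field_derivative_def)
qed

text \<open>The left-hand side is symmetric in \<open>i\<close> and \<open>j\<close>, which gives the symmetry of second derivatives.\<close>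

lemma second_difference_mvt:
  fixes f :: "real^'n::finite \<Rightarrow> real"
  assumes "smooth_on f U" "open U" "h > 0"
    and sub: "\<And>s t. 0 \<le> s \<Longrightarrow> s \<le> h \<Longrightarrow> 0 \<le> t \<Longrightarrow> t \<le> h \<Longrightarrow> x + s *\<^sub>R axis i 1 + t *\<^sub>R axis j 1 \<in> U"
  obtains s t where "0 \<le> s" "s \<le> h" "0 \<le> t" "t \<le> h"
    "f (x + h *\<^sub>R axis i 1 + h *\<^sub>R axis j 1) - f (x + h *\<^sub>R axis i 1) - f (x + h *\<^sub>R axis j 1) + f x
      = h * h * pd j (pd i f) (x + s *\<^sub>R axis i 1 + t *\<^sub>R axis j 1)"
proof -
  define P where "P s t = x + s *\<^sub>R axis i 1 + t *\<^sub>R axis j 1" for s t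
  have diff: "smooth_on k U \<Longrightarrow> 0 \<le> s \<Longrightarrow> s \<le> h \<Longrightarrow> 0 \<le> t \<Longrightarrow> t \<le> h \<Longrightarrow> k differentiable (at (P s t))"
    for k :: "real^'n \<Rightarrow> real" and s t
    unfolding P_def using sub smooth_on_differentiable[OF _ assms(2)] by blast
  have i: "((\<lambda>s. f (P s t)) has_real_derivative pd i f (P s t)) (at s)"
    if "0 \<le> s" "s \<le> h" "0 \<le> t" "t \<le> h" for s t
    using DERIV_line[of f "x + t *\<^sub>R axis j 1" s i] diff[OF assms(1) that]
    by (simp add: P_def algebra_simps)
  have "\<exists>s. 0 < s \<and> s < h \<and> (f (P h h) - f (P h 0)) - (f (P 0 h) - f (P 0 0)) = (h - 0) * (pd i f (P s h) - pd i f (P s 0))"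
    by (rule MVT2) (use assms(3) in \<open>auto intro!: DERIV_diff i\<close>)
  then obtain s where s: "0 < s" "s < h"
    "f (P h h) - f (P h 0) - (f (P 0 h) - f (P 0 0)) = h * (pd i f (P s h) - pd i f (P s 0))" by auto
  have j: "((\<lambda>t. pd i f (P s t)) has_real_derivative pd j (pd i f) (P s t)) (at t)"
    if "0 \<le> t" "t \<le> h" for t
    using DERIV_line[of "pd i f" "x + s *\<^sub>R axis i 1" t j] diff[OF smooth_on_pd[OF assms(1,2)], of s t] s that
    by (simp add: P_def algebra_simps)
  have "\<exists>t. 0 < t \<and> t < h \<and> pd i f (P s h) - pd i f (P s 0) = (h - 0) * pd j (pd i f) (P s t)"
    by (rule MVT2) (use assms(3) in \<open>auto intro!: j\<close>)
  then obtain t where "0 < t" "t < h" "pd i f (P s h) - pd i f (P s 0) = h * pd j (pd i f) (P s t)" by auto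
  then show thesis
    using that[of s t] s by (simp add: P_def algebra_simps)
qed

text \<open>By \<open>second_difference_mvt\<close> the same second difference, divided by h^2, is a
  value of each mixed derivative at some point near \<open>x\<close>; continuity then forces
  agreement at \<open>x\<close>.\<close>

lemma pd_commute:
  fixes f :: "real^'n::finite \<Rightarrow> real"
  assumes f: "smooth_on f U" and U: "open U" "x \<in> U"
  shows "pd i (pd j f) x = pd j (pd i f) x"
proof (rule ccontr)
  assume ne: "pd i (pd j f) x \<noteq> pd j (pd i f) x"
  \<comment> \<open>Half the gap: a common value cannot lie within \<open>e\<close> of both mixed
    derivatives.\<close>
  define e where "e = \<bar>pd i (pd j f) x - pd j (pd i f) x\<bar> / 2"
  have e: "e > 0" using ne by (simp add: e_def)
  have cont: "isCont (pd a (pd b f)) x" for a b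
    using smooth_on_imp_continuous_on[OF smooth_on_pd[OF smooth_on_pd[OF f U(1)] U(1)]] U
    by (simp add: continuous_on_eq_continuous_at)
  obtain d1 where d1: "d1 > 0" "\<And>y. dist y x < d1 \<Longrightarrow> dist (pd i (pd j f) y) (pd i (pd j f) x) < e"
    using cont[of i j] e unfolding continuous_at_eps_delta by metis
  obtain d2 where d2: "d2 > 0" "\<And>y. dist y x < d2 \<Longrightarrow> dist (pd j (pd i f) y) (pd j (pd i f) x) < e"
    using cont[of j i] e unfolding continuous_at_eps_delta by metis
  obtain d3 where d3: "d3 > 0" "ball x d3 \<subseteq> U" using U openE by blast
  \<comment> \<open>Two steps of length at most \<open>h\<close> stay within 2h of \<open>x\<close>;
    the divisor 3 makes this strictly less than all three radii.\<close>
  define h where "h = min d1 (min d2 d3) / 3"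
  have h: "h > 0" using d1 d2 d3 by (simp add: h_def)
  have near: "dist (x + s *\<^sub>R axis a 1 + t *\<^sub>R axis b 1) x < min d1 (min d2 d3)"
    if "0 \<le> s" "s \<le> h" "0 \<le> t" "t \<le> h" for s t and a b :: 'n
  proof -
    have "dist (x + s *\<^sub>R axis a 1 + t *\<^sub>R axis b 1) x \<le> norm (s *\<^sub>R (axis a 1 :: real^'n)) + norm (t *\<^sub>R (axis b 1 :: real^'n))"
      using norm_triangle_ineq[of "s *\<^sub>R (axis a 1 :: real^'n)" "t *\<^sub>R axis b 1"]
      by (simp add: dist_norm add.assoc del: norm_scaleR)
    also have "\<dots> < 3 * h" using that h by simp
    finally show ?thesis by (simp add: h_def)
  qed
  have sub: "x + s *\<^sub>R axis a 1 + t *\<^sub>R axis b 1 \<in> U" if "0 \<le> s" "s \<le> h" "0 \<le> t" "t \<le> h" for s t a b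
    using near[OF that, of a b] d3(2) by (auto simp: subset_iff dist_commute)
  obtain s t where st: "0 \<le> s" "s \<le> h" "0 \<le> t" "t \<le> h"
    "f (x + h *\<^sub>R axis i 1 + h *\<^sub>R axis j 1) - f (x + h *\<^sub>R axis i 1) - f (x + h *\<^sub>R axis j 1) + f x
      = h * h * pd j (pd i f) (x + s *\<^sub>R axis i 1 + t *\<^sub>R axis j 1)"
    by (rule second_difference_mvt[OF f U(1) h sub])
  obtain s' t' where st': "0 \<le> s'" "s' \<le> h" "0 \<le> t'" "t' \<le> h"
    "f (x + h *\<^sub>R axis j 1 + h *\<^sub>R axis i 1) - f (x + h *\<^sub>R axis j 1) - f (x + h *\<^sub>R axis i 1) + f x
      = h * h * pd i (pd j f) (x + s' *\<^sub>R axis j 1 + t' *\<^sub>R axis i 1)"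
    by (rule second_difference_mvt[OF f U(1) h sub])
  have "h * h * pd j (pd i f) (x + s *\<^sub>R axis i 1 + t *\<^sub>R axis j 1) =
      h * h * pd i (pd j f) (x + s' *\<^sub>R axis j 1 + t' *\<^sub>R axis i 1)"
    unfolding st(5)[symmetric] st'(5)[symmetric] by (simp add: algebra_simps)
  then have "pd j (pd i f) (x + s *\<^sub>R axis i 1 + t *\<^sub>R axis j 1) =
      pd i (pd j f) (x + s' *\<^sub>R axis j 1 + t' *\<^sub>R axis i 1)" using h by simp
  moreover note d1(2)[of "x + s' *\<^sub>R axis j 1 + t' *\<^sub>R axis i 1"] d2(2)[of "x + s *\<^sub>R axis i 1 + t *\<^sub>R axis j 1"]
    near[OF st'(1-4), of j i] near[OF st(1-4), of i j]
  ultimately show False by (auto simp: e_def dist_real_def abs_if split: if_splits)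
qed

section \<open>Determinants and inverses of matrix functions\<close>

lemma smooth_on_det:
  fixes A :: "'a::euclidean_space \<Rightarrow> real^'n::finite^'n"
  assumes "\<And>i j. smooth_on (\<lambda>x. A x $ i $ j) S" "open S"
  shows "smooth_on (\<lambda>x. det (A x)) S"
  unfolding det_def
  by (intro smooth_on_sum smooth_on_mult smooth_on_const smooth_on_prod assms)

lemma matrix_inv_right: "invertible A \<Longrightarrow> A ** matrix_inv A = mat 1"
  unfolding invertible_def matrix_inv_def by (rule someI2_ex) auto

lemma matrix_inv_left: "invertible A \<Longrightarrow> matrix_inv A ** A = mat 1"
  unfolding invertible_def matrix_inv_def by (rule someI2_ex) auto

text \<open>Cramer's rule exhibits the entries of the inverse as quotients of polynomials in the
  entries of \<open>A\<close>, from which the smoothness of the inverse metric is read off.\<close>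

lemma matrix_inv_cramer:
  fixes A :: "real^'n::finite^'n"
  assumes "invertible A"
  shows "matrix_inv A $ i $ j = det (\<chi> a b. if b = i then axis j 1 $ a else A $ a $ b) / det A"
proof -
  have "A *v (matrix_inv A *v axis j 1) = axis j 1"
    using matrix_inv_right[OF assms] by (simp add: matrix_vector_mul_assoc)
  then have "matrix_inv A *v axis j 1 = (\<chi> k. det (\<chi> a b. if b = k then axis j 1 $ a else A $ a $ b) / det A)"
    using assms by (subst (asm) cramer) (auto simp: invertible_det_nz)
  then have "(matrix_inv A *v axis j 1) $ i = det (\<chi> a b. if b = i then axis j 1 $ a else A $ a $ b) / det A"
    by simp
  moreover have "(matrix_inv A *v axis j 1) $ i = matrix_inv A $ i $ j"
    by (simp add: matrix_vector_mult_def axis_def if_distrib cong: if_cong)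
  ultimately show ?thesis by simp
qed

definition posdef :: "real^'n::finite^'n \<Rightarrow> bool" where
  "posdef A \<longleftrightarrow> transpose A = A \<and> (\<forall>v. v \<noteq> 0 \<longrightarrow> v \<bullet> (A *v v) > 0)"

lemma posdef_invertible: "posdef A \<Longrightarrow> invertible A"
  unfolding invertible_left_inverse matrix_left_invertible_ker
  by (metis inner_zero_right less_irrefl posdef_def)

text \<open>On the segment from the identity to \<open>A\<close> the quadratic form stays positive,
  so every matrix on it is invertible and the determinant cannot change sign.\<close>

lemma posdef_det_pos:
  fixes A :: "real^'n::finite^'n"
  assumes "posdef A"
  shows "det A > 0"
proof (rule ccontr)
  assume "\<not> det A > 0"
  define B where "B s = (1 - s) *\<^sub>R mat 1 + s *\<^sub>R A" for s
  have "continuous_on {0..1} (\<lambda>s. det (B s))"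
    unfolding det_def B_def by (intro continuous_intros)
  then obtain s where s: "0 \<le> s" "s \<le> 1" "det (B s) = 0"
    using IVT2'[of "\<lambda>s. det (B s)" 1 0 0] \<open>\<not> det A > 0\<close> by (auto simp: B_def)
  have "v \<bullet> (B s *v v) > 0" if "v \<noteq> 0" for v
  proof -
    have "v \<bullet> (A *v v) > 0" using assms that by (simp add: posdef_def)
    moreover have "v \<bullet> v > 0" using that by simp
    moreover have "v \<bullet> (B s *v v) = (1 - s) * (v \<bullet> v) + s * (v \<bullet> (A *v v))"
      by (simp add: B_def matrix_vector_mult_add_rdistrib scaleR_matrix_vector_assoc[symmetric] inner_add_right)
    ultimately show ?thesis using s
      by (cases "s = 0") (auto intro: add_nonneg_pos)
  qed
  then have "invertible (B s)"
    unfolding invertible_left_inverse matrix_left_invertible_ker by (metis inner_zero_right less_irrefl)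
  then show False using s(3) by (simp add: invertible_det_nz)
qed

lemma smooth_on_matrix_inv:
  fixes A :: "'a::euclidean_space \<Rightarrow> real^'n::finite^'n"
  assumes "\<And>i j. smooth_on (\<lambda>x. A x $ i $ j) S" "open S" "\<And>x. x \<in> S \<Longrightarrow> posdef (A x)"
  shows "smooth_on (\<lambda>x. matrix_inv (A x) $ i $ j) S"
proof -
  have "smooth_on (\<lambda>x. (if b = i then axis j 1 $ a else A x $ a $ b)) S" for a b
    using assms by (cases "b = i") (auto intro: smooth_on_const)
  then have "smooth_on (\<lambda>x. det (\<chi> a b. if b = i then axis j 1 $ a else A x $ a $ b) / det (A x)) S"
    using assms by (intro smooth_on_divide_pos smooth_on_det posdef_det_pos) auto
  then show ?thesis
    by (subst smooth_on_cong[OF matrix_inv_cramer[OF posdef_invertible[OF assms(3)]]]) auto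
qed

text \<open>Jacobi's formula at the identity. A permutation other than \<open>id\<close> moves at
  least two indices, so after one factor has been differentiated another off-diagonal entry, which
  is 0, remains.\<close>

lemma pd_det_at_mat_1:
  fixes B :: "real^'n::finite \<Rightarrow> real^'m::finite^'m"
  assumes d: "\<And>i j. (\<lambda>y. B y $ i $ j) differentiable (at x)" and "B x = mat 1"
  shows "pd k (\<lambda>y. det (B y)) x = (\<Sum>i\<in>UNIV. pd k (\<lambda>y. B y $ i $ i) x)"
proof -
  let ?P = "{p. p permutes (UNIV :: 'm set)}"
  have der: "((\<lambda>y. B y $ i $ j) has_derivative frechet_derivative (\<lambda>y. B y $ i $ j) (at x)) (at x)" for i j
    using d frechet_derivative_works by blast
  have "pd k (\<lambda>y. det (B y)) x = (\<Sum>p\<in>?P. of_int (sign p) *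
      (\<Sum>i\<in>UNIV. frechet_derivative (\<lambda>y. B y $ i $ p i) (at x) (axis k 1) * (\<Prod>j\<in>UNIV - {i}. B x $ j $ p j)))"
    unfolding det_def
    by (rule pd_eqI) (intro has_derivative_sum has_derivative_mult_right has_derivative_prod der)
  also have "\<dots> = (\<Sum>p\<in>?P. if p = id then (\<Sum>i\<in>UNIV. pd k (\<lambda>y. B y $ i $ i) x) else 0)"
  proof (rule sum.cong[OF refl])
    fix p :: "'m \<Rightarrow> 'm" assume p: "p \<in> ?P"
    show "of_int (sign p) *
      (\<Sum>i\<in>UNIV. frechet_derivative (\<lambda>y. B y $ i $ p i) (at x) (axis k 1) * (\<Prod>j\<in>UNIV - {i}. B x $ j $ p j))
      = (if p = id then (\<Sum>i\<in>UNIV. pd k (\<lambda>y. B y $ i $ i) x) else 0)"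
    proof (cases "p = id")
      case True
      then show ?thesis by (simp add: assms(2) mat_def pd_def)
    next
      case False
      have zero: "(\<Prod>j\<in>UNIV - {i}. B x $ j $ p j) = 0" for i
      proof -
        have "\<exists>j. j \<noteq> i \<and> p j \<noteq> j"
        proof (rule ccontr)
          assume *: "\<nexists>j. j \<noteq> i \<and> p j \<noteq> j"
          have "inj p" using p permutes_inj by blast
          then have "p i = i" using * by (metis injD)
          then show False using * False by (metis eq_id_iff)
        qed
        then show ?thesis by (force simp: assms(2) mat_def)
      qed
      then show ?thesis using False by (simp only: zero mult_zero_right sum.neutral_const if_False)
    qed
  qed
  also have "\<dots> = (\<Sum>i\<in>UNIV. pd k (\<lambda>y. B y $ i $ i) x)"
    by (simp add: sum.delta finite_permutations permutes_id)
  finally show ?thesis .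
qed

lemma differentiable_sum_cmult:
  assumes "\<And>a. (f a :: real^'n::finite \<Rightarrow> real) differentiable (at x)"
  shows "(\<lambda>y. \<Sum>a\<in>I. c a * f a y) differentiable (at x)"
  using assms by (cases "finite I") (auto intro!: differentiable_sum differentiable_mult)

text \<open>Factoring out the constant matrix \<open>A x\<close> normalises the value at
  \<open>x\<close> to the identity, where \<open>pd_det_at_mat_1\<close> applies.\<close>

lemma pd_det:
  fixes A :: "real^'n::finite \<Rightarrow> real^'m::finite^'m"
  assumes d: "\<And>i j. (\<lambda>y. A y $ i $ j) differentiable (at x)" and inv: "invertible (A x)"
  shows "pd k (\<lambda>y. det (A y)) x =
    det (A x) * (\<Sum>i\<in>UNIV. \<Sum>j\<in>UNIV. matrix_inv (A x) $ i $ j * pd k (\<lambda>y. A y $ j $ i) x)"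
proof -
  define B where "B y = matrix_inv (A x) ** A y" for y
  have B: "B y $ i $ j = (\<Sum>a\<in>UNIV. matrix_inv (A x) $ i $ a * A y $ a $ j)" for y i j
    by (simp add: B_def matrix_matrix_mult_def)
  have dB: "(\<lambda>y. B y $ i $ j) differentiable (at x)" for i j
    unfolding B using d by (rule differentiable_sum_cmult)
  have "A y = A x ** B y" for y
    by (simp add: B_def matrix_mul_assoc matrix_inv_right[OF inv])
  then have det: "(\<lambda>y. det (A y)) = (\<lambda>y. det (A x) * det (B y))"
    by (metis det_mul)
  have "pd k (\<lambda>y. det (A y)) x = det (A x) * pd k (\<lambda>y. det (B y)) x"
    unfolding det
  proof (rule pd_cmult)
    show "(\<lambda>y. det (B y)) differentiable at x"
      unfolding det_def
      by (intro differentiable_sum ballI finite_permutations finite differentiable_mult differentiable_const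
          differentiableI[OF has_derivative_prod[OF iffD1[OF frechet_derivative_works dB]]])
  qed
  also have "pd k (\<lambda>y. det (B y)) x = (\<Sum>i\<in>UNIV. pd k (\<lambda>y. B y $ i $ i) x)"
    by (rule pd_det_at_mat_1[OF dB]) (simp add: B_def matrix_inv_left[OF inv])
  also have "\<dots> = (\<Sum>i\<in>UNIV. \<Sum>j\<in>UNIV. matrix_inv (A x) $ i $ j * pd k (\<lambda>y. A y $ j $ i) x)"
    unfolding B using d by (simp add: pd_sum pd_cmult)
  finally show ?thesis .
qed

section \<open>Matrix-valued functions\<close>

lemma matrix_diff_ldistrib: "(A :: real^'n::finite^'m) ** (B - C) = A ** B - A ** C"
  by (simp add: vec_eq_iff matrix_matrix_mult_def right_diff_distrib sum_subtractf)

lemma matrix_diff_rdistrib: "(B - C) ** (A :: real^'n::finite^'m::finite) = B ** A - C ** A"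
  by (simp add: vec_eq_iff matrix_matrix_mult_def left_diff_distrib sum_subtractf)

lemma matrix_minus_right: "(A :: real^'n::finite^'m) ** (- B) = - (A ** B)"
  by (simp add: vec_eq_iff matrix_matrix_mult_def sum_negf)

lemma matrix_minus_left: "(- A :: real^'n::finite^'m) ** B = - (A ** B)"
  by (simp add: vec_eq_iff matrix_matrix_mult_def sum_negf)

lemma matrix_add_rdistrib: "(B + C) ** (A :: real^'n::finite^'m::finite) = B ** A + C ** A"
  by (simp add: vec_eq_iff matrix_matrix_mult_def distrib_right sum.distrib)

lemma matrix_zero_left: "(0 :: real^'n::finite^'m) ** B = 0"
  by (simp add: vec_eq_iff matrix_matrix_mult_def)

lemma matrix_zero_right: "(A :: real^'n::finite^'m) ** 0 = 0"
  by (simp add: vec_eq_iff matrix_matrix_mult_def)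

lemma matrix_sum_right: "(A :: real^'n::finite^'m) ** (\<Sum>i\<in>I. F i) = (\<Sum>i\<in>I. A ** F i)"
  by (induction I rule: infinite_finite_induct) (auto simp: matrix_add_ldistrib matrix_zero_right)

lemma matrix_sum_left: "(\<Sum>i\<in>I. F i) ** (A :: real^'n::finite^'m::finite) = (\<Sum>i\<in>I. F i ** A)"
  by (induction I rule: infinite_finite_induct) (auto simp: matrix_add_rdistrib matrix_zero_left)

lemma matrix_scaleR_left: "(c *\<^sub>R A :: real^'n::finite^'m) ** B = c *\<^sub>R (A ** B)"
  by (simp add: vec_eq_iff matrix_matrix_mult_def sum_distrib_left mult.assoc)

lemma matrix_scaleR_right: "(A :: real^'n::finite^'m) ** (c *\<^sub>R B) = c *\<^sub>R (A ** B)"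
  by (simp add: vec_eq_iff matrix_matrix_mult_def sum_distrib_left mult.left_commute)

lemma transpose_add: "transpose (A + B :: real^'n^'m) = transpose A + transpose B"
  by (simp add: vec_eq_iff transpose_def)

lemma transpose_diff: "transpose (A - B :: real^'n^'m) = transpose A - transpose B"
  by (simp add: vec_eq_iff transpose_def)

lemma transpose_sum: "transpose (\<Sum>i\<in>I. F i :: real^'n^'m) = (\<Sum>i\<in>I. transpose (F i))"
  by (simp add: vec_eq_iff transpose_def)

lemma matrix_vector_sum: "(\<Sum>i\<in>I. F i) *v (v :: real^'n::finite) = (\<Sum>i\<in>I. F i *v v)"
  by (induction I rule: infinite_finite_induct) (auto simp: matrix_vector_mult_add_rdistrib)

lemma matrix_vector_scaleR: "(c *\<^sub>R A) *v (v :: real^'n::finite) = c *\<^sub>R (A *v v)"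
  by (simp add: vec_eq_iff matrix_vector_mult_def sum_distrib_left mult.assoc)

lemmas mat_alg = matrix_add_ldistrib matrix_add_rdistrib matrix_diff_ldistrib matrix_diff_rdistrib
  matrix_minus_left matrix_minus_right matrix_mul_assoc

lemma trace_minus: "trace (- A :: real^'n::finite^'n) = - trace A"
  by (simp add: trace_def sum_negf)

lemma trace_transpose: "trace (transpose A) = trace A"
  by (simp add: trace_def transpose_def)

lemma matrix_nth: "(A ** B) $ i $ j = (\<Sum>k\<in>UNIV. A $ i $ k * B $ k $ j)"
  by (simp add: matrix_matrix_mult_def)

lemma bounded_bilinear_matrix_mult:
  "bounded_bilinear (\<lambda>(A::real^'n::finite^'m::finite) (B::real^'k::finite^'n). A ** B)"
proof (rule iffD1[OF bilinear_conv_bounded_bilinear], unfold bilinear_def, intro conjI allI)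
  show "linear (\<lambda>B::real^'k::finite^'n. A ** B)" for A :: "real^'n::finite^'m::finite"
    by (rule linearI) (auto simp: matrix_add_ldistrib matrix_scaleR_right)
  show "linear (\<lambda>A::real^'n::finite^'m::finite. A ** B)" for B :: "real^'k::finite^'n"
    by (rule linearI) (auto simp: matrix_add_rdistrib matrix_scaleR_left)
qed

lemma bounded_bilinear_matrix_vector_mult:
  "bounded_bilinear (\<lambda>(A::real^'n::finite^'m::finite) v. A *v v)"
proof (rule iffD1[OF bilinear_conv_bounded_bilinear], unfold bilinear_def, intro conjI allI)
  show "linear (\<lambda>v. A *v v)" for A :: "real^'n::finite^'m::finite"
    by simp
  show "linear (\<lambda>A::real^'n::finite^'m::finite. A *v v)" for v
    by (rule linearI) (auto simp: matrix_vector_mult_add_rdistrib matrix_vector_scaleR)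
qed

lemma bounded_linear_transpose: "bounded_linear (transpose :: real^'n::finite^'m::finite \<Rightarrow> _)"
  by (rule linear_conv_bounded_linear[THEN iffD1], rule linearI) (simp_all add: transpose_add transpose_scalar)

lemma bounded_linear_trace: "bounded_linear (trace :: real^'n::finite^'n \<Rightarrow> _)"
  by (rule linear_conv_bounded_linear[THEN iffD1], rule linearI) (simp_all add: trace_def sum_distrib_left sum.distrib)

definition partial :: "'n \<Rightarrow> (real^'n::finite \<Rightarrow> 'b::real_normed_vector) \<Rightarrow> real^'n \<Rightarrow> 'b" where
  "partial i F x = frechet_derivative F (at x) (axis i 1)"

lemma pd_eq_partial: "pd = partial"
  by (simp add: fun_eq_iff pd_def partial_def)

lemma partial_eqI: "(f has_derivative D) (at x) \<Longrightarrow> partial i f x = D (axis i 1)"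
  by (simp add: partial_def frechet_derivative_at[symmetric])

lemma partial_cong:
  assumes "open V" "x \<in> V" "\<And>y. y \<in> V \<Longrightarrow> f y = h y"
  shows "partial i f x = partial i h x"
proof -
  have "(f has_derivative D) (at x) \<longleftrightarrow> (h has_derivative D) (at x)" for D
    using assms by (metis has_derivative_transform_within_open)
  then show ?thesis
    by (simp add: partial_def frechet_derivative_def)
qed

lemma partial_const [simp]: "partial i (\<lambda>x. c) x = 0"
  by (rule partial_eqI[where D = "\<lambda>v. 0"]) simp

lemma smooth_on_partial: "smooth_on f S \<Longrightarrow> open S \<Longrightarrow> smooth_on (partial i f) S"
  using smooth_on_frechet[of f S "axis i 1"] by (auto simp: partial_def[abs_def] axis_in_Basis_iff)

lemma smooth_on_matrix_mult:
  fixes F :: "'a::euclidean_space \<Rightarrow> real^'n::finite^'m::finite" and H :: "'a \<Rightarrow> real^'k::finite^'n"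
  shows "smooth_on F S \<Longrightarrow> smooth_on H S \<Longrightarrow> open S \<Longrightarrow> smooth_on (\<lambda>x. F x ** H x) S"
  by (simp add: smooth_on_def Ck_on_bilinear[OF _ bounded_bilinear_matrix_mult])

lemma smooth_on_matrix_vector_mult:
  fixes F :: "'a::euclidean_space \<Rightarrow> real^'n::finite^'m::finite" and H :: "'a \<Rightarrow> real^'n"
  shows "smooth_on F S \<Longrightarrow> smooth_on H S \<Longrightarrow> open S \<Longrightarrow> smooth_on (\<lambda>x. F x *v H x) S"
  by (simp add: smooth_on_def Ck_on_bilinear[OF _ bounded_bilinear_matrix_vector_mult])

lemma smooth_on_transpose:
  fixes F :: "'a::euclidean_space \<Rightarrow> real^'n::finite^'m::finite"
  shows "smooth_on F S \<Longrightarrow> open S \<Longrightarrow> smooth_on (\<lambda>x. transpose (F x)) S"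
  by (rule smooth_on_bounded_linear[OF _ _ bounded_linear_transpose])

lemma smooth_on_trace:
  fixes F :: "'a::euclidean_space \<Rightarrow> real^'n::finite^'n"
  shows "smooth_on F S \<Longrightarrow> open S \<Longrightarrow> smooth_on (\<lambda>x. trace (F x)) S"
  by (rule smooth_on_bounded_linear[OF _ _ bounded_linear_trace])

lemma smooth_on_mat:
  fixes f :: "'a::euclidean_space \<Rightarrow> real^'n::finite^'m::finite"
  assumes "open S" "\<And>i j. smooth_on (\<lambda>x. f x $ i $ j) S"
  shows "smooth_on f S"
proof -
  have "smooth_on (\<lambda>x. \<Sum>i\<in>UNIV. axis i (f x $ i)) S"
  proof (intro smooth_on_sum assms)
    fix i :: 'm
    have "bounded_linear (axis i :: real^'n \<Rightarrow> real^'n^'m)"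
      by (rule linear_conv_bounded_linear[THEN iffD1], rule linearI) (auto simp: axis_def vec_eq_iff)
    then show "smooth_on (\<lambda>x. axis i (f x $ i)) S"
      by (rule smooth_on_bounded_linear[OF smooth_on_vec[OF assms(2,1)] assms(1)])
  qed
  also have "(\<lambda>x. \<Sum>i\<in>UNIV. axis i (f x $ i)) = f"
    by (simp add: fun_eq_iff vec_eq_iff axis_def if_distrib if_distribR cong: if_cong)
  finally show ?thesis .
qed

locale open_set =
  fixes U :: "(real^'n::finite) set"
  assumes open_U: "open U"
begin

lemma smooth_differentiable [intro]: "smooth_on F U \<Longrightarrow> x \<in> U \<Longrightarrow> F differentiable (at x)"
  using smooth_on_differentiable open_U by blast

lemma smooth_der: "smooth_on F U \<Longrightarrow> x \<in> U \<Longrightarrow> (F has_derivative frechet_derivative F (at x)) (at x)"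
  using smooth_on_has_derivative open_U by blast

lemma partial_linear:
  assumes "bounded_linear L" "smooth_on F U" "x \<in> U"
  shows "partial i (\<lambda>x. L (F x)) x = L (partial i F x)"
  using partial_eqI[OF bounded_linear.has_derivative[OF assms(1) smooth_der[OF assms(2,3)]]]
  by (simp add: partial_def)

lemma partial_bilinear:
  assumes "bounded_bilinear B" "smooth_on F U" "smooth_on H U" "x \<in> U"
  shows "partial i (\<lambda>x. B (F x) (H x)) x = B (F x) (partial i H x) + B (partial i F x) (H x)"
  using partial_eqI[OF bounded_bilinear.FDERIV[OF assms(1) smooth_der[OF assms(2,4)] smooth_der[OF assms(3,4)]]]
  by (simp add: partial_def)

lemma partial_add:
  assumes "smooth_on F U" "smooth_on H U" "x \<in> U"
  shows "partial i (\<lambda>x. F x + H x) x = partial i F x + partial i H x"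
  using partial_eqI[OF has_derivative_add[OF smooth_der[OF assms(1,3)] smooth_der[OF assms(2,3)]]]
  by (simp add: partial_def)

lemma partial_diff:
  assumes "smooth_on F U" "smooth_on H U" "x \<in> U"
  shows "partial i (\<lambda>x. F x - H x) x = partial i F x - partial i H x"
  using partial_eqI[OF has_derivative_diff[OF smooth_der[OF assms(1,3)] smooth_der[OF assms(2,3)]]]
  by (simp add: partial_def)

lemma partial_sum:
  assumes "\<And>a. a \<in> I \<Longrightarrow> smooth_on (F a) U" "x \<in> U"
  shows "partial i (\<lambda>x. \<Sum>a\<in>I. F a x) x = (\<Sum>a\<in>I. partial i (F a) x)"
  using partial_eqI[OF has_derivative_sum[OF smooth_der[OF assms]], of I]
  by (simp add: partial_def)

lemmas partial_scaleR = partial_bilinear[OF bounded_bilinear_scaleR]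
lemmas partial_matrix_mult = partial_bilinear[OF bounded_bilinear_matrix_mult]
lemmas partial_matrix_vector_mult = partial_bilinear[OF bounded_bilinear_matrix_vector_mult]
lemmas partial_transpose = partial_linear[OF bounded_linear_transpose]
lemmas partial_trace = partial_linear[OF bounded_linear_trace]
lemmas partial_nth = partial_linear[OF bounded_linear_vec_nth]

lemma partial_nth2:
  fixes F :: "real^'n \<Rightarrow> real^'k::finite^'m::finite"
  assumes "smooth_on F U" "x \<in> U"
  shows "partial i (\<lambda>x. F x $ a $ b) x = partial i F x $ a $ b"
  using partial_nth[OF smooth_on_nth[OF assms(1) open_U] assms(2)] partial_nth[OF assms] by metis

lemmas smooth_add = smooth_on_add[OF _ _ open_U]
lemmas smooth_diff = smooth_on_diff[OF _ _ open_U]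
lemmas smooth_minus = smooth_on_minus[OF _ open_U]
lemmas smooth_mult = smooth_on_mult[OF _ _ open_U]
lemmas smooth_scaleR = smooth_on_scaleR[OF _ _ open_U]
lemmas smooth_sum = smooth_on_sum[OF open_U]
lemmas smooth_const = smooth_on_const[OF open_U]
lemmas smooth_partial = smooth_on_partial[OF _ open_U]
lemmas smooth_matrix_mult = smooth_on_matrix_mult[OF _ _ open_U]
lemmas smooth_matrix_vector_mult = smooth_on_matrix_vector_mult[OF _ _ open_U]
lemmas smooth_transpose = smooth_on_transpose[OF _ open_U]
lemmas smooth_trace = smooth_on_trace[OF _ open_U]
lemmas smooth_nth = smooth_on_nth[OF _ open_U]
lemmas smooth_vec = smooth_on_vec[OF _ open_U]
lemmas smooth_mat = smooth_on_mat[OF open_U]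

lemmas smooths = smooth_add smooth_diff smooth_minus smooth_mult smooth_scaleR smooth_sum smooth_const
  smooth_partial smooth_matrix_mult smooth_matrix_vector_mult smooth_transpose smooth_trace

lemma smooth_pd: "smooth_on f U \<Longrightarrow> smooth_on (pd i f) U"
  by (rule smooth_on_pd[OF _ open_U])

lemma partial_commute_vec:
  fixes F :: "real^'n \<Rightarrow> real^'m::finite"
  assumes "smooth_on F U" "x \<in> U"
  shows "partial i (partial j F) x = partial j (partial i F) x"
proof -
  have "partial i (partial j F) x $ a = pd i (pd j (\<lambda>y. F y $ a)) x" for i j a
    using partial_nth[OF smooth_partial[OF assms(1)] assms(2)]
    by (subst pd_cong[OF open_U assms(2), of _ "\<lambda>y. partial j F y $ a"])
      (simp_all add: pd_eq_partial partial_nth[OF assms(1)])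
  then show ?thesis
    using pd_commute[OF smooth_nth[OF assms(1)] open_U assms(2)] by (simp add: vec_eq_iff)
qed

lemma partial_commute_mat:
  fixes F :: "real^'n \<Rightarrow> real^'k::finite^'m::finite"
  assumes "smooth_on F U" "x \<in> U"
  shows "partial i (partial j F) x = partial j (partial i F) x"
proof -
  have "partial i (partial j F) x $ a $ b = pd i (pd j (\<lambda>y. F y $ a $ b)) x" for i j a b
    using partial_nth2[OF smooth_partial[OF assms(1)] assms(2)]
    by (subst pd_cong[OF open_U assms(2), of _ "\<lambda>y. partial j F y $ a $ b"])
      (simp_all add: pd_eq_partial partial_nth2[OF assms(1)])
  then show ?thesis
    using pd_commute[OF smooth_nth[OF smooth_nth[OF assms(1)]] open_U assms(2)] by (simp add: vec_eq_iff)
qed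

end

section \<open>Curvature identities in a chart\<close>

text \<open>A (1,1) tensor \<open>T\<^sub>l\<^sup>i\<close> is treated as the matrix \<open>T $ i $ l\<close>, so that composition of
  endomorphisms is matrix multiplication.\<close>

definition chr_mat :: "'n::finite local_metric \<Rightarrow> 'n \<Rightarrow> real^'n \<Rightarrow> real^'n^'n" where
  "chr_mat G k x = (\<chi> l i. christoffel G l k i x)"

definition curv_mat :: "'n::finite local_metric \<Rightarrow> 'n \<Rightarrow> 'n \<Rightarrow> real^'n \<Rightarrow> real^'n^'n" where
  "curv_mat G i j x = (\<chi> l k. riemann G l i j k x)"

definition ricci_mat :: "'n::finite local_metric \<Rightarrow> real^'n \<Rightarrow> real^'n^'n" where
  "ricci_mat G x = (\<chi> j k. ricci G j k x)"

definition nabla_mat :: "'n::finite local_metric \<Rightarrow> (real^'n \<Rightarrow> real^'n) \<Rightarrow> real^'n \<Rightarrow> real^'n^'n" where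
  "nabla_mat G X x = (\<chi> j i. nabla_vec G X i j x)"

text \<open>The connection acts on endomorphisms by the commutator with \<open>chr_mat\<close>.
  Applied to \<open>nabla_mat G X\<close> this is the full second covariant derivative; applied to
  \<open>curv_mat G i j\<close> it leaves the base indices \<open>i\<close> and \<open>j\<close>
  uncorrected, which \<open>cov_curv\<close> makes up for.\<close>

definition cov_mat ::
  "'n::finite local_metric \<Rightarrow> 'n \<Rightarrow> (real^'n \<Rightarrow> real^'n^'n) \<Rightarrow> real^'n \<Rightarrow> real^'n^'n" where
  "cov_mat G k T x = partial k T x + chr_mat G k x ** T x - T x ** chr_mat G k x"

definition div_mat :: "'n::finite local_metric \<Rightarrow> (real^'n \<Rightarrow> real^'n^'n) \<Rightarrow> real^'n \<Rightarrow> real^'n" where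
  "div_mat G T x = (\<chi> l. \<Sum>i\<in>UNIV. cov_mat G i T x $ i $ l)"

definition adj_mat :: "'n::finite local_metric \<Rightarrow> (real^'n \<Rightarrow> real^'n^'n) \<Rightarrow> real^'n \<Rightarrow> real^'n^'n" where
  "adj_mat G T x = matrix_inv (G x) ** transpose (T x) ** G x"

definition ricci_end :: "'n::finite local_metric \<Rightarrow> real^'n \<Rightarrow> real^'n^'n" where
  "ricci_end G x = matrix_inv (G x) ** ricci_mat G x"

text \<open>The matrix is twice the deformation tensor of \<open>X\<close> with one index raised, so
  this field is 2 Def(X) applied to \<open>Y\<close>.\<close>

definition def_vec ::
  "'n::finite local_metric \<Rightarrow> (real^'n \<Rightarrow> real^'n) \<Rightarrow> (real^'n \<Rightarrow> real^'n) \<Rightarrow> real^'n \<Rightarrow> real^'n" where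
  "def_vec G X Y x = (nabla_mat G X x + adj_mat G (nabla_mat G X) x) *v Y x"

locale chart_metric = open_set U for U :: "(real^'n::finite) set" +
  fixes G :: "'n local_metric"
  assumes smooth_G: "smooth_on G U" and posdef_G: "x \<in> U \<Longrightarrow> posdef (G x)"
begin

abbreviation "\<Gamma> \<equiv> chr_mat G"
abbreviation "P \<equiv> (\<lambda>x. matrix_inv (G x))"

lemma inv_G: "x \<in> U \<Longrightarrow> invertible (G x)"
  using posdef_G posdef_invertible by blast

lemma transpose_G: "x \<in> U \<Longrightarrow> transpose (G x) = G x"
  using posdef_G by (simp add: posdef_def)

lemma GP: "x \<in> U \<Longrightarrow> G x ** P x = mat 1" and PG: "x \<in> U \<Longrightarrow> P x ** G x = mat 1"
  using inv_G matrix_inv_left matrix_inv_right by blast+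

lemma transpose_P: assumes "x \<in> U" shows "transpose (P x) = P x"
proof -
  have "transpose (P x) = transpose (P x) ** (G x ** P x)" using GP[OF assms] by simp
  also have "\<dots> = transpose (G x ** P x) ** P x"
    using transpose_G[OF assms] by (simp add: matrix_transpose_mul matrix_mul_assoc)
  finally show ?thesis using GP[OF assms] by simp
qed

lemma smooth_P: "smooth_on P U"
  by (rule smooth_mat, rule smooth_on_matrix_inv)
    (use posdef_G in \<open>auto intro!: smooth_on_nth smooth_G open_U\<close>)

lemma smooth_ginv: "smooth_on (ginv G i j) U"
  unfolding ginv_def[abs_def] by (intro smooth_on_nth smooth_P open_U)

lemma smooth_chr: "smooth_on (\<Gamma> k) U"
proof (rule smooth_mat)
  have "smooth_on (\<lambda>y. G y $ i $ j) U" for i j by (intro smooth_on_nth smooth_G open_U)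
  then show "smooth_on (\<lambda>x. \<Gamma> k x $ i $ j) U" for i j
    unfolding chr_mat_def christoffel_def vec_lambda_beta
    by (intro smooth_mult smooth_const smooth_sum smooth_ginv smooth_add smooth_diff smooth_pd)
qed

lemma christoffel_sym: "x \<in> U \<Longrightarrow> christoffel G k i j x = christoffel G k j i x"
  using christoffel_torsion_free[OF open_U] transpose_G by blast

lemma chr_nth: "\<Gamma> k x $ l $ i = christoffel G l k i x"
  by (simp add: chr_mat_def)

lemma partial_G:
  assumes "x \<in> U"
  shows "partial k G x = transpose (\<Gamma> k x) ** G x + G x ** \<Gamma> k x"
proof -
  have "partial k G x $ i $ j = (transpose (\<Gamma> k x) ** G x + G x ** \<Gamma> k x) $ i $ j" for i j
  proof -
    have "partial k G x $ i $ j = pd k (\<lambda>y. G y $ i $ j) x"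
      by (simp add: pd_eq_partial partial_nth2[OF smooth_G assms])
    also have "\<dots> = (\<Sum>l\<in>UNIV. christoffel G l k i x * G x $ l $ j + christoffel G l k j x * G x $ i $ l)"
      using transpose_G by (intro christoffel_metric[where V = U] open_U assms inv_G)
    also have "\<dots> = (transpose (\<Gamma> k x) ** G x + G x ** \<Gamma> k x) $ i $ j"
      by (simp add: matrix_nth transpose_def chr_mat_def sum.distrib mult.commute)
    finally show ?thesis .
  qed
  then show ?thesis by (simp add: vec_eq_iff)
qed

text \<open>Differentiate \<open>P y ** G y = mat 1\<close> and solve for the derivative of
  \<open>P\<close>. The result says that the inverse metric is parallel.\<close>

lemma partial_P:
  assumes "x \<in> U"
  shows "partial k P x = - (P x ** transpose (\<Gamma> k x) + \<Gamma> k x ** P x)"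
proof -
  have "0 = partial k (\<lambda>y. mat 1 :: real^'n^'n) x" by simp
  also have "\<dots> = partial k (\<lambda>y. P y ** G y) x"
    by (rule partial_cong[OF open_U assms]) (simp add: PG)
  also have "\<dots> = P x ** partial k G x + partial k P x ** G x"
    by (rule partial_matrix_mult[OF smooth_P smooth_G assms])
  finally have "0 = (P x ** partial k G x + partial k P x ** G x) ** P x" by (metis matrix_zero_left)
  also have "\<dots> = P x ** transpose (\<Gamma> k x) ** (G x ** P x) + (P x ** G x) ** \<Gamma> k x ** P x + partial k P x ** (G x ** P x)"
    by (simp add: partial_G[OF assms] mat_alg)
  finally have "P x ** transpose (\<Gamma> k x) + \<Gamma> k x ** P x + partial k P x = 0"
    by (simp add: GP[OF assms] PG[OF assms])
  then show ?thesis by (rule minus_unique[symmetric])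
qed

lemma curv_mat_eq:
  assumes "x \<in> U"
  shows "curv_mat G i j x = partial i (\<Gamma> j) x - partial j (\<Gamma> i) x + \<Gamma> i x ** \<Gamma> j x - \<Gamma> j x ** \<Gamma> i x"
  using partial_nth2[OF smooth_chr assms]
  by (simp add: vec_eq_iff curv_mat_def riemann_def matrix_nth pd_eq_partial chr_nth)

lemma smooth_curv: "smooth_on (curv_mat G i j) U"
  by (subst smooth_on_cong[OF curv_mat_eq]) (auto intro!: smooths smooth_chr)

lemma smooth_ricci: "smooth_on (ricci_mat G) U"
proof (rule smooth_mat)
  fix j k
  have "smooth_on (\<lambda>x. \<Sum>i\<in>UNIV. curv_mat G i j x $ i $ k) U"
    by (intro smooth_sum smooth_on_nth smooth_curv open_U)
  then show "smooth_on (\<lambda>x. ricci_mat G x $ j $ k) U"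
    by (simp add: ricci_mat_def ricci_def curv_mat_def)
qed

lemma smooth_ricci_end: "smooth_on (ricci_end G) U"
  unfolding ricci_end_def by (intro smooth_matrix_mult smooth_P smooth_ricci)

lemma riemann_antisym: "riemann G l i j k x = - riemann G l j i k x"
  by (simp add: riemann_def)

lemma curv_mat_antisym: "curv_mat G i j x = - curv_mat G j i x"
  by (simp add: vec_eq_iff curv_mat_def riemann_def)

text \<open>Metric compatibility expresses the first derivatives of \<open>G\<close> through
  \<Gamma>. Differentiating once more and antisymmetrising in \<open>i\<close> and \<open>j\<close>
  kills the second derivatives of \<open>G\<close>; what remains is a relation for the
  curvature.\<close>

lemma curv_mat_skew:
  assumes "x \<in> U"
  shows "G x ** curv_mat G i j x = - (transpose (curv_mat G i j x) ** G x)"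
proof -
  have d2: "partial i (partial j G) x = transpose (\<Gamma> j x) ** partial i G x + transpose (partial i (\<Gamma> j) x) ** G x
      + (G x ** partial i (\<Gamma> j) x + partial i G x ** \<Gamma> j x)" for i j
  proof -
    have "partial i (partial j G) x = partial i (\<lambda>y. transpose (\<Gamma> j y) ** G y + G y ** \<Gamma> j y) x"
      by (rule partial_cong[OF open_U assms]) (rule partial_G)
    then show ?thesis
      by (simp add: partial_add partial_matrix_mult partial_transpose smooths smooth_G smooth_chr assms)
  qed
  have "partial i (partial j G) x - partial j (partial i G) x = 0"
    using partial_commute_mat[OF smooth_G assms] by simp
  then have "G x ** curv_mat G i j x + transpose (curv_mat G i j x) ** G x = 0"
    unfolding d2 partial_G[OF assms] curv_mat_eq[OF assms] transpose_add transpose_diff matrix_transpose_mul mat_alg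
    by (simp add: algebra_simps)
  then show ?thesis by (rule minus_unique[symmetric, OF trans[OF add.commute]])
qed

text \<open>By skewness the matrix is minus a conjugate of its transpose, so its trace equals its
  own negative. This disposes of one term in \<open>ricci_sym\<close>.\<close>

lemma curv_mat_trace:
  assumes "x \<in> U"
  shows "trace (curv_mat G i j x) = 0"
proof -
  have "curv_mat G i j x = P x ** (G x ** curv_mat G i j x)"
    by (simp add: matrix_mul_assoc PG[OF assms])
  also have "\<dots> = - (P x ** (transpose (curv_mat G i j x) ** G x))"
    by (simp add: curv_mat_skew[OF assms] mat_alg)
  finally have "trace (curv_mat G i j x) = - trace ((transpose (curv_mat G i j x) ** G x) ** P x)"
    by (metis trace_minus trace_mul_sym)
  also have "\<dots> = - trace (curv_mat G i j x)"
    by (simp add: matrix_mul_assoc[symmetric] GP[OF assms] trace_transpose)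
  finally show ?thesis by simp
qed

lemma riemann_cyclic:
  assumes "x \<in> U"
  shows "riemann G l i j k x + riemann G l j k i x + riemann G l k i j x = 0"
proof -
  have "pd a (christoffel G l b c) x = pd a (christoffel G l c b) x" for a b c
    by (rule pd_cong[OF open_U assms]) (rule christoffel_sym)
  then show ?thesis
    using christoffel_sym[OF assms] by (simp add: riemann_def)
qed

text \<open>Trace the first Bianchi identity over the upper index and the first lower one. The outer
  terms give Ric_jk and -Ric_kj, the middle one is the trace of the curvature endomorphism.\<close>

lemma ricci_sym:
  assumes "x \<in> U"
  shows "transpose (ricci_mat G x) = ricci_mat G x"
proof -
  have "ricci G j k x = ricci G k j x" for j k
  proof -
    have "0 = (\<Sum>i\<in>UNIV. riemann G i i j k x + riemann G i j k i x + riemann G i k i j x)"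
      by (simp add: riemann_cyclic[OF assms])
    also have "\<dots> = ricci G j k x + trace (curv_mat G j k x) - ricci G k j x"
      using riemann_antisym[of _ k _ j x]
      by (simp add: sum.distrib ricci_def trace_def curv_mat_def sum_subtractf)
    finally show ?thesis by (simp add: curv_mat_trace[OF assms])
  qed
  then show ?thesis by (simp add: vec_eq_iff transpose_def ricci_mat_def)
qed

text \<open>The base indices need no connection term here because the Christoffel symbols are symmetric.\<close>

lemma second_bianchi:
  assumes "x \<in> U"
  shows "cov_mat G m (curv_mat G i j) x + cov_mat G i (curv_mat G j m) x + cov_mat G j (curv_mat G m i) x = 0"
proof -
  have c: "partial m (curv_mat G i j) x = partial m (partial i (\<Gamma> j)) x - partial m (partial j (\<Gamma> i)) x
      + (\<Gamma> i x ** partial m (\<Gamma> j) x + partial m (\<Gamma> i) x ** \<Gamma> j x)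
      - (\<Gamma> j x ** partial m (\<Gamma> i) x + partial m (\<Gamma> j) x ** \<Gamma> i x)" for m i j
  proof -
    have "partial m (curv_mat G i j) x =
      partial m (\<lambda>y. partial i (\<Gamma> j) y - partial j (\<Gamma> i) y + \<Gamma> i y ** \<Gamma> j y - \<Gamma> j y ** \<Gamma> i y) x"
      by (rule partial_cong[OF open_U assms]) (rule curv_mat_eq)
    then show ?thesis
      by (simp add: partial_add partial_diff partial_matrix_mult smooths smooth_chr assms)
  qed
  show ?thesis
    unfolding cov_mat_def c curv_mat_eq[OF assms] mat_alg
    using partial_commute_mat[OF smooth_chr assms, of m i j] partial_commute_mat[OF smooth_chr assms, of m j i]
      partial_commute_mat[OF smooth_chr assms, of i j m]
    by (simp add: algebra_simps)
qed

end

section \<open>Positive semidefinite matrices\<close>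

lemma symmetric_nth:
  fixes A :: "'a^'n^'n"
  assumes "transpose A = A"
  shows "A $ i $ j = A $ j $ i"
proof -
  have "transpose A $ i $ j = A $ i $ j" using assms by simp
  then show ?thesis by (simp add: transpose_def)
qed

text \<open>The case a = 0 is included so that Cauchy-Schwarz holds for forms that are only
  semidefinite. It serves both matrices and the integral inner product.\<close>

lemma quadratic_nonneg_imp_discriminant:
  fixes a b c :: real
  assumes q: "\<And>t. 0 \<le> a * t\<^sup>2 + 2 * b * t + c"
  shows "b\<^sup>2 \<le> a * c"
proof (cases "a = 0")
  case True
  have "b = 0"
  proof (rule ccontr)
    assume "b \<noteq> 0"
    \<comment> \<open>At this point the linear polynomial takes the value -1.\<close>
    then show False using q[of "- (c + 1) / (2 * b)"] True by (simp add: field_simps)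
  qed
  then show ?thesis using True by simp
next
  case False
  have "a \<ge> 0"
  proof (rule ccontr)
    assume "\<not> a \<ge> 0"
    then have a: "a < 0" by simp
    \<comment> \<open>Chosen so that a t = a - 2|b| - |c|; as t is at least 1, the quadratic term
      then outweighs the other two.\<close>
    define t where "t = 1 + (2 * \<bar>b\<bar> + \<bar>c\<bar>) / (- a)"
    have t: "t \<ge> 1" unfolding t_def using a divide_nonneg_pos[of "2 * \<bar>b\<bar> + \<bar>c\<bar>" "- a"] by linarith
    have at: "a * t = a - (2 * \<bar>b\<bar> + \<bar>c\<bar>)" using a by (simp add: t_def field_simps)
    have "a * t\<^sup>2 + 2 * b * t + c = (a * t) * t + 2 * b * t + c" by (simp add: power2_eq_square)
    also have "(a * t) * t = (a - (2 * \<bar>b\<bar> + \<bar>c\<bar>)) * t" by (simp only: at)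
    also have "\<dots> + 2 * b * t + c = a * t + 2 * (b - \<bar>b\<bar>) * t + (c - \<bar>c\<bar> * t)" by (simp add: algebra_simps)
    also have "\<dots> < 0"
    proof -
      have "a * t < 0" using a t by (simp add: mult_neg_pos)
      moreover have "2 * (b - \<bar>b\<bar>) * t \<le> 0" by (rule mult_nonpos_nonneg) (use t in auto)
      moreover have "\<bar>c\<bar> * 1 \<le> \<bar>c\<bar> * t" using t by (intro mult_left_mono) auto
      ultimately show ?thesis by linarith
    qed
    finally show False using q[of t] by simp
  qed
  then have pos: "a > 0" using False by simp
  show ?thesis using q[of "- b / a"] pos by (simp add: power2_eq_square field_simps)
qed

lemma psd_cauchy_schwarz:
  fixes P :: "real^'n::finite^'n"
  assumes sym: "transpose P = P" and psd: "\<And>v. v \<bullet> (P *v v) \<ge> 0"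
  shows "(u \<bullet> (P *v v))\<^sup>2 \<le> (u \<bullet> (P *v u)) * (v \<bullet> (P *v v))"
proof -
  have sw: "v \<bullet> (P *v u) = u \<bullet> (P *v v)" for u v
    using sym by (metis dot_lmul_matrix inner_commute transpose_matrix_vector)
  show ?thesis
  proof (rule quadratic_nonneg_imp_discriminant)
    show "0 \<le> (u \<bullet> (P *v u)) * t\<^sup>2 + 2 * (u \<bullet> (P *v v)) * t + v \<bullet> (P *v v)" for t
      using psd[of "t *\<^sub>R u + v"]
      by (simp add: matrix_vector_right_distrib matrix_vector_mult_scaleR inner_add_left inner_add_right
          sw[of v u] power2_eq_square algebra_simps)
  qed
qed

text \<open>Peeling off rank-one summands of \<open>P\<close> (Cholesky elimination).\<close>

lemma psd_trace_mult_nonneg: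
  fixes P M :: "real^'n::finite^'n"
  assumes "transpose P = P" "\<And>v. v \<bullet> (P *v v) \<ge> 0" "\<And>v. v \<bullet> (M *v v) \<ge> 0"
  shows "trace (P ** M) \<ge> 0"
  using assms(1,2)
proof (induction "card {i. P $ i \<noteq> 0}" arbitrary: P rule: less_induct)
  case less
  show ?case
  proof (cases "P = 0")
    case True
    then show ?thesis by (simp add: matrix_zero_left trace_def)
  next
    case False
    then obtain k where k: "P $ k \<noteq> 0" by (auto simp: vec_eq_iff)
    have nth: "axis i 1 \<bullet> (P *v axis j 1) = P $ i $ j" for i j
      by (simp add: inner_axis' matrix_vector_mult_basis column_def)
    \<comment> \<open>By Cauchy-Schwarz a zero diagonal entry would annihilate its whole row, so a
      nonzero row has a usable pivot.\<close>
    have "P $ k $ k \<noteq> 0"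
    proof
      assume "P $ k $ k = 0"
      then have "P $ k $ i = 0" for i
        using psd_cauchy_schwarz[OF less.prems, of "axis k 1" "axis i 1"] by (simp add: nth)
      then show False using k by (simp add: vec_eq_iff)
    qed
    then have pos: "P $ k $ k > 0" using less.prems(2)[of "axis k 1"] by (simp add: nth)
    define w where "w = P $ k"
    define W :: "real^'n^'n" where "W = (\<chi> i j. w $ i * w $ j)"
    define P' where "P' = P - (1 / P $ k $ k) *\<^sub>R W"
    have Psym: "P $ i $ j = P $ j $ i" for i j
      by (rule symmetric_nth[OF less.prems(1)])
    have Wv: "v \<bullet> (W *v v) = (axis k 1 \<bullet> (P *v v))\<^sup>2" for v
    proof -
      have "W *v v = (w \<bullet> v) *\<^sub>R w"
        by (simp add: vec_eq_iff W_def matrix_vector_mult_def Finite_Cartesian_Product.inner_vec_def sum_distrib_left sum_distrib_right mult_ac)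
      moreover have "w \<bullet> v = axis k 1 \<bullet> (P *v v)"
        by (simp add: w_def inner_axis' matrix_vector_mul_component)
      ultimately show ?thesis by (simp add: power2_eq_square inner_commute)
    qed
    \<comment> \<open>Subtracting the rank-one part clears row \<open>k\<close> and creates no new
      nonzero row, because by symmetry a zero row \<open>i\<close> forces entry \<open>i\<close> of
      \<open>w\<close> to vanish.\<close>
    have "{i. P' $ i \<noteq> 0} \<subset> {i. P $ i \<noteq> 0}"
    proof -
      have "P' $ i = 0" if "P $ i = 0" for i
        using that Psym[of i k] by (simp add: P'_def W_def w_def vec_eq_iff)
      moreover have "P' $ k = 0"
        using pos by (simp add: P'_def W_def w_def vec_eq_iff)
      ultimately show ?thesis using k by auto
    qed
    then have "card {i. P' $ i \<noteq> 0} < card {i. P $ i \<noteq> 0}" by (simp add: psubset_card_mono)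
    moreover have "transpose P' = P'"
      using Psym by (simp add: P'_def W_def vec_eq_iff transpose_def)
    \<comment> \<open>Semidefiniteness of this Schur complement is exactly Cauchy-Schwarz against
      the \<open>k\<close>-th basis vector.\<close>
    moreover have "v \<bullet> (P' *v v) \<ge> 0" for v
      using psd_cauchy_schwarz[OF less.prems, of "axis k 1" v] pos
      by (simp add: P'_def matrix_vector_mult_diff_rdistrib inner_diff_right matrix_vector_scaleR Wv nth field_simps)
    ultimately have "trace (P' ** M) \<ge> 0" by (rule less.hyps)
    moreover have "trace (W ** M) \<ge> 0"
    proof -
      have "trace (W ** M) = w \<bullet> (M *v w)"
        by (simp add: trace_def matrix_nth W_def Finite_Cartesian_Product.inner_vec_def matrix_vector_mult_def sum_distrib_left mult_ac)
          (subst sum.swap, simp add: mult_ac)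
      then show ?thesis using assms(3) by simp
    qed
    moreover have "trace (P ** M) = trace (P' ** M) + (1 / P $ k $ k) * trace (W ** M)"
      by (simp add: P'_def mat_alg trace_sub matrix_scaleR_left) (simp add: trace_def sum_divide_distrib)
    ultimately show ?thesis using pos by simp
  qed
qed

definition flow_op :: "'n::finite local_metric \<Rightarrow> (real^'n \<Rightarrow> real^'n) \<Rightarrow> real^'n \<Rightarrow> real^'n" where
  "flow_op G X x = laplace_vec G X x + grad G (divergence G X) x + ricci_vec G X x"

definition diff_vec :: "(real^'n::finite \<Rightarrow> real) \<Rightarrow> real^'n \<Rightarrow> real^'n" where
  "diff_vec f x = (\<chi> i. pd i f x)"

lemma grad_eq: "grad G f x = matrix_inv (G x) *v diff_vec f x"
  by (simp add: grad_def ginv_def diff_vec_def matrix_vector_mult_def)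

lemma ricci_vec_eq: "ricci_vec G X x = ricci_end G x *v X x"
  by (simp add: vec_eq_iff ricci_vec_def ricci_end_def ricci_mat_def matrix_nth matrix_vector_mult_def ginv_def)

lemma inner_vec_eq: "inner_vec G X Y x = X x \<bullet> (G x *v Y x)"
  by (simp add: Defs.inner_vec_def matrix_vector_mult_def sum_distrib_left mult_ac Finite_Cartesian_Product.inner_vec_def)

lemma scalar_curvature_eq:
  "transpose (ricci_mat G x) = ricci_mat G x \<Longrightarrow> scalar_curvature G x = trace (ricci_end G x)"
proof -
  assume "transpose (ricci_mat G x) = ricci_mat G x"
  then have "ricci G i j x = ricci G j i x" for i j
    by (simp add: vec_eq_iff transpose_def ricci_mat_def)
  then show ?thesis
    by (simp add: scalar_curvature_def trace_def ricci_end_def matrix_nth ginv_def ricci_mat_def)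
qed

lemma nabla_mixed_eq: "nabla_mixed G (\<lambda>l i y. T y $ i $ l) k l i x =
    pd k (\<lambda>y. T y $ i $ l) x + (chr_mat G k x ** T x) $ i $ l - (T x ** chr_mat G k x) $ i $ l"
  by (simp add: nabla_mixed_def matrix_nth chr_mat_def mult.commute)

section \<open>The flow operator as a divergence\<close>

context chart_metric
begin

lemma nabla_mat_nth:
  assumes "smooth_on X U" "x \<in> U"
  shows "nabla_mat G X x $ j $ i = (partial i X x + \<Gamma> i x *v X x) $ j"
  by (simp add: nabla_mat_def nabla_vec_def pd_eq_partial partial_nth[OF assms] matrix_vector_mult_def chr_mat_def)

lemma smooth_nabla_mat: "smooth_on X U \<Longrightarrow> smooth_on (nabla_mat G X) U"
  by (rule smooth_mat, subst smooth_on_cong[OF nabla_mat_nth])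
    (auto intro!: smooth_on_nth open_U smooths smooth_chr)

lemma divergence_eq_trace: "divergence G X x = trace (nabla_mat G X x)"
  by (simp add: divergence_def trace_def nabla_mat_def)

lemma smooth_divergence: "smooth_on X U \<Longrightarrow> smooth_on (divergence G X) U"
  unfolding divergence_eq_trace[abs_def] by (intro smooth_trace smooth_nabla_mat)

lemma smooth_diff_vec: "smooth_on f U \<Longrightarrow> smooth_on (diff_vec f) U"
  unfolding diff_vec_def by (rule smooth_vec) (simp add: smooth_pd)

lemma smooth_grad: "smooth_on f U \<Longrightarrow> smooth_on (grad G f) U"
  unfolding grad_eq[abs_def] by (intro smooth_matrix_vector_mult smooth_P smooth_diff_vec)

lemma smooth_adj: "smooth_on T U \<Longrightarrow> smooth_on (adj_mat G T) U"
  unfolding adj_mat_def by (intro smooth_matrix_mult smooth_P smooth_G smooth_transpose)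

lemma smooth_cov: "smooth_on T U \<Longrightarrow> smooth_on (cov_mat G k T) U"
  unfolding cov_mat_def by (intro smooths smooth_chr)

lemma smooth_def_vec: "smooth_on X U \<Longrightarrow> smooth_on Y U \<Longrightarrow> smooth_on (def_vec G X Y) U"
  unfolding def_vec_def by (intro smooths smooth_nabla_mat smooth_adj)

lemma smooth_ricci_vec: "smooth_on X U \<Longrightarrow> smooth_on (ricci_vec G X) U"
  unfolding ricci_vec_eq[abs_def] by (intro smooths smooth_ricci_end)

lemma scalar_curvature_trace: "x \<in> U \<Longrightarrow> scalar_curvature G x = trace (ricci_end G x)"
  by (rule scalar_curvature_eq[OF ricci_sym])

lemma smooth_scalar_curvature: "smooth_on (scalar_curvature G) U"
  by (subst smooth_on_cong[OF scalar_curvature_trace]) (auto intro!: smooth_trace smooth_ricci_end)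

text \<open>The metric is parallel, so taking adjoints commutes with covariant differentiation: the
  \<Gamma> terms from differentiating \<open>P\<close> and \<open>G\<close> turn one commutator into
  the other.\<close>

lemma cov_adj:
  assumes "smooth_on T U" "x \<in> U"
  shows "cov_mat G k (adj_mat G T) x = P x ** transpose (cov_mat G k T x) ** G x"
  unfolding cov_mat_def adj_mat_def
  by (simp add: partial_matrix_mult partial_transpose partial_G partial_P smooths smooth_P smooth_G assms
      transpose_add transpose_diff matrix_transpose_mul mat_alg)

text \<open>The trace of the covariant Leibniz rule. It produces the symmetric form of the flow
  operator and, for the Ricci endomorphism, div(Ric X).\<close>

lemma divergence_matrix_vector:
  assumes "smooth_on T U" "smooth_on Y U" "x \<in> U"
  shows "divergence G (\<lambda>y. T y *v Y y) x = div_mat G T x \<bullet> Y x + trace (T x ** nabla_mat G Y x)"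
proof -
  have Z: "smooth_on (\<lambda>y. T y *v Y y) U" by (intro smooths assms)
  have "nabla_mat G (\<lambda>y. T y *v Y y) x $ i $ i =
      (cov_mat G i T x *v Y x) $ i + (T x ** nabla_mat G Y x) $ i $ i" for i
  proof -
    have "(T x ** nabla_mat G Y x) $ i $ i = (T x *v (partial i Y x + \<Gamma> i x *v Y x)) $ i"
      by (simp add: matrix_nth nabla_mat_nth[OF assms(2,3)] matrix_vector_mult_def)
    then show ?thesis
      by (simp add: nabla_mat_nth[OF Z assms(3)] partial_matrix_vector_mult assms cov_mat_def
          matrix_vector_mult_add_rdistrib matrix_vector_mult_diff_rdistrib matrix_vector_right_distrib
          matrix_vector_mul_assoc)
  qed
  then have "divergence G (\<lambda>y. T y *v Y y) x =
      (\<Sum>i\<in>UNIV. (cov_mat G i T x *v Y x) $ i) + trace (T x ** nabla_mat G Y x)"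
    by (simp add: divergence_eq_trace trace_def sum.distrib)
  also have "(\<Sum>i\<in>UNIV. (cov_mat G i T x *v Y x) $ i) = div_mat G T x \<bullet> Y x"
    by (simp add: matrix_vector_mult_def div_mat_def Finite_Cartesian_Product.inner_vec_def sum_distrib_right) (rule sum.swap)
  finally show ?thesis .
qed

text \<open>Second partial derivatives cancel by symmetry, and the terms where the connection acts
  on the index of differentiation cancel because \<Gamma> is symmetric; the rest assembles to the
  curvature.\<close>

lemma ricci_identity:
  assumes "smooth_on X U" "x \<in> U"
  shows "cov_mat G k (nabla_mat G X) x $ i $ l - cov_mat G l (nabla_mat G X) x $ i $ k
    = (curv_mat G k l x *v X x) $ i"
proof -
  have p: "partial k (nabla_mat G X) x $ i $ l =
      (partial k (partial l X) x + (\<Gamma> l x *v partial k X x + partial k (\<Gamma> l) x *v X x)) $ i" for k l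
  proof -
    have "partial k (nabla_mat G X) x $ i $ l = partial k (\<lambda>y. nabla_mat G X y $ i $ l) x"
      by (rule partial_nth2[OF smooth_nabla_mat, symmetric]) (rule assms)+
    also have "\<dots> = partial k (\<lambda>y. (partial l X y + \<Gamma> l y *v X y) $ i) x"
      by (rule partial_cong[OF open_U assms(2)]) (rule nabla_mat_nth[OF assms(1)])
    also have "\<dots> = partial k (\<lambda>y. partial l X y + \<Gamma> l y *v X y) x $ i"
      by (rule partial_nth) (auto intro!: smooths assms smooth_chr)
    finally show ?thesis
      by (simp add: partial_add partial_matrix_vector_mult smooths assms smooth_chr)
  qed
  have a: "(\<Gamma> k x ** nabla_mat G X x) $ i $ l = (\<Gamma> k x *v partial l X x + (\<Gamma> k x ** \<Gamma> l x) *v X x) $ i" for k l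
    by (simp add: matrix_nth nabla_mat_nth[OF assms] matrix_vector_mul_assoc[symmetric])
      (simp add: matrix_vector_mult_def sum.distrib distrib_left)
  have b: "(nabla_mat G X x ** \<Gamma> k x) $ i $ l = (nabla_mat G X x ** \<Gamma> l x) $ i $ k"
    by (simp add: matrix_nth chr_nth christoffel_sym[OF assms(2), of _ k l])
  show ?thesis
    using partial_commute_vec[OF assms, of k l] b
    by (simp add: cov_mat_def p a curv_mat_eq[OF assms(2)] matrix_vector_mult_add_rdistrib matrix_vector_mult_diff_rdistrib)
qed

lemma cov_mat_trace:
  assumes "smooth_on T U" "x \<in> U"
  shows "trace (cov_mat G k T x) = partial k (\<lambda>y. trace (T y)) x"
  by (simp add: cov_mat_def partial_trace assms trace_add trace_sub trace_mul_sym[of "T x"])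

text \<open>Contracting the Ricci identity exchanges the derivatives in \<nabla>_i \<nabla>_l X^i at
  the price of a Ricci term.\<close>

lemma div_nabla_mat:
  assumes "smooth_on X U" "x \<in> U"
  shows "div_mat G (nabla_mat G X) x = diff_vec (divergence G X) x + ricci_mat G x *v X x"
proof -
  have "div_mat G (nabla_mat G X) x $ l = (\<Sum>i\<in>UNIV. cov_mat G l (nabla_mat G X) x $ i $ i)
      + (\<Sum>i\<in>UNIV. (curv_mat G i l x *v X x) $ i)" for l
    by (simp add: div_mat_def sum.distrib[symmetric] ricci_identity[OF assms, symmetric])
  moreover have "(\<Sum>i\<in>UNIV. cov_mat G l (nabla_mat G X) x $ i $ i) = pd l (divergence G X) x" for l
    using cov_mat_trace[OF smooth_nabla_mat[OF assms(1)] assms(2), of l]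
    by (simp add: trace_def divergence_eq_trace[abs_def] pd_eq_partial)
  moreover have "(\<Sum>i\<in>UNIV. (curv_mat G i l x *v X x) $ i) = (ricci_mat G x *v X x) $ l" for l
    by (simp add: matrix_vector_mult_def curv_mat_def ricci_mat_def ricci_def sum_distrib_right) (rule sum.swap)
  ultimately show ?thesis by (simp add: vec_eq_iff diff_vec_def)
qed

text \<open>The adjoint of \<nabla>X has the components \<nabla>^i X_l, so contracting a further
  derivative with \<open>i\<close> gives the Laplacian with its index lowered.\<close>

lemma laplace_vec_eq:
  assumes "smooth_on X U" "x \<in> U"
  shows "G x *v laplace_vec G X x = div_mat G (adj_mat G (nabla_mat G X)) x"
proof -
  let ?D = "\<lambda>k. cov_mat G k (nabla_mat G X) x"
  have "nabla_mixed G (nabla_vec G X) k l i x = ?D k $ i $ l" for k l i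
    using nabla_mixed_eq[of G "nabla_mat G X" k l i x] partial_nth2[OF smooth_nabla_mat[OF assms(1)] assms(2)]
    by (simp add: cov_mat_def pd_eq_partial) (simp add: nabla_mat_def[abs_def] eta_contract_eq)
  then have "(G x *v laplace_vec G X x) $ l = (\<Sum>b\<in>UNIV. G x $ l $ b * (\<Sum>i\<in>UNIV. \<Sum>a\<in>UNIV. P x $ i $ a * ?D i $ b $ a))" for l
    by (simp add: matrix_vector_mult_def laplace_vec_def ginv_def)
  moreover have "div_mat G (adj_mat G (nabla_mat G X)) x $ l =
     (\<Sum>b\<in>UNIV. G x $ l $ b * (\<Sum>i\<in>UNIV. \<Sum>a\<in>UNIV. P x $ i $ a * ?D i $ b $ a))" for l
  proof -
    have s: "G x $ b $ l = G x $ l $ b" for b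
      by (rule symmetric_nth[OF transpose_G[OF assms(2)]])
    have "div_mat G (adj_mat G (nabla_mat G X)) x $ l =
      (\<Sum>i\<in>UNIV. \<Sum>b\<in>UNIV. G x $ l $ b * (\<Sum>a\<in>UNIV. P x $ i $ a * ?D i $ b $ a))"
      by (simp add: div_mat_def cov_adj[OF smooth_nabla_mat[OF assms(1)] assms(2)] matrix_nth transpose_def s mult.commute)
    then show ?thesis
      by (subst (asm) sum.swap) (simp add: sum_distrib_left)
  qed
  ultimately show ?thesis by (simp add: vec_eq_iff)
qed

lemma div_mat_add:
  assumes "smooth_on S U" "smooth_on T U" "x \<in> U"
  shows "div_mat G (\<lambda>y. S y + T y) x = div_mat G S x + div_mat G T x"
  by (simp add: vec_eq_iff div_mat_def cov_mat_def partial_add assms mat_alg sum.distrib[symmetric] algebra_simps)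

lemma G_P_vec: "x \<in> U \<Longrightarrow> G x *v (P x *v v) = v"
  by (simp add: matrix_vector_mul_assoc GP)

lemma flow_op_eq:
  assumes "smooth_on X U" "x \<in> U"
  shows "G x *v flow_op G X x = div_mat G (\<lambda>y. nabla_mat G X y + adj_mat G (nabla_mat G X) y) x"
  by (simp add: flow_op_def matrix_vector_right_distrib laplace_vec_eq[OF assms] grad_eq G_P_vec assms
      ricci_vec_eq ricci_end_def matrix_vector_mul_assoc[symmetric] div_mat_add smooth_nabla_mat smooth_adj div_nabla_mat
      del: matrix_vector_mul_assoc)

lemma inner_vec_sym: "x \<in> U \<Longrightarrow> inner_vec G X Y x = inner_vec G Y X x"
  using transpose_G[of x] by (metis inner_vec_eq dot_lmul_matrix inner_commute transpose_matrix_vector)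

text \<open>This is 2 <Def(X), Def(Y)>: the first factor is self-adjoint and sees only the
  self-adjoint part of \<nabla>Y. The unsymmetric expression is the one that the product rule
  yields.\<close>

definition def_form :: "(real^'n \<Rightarrow> real^'n) \<Rightarrow> (real^'n \<Rightarrow> real^'n) \<Rightarrow> real^'n \<Rightarrow> real" where
  "def_form X Y x = trace ((nabla_mat G X x + adj_mat G (nabla_mat G X) x) ** nabla_mat G Y x)"

lemma divergence_def_vec:
  assumes "smooth_on X U" "smooth_on Y U" "x \<in> U"
  shows "divergence G (def_vec G X Y) x = inner_vec G (flow_op G X) Y x + def_form X Y x"
proof -
  have "divergence G (def_vec G X Y) x = (G x *v flow_op G X x) \<bullet> Y x + def_form X Y x"
    unfolding def_vec_def[abs_def] def_form_def flow_op_eq[OF assms(1,3)]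
    by (rule divergence_matrix_vector) (auto intro!: smooths smooth_nabla_mat smooth_adj assms)
  also have "(G x *v flow_op G X x) \<bullet> Y x = inner_vec G (flow_op G X) Y x"
    using inner_vec_sym[OF assms(3)] by (simp add: inner_vec_eq inner_commute)
  finally show ?thesis .
qed

lemma trace_adj_mult:
  assumes "x \<in> U"
  shows "trace (adj_mat G S x ** T x) = trace (adj_mat G T x ** S x)"
proof -
  have "trace (adj_mat G S x ** T x) = trace (transpose (P x ** transpose (S x) ** G x ** T x))"
    by (simp add: trace_transpose adj_mat_def)
  also have "\<dots> = trace ((transpose (T x) ** G x ** S x) ** P x)"
    by (simp add: matrix_transpose_mul transpose_G transpose_P assms matrix_mul_assoc)
  also have "\<dots> = trace (P x ** (transpose (T x) ** G x ** S x))" by (rule trace_mul_sym)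
  finally show ?thesis by (simp add: adj_mat_def matrix_mul_assoc)
qed

lemma def_form_sym: "x \<in> U \<Longrightarrow> def_form X Y x = def_form Y X x"
  using trace_adj_mult[of x "nabla_mat G X" "nabla_mat G Y"]
  by (simp add: def_form_def mat_alg trace_add trace_mul_sym[of "nabla_mat G X x"])

lemma psd_G: "x \<in> U \<Longrightarrow> v \<bullet> (G x *v v) \<ge> 0"
  using posdef_G[of x] unfolding posdef_def by (cases "v = 0") (auto intro: less_imp_le)

lemma psd_P: assumes "x \<in> U" shows "v \<bullet> (P x *v v) \<ge> 0"
  using psd_G[OF assms, of "P x *v v"] by (simp add: G_P_vec[OF assms] inner_commute del: matrix_vector_mul_assoc)

text \<open>For the self-adjoint \<open>B\<close>, tr(B B) is the trace of \<open>P\<close> times a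
  positive semidefinite matrix. Since \<open>A\<close> and its adjoint have the same trace against
  \<open>B\<close>, tr(B B) is twice the form in question.\<close>

lemma def_form_nonneg:
  assumes "x \<in> U"
  shows "def_form X X x \<ge> 0"
proof -
  define A where "A = nabla_mat G X x"
  define B where "B = A + P x ** transpose A ** G x"
  have adj: "P x ** transpose B ** G x = B"
  proof -
    have "transpose B = transpose A + G x ** (A ** P x)"
      by (simp add: B_def transpose_add matrix_transpose_mul transpose_G transpose_P assms)
    then have "P x ** transpose B ** G x = P x ** transpose A ** G x + (P x ** G x) ** A ** (P x ** G x)"
      by (simp add: mat_alg)
    then show ?thesis by (simp add: PG[OF assms] B_def add.commute)
  qed
  have "trace (P x ** (transpose B ** G x ** B)) \<ge> 0"
  proof (rule psd_trace_mult_nonneg[OF transpose_P[OF assms] psd_P[OF assms]])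
    show "0 \<le> v \<bullet> ((transpose B ** G x ** B) *v v)" for v
    proof -
      have "v \<bullet> ((transpose B ** G x ** B) *v v) = (B *v v) \<bullet> (G x *v (B *v v))"
        by (metis dot_lmul_matrix inner_commute matrix_vector_mul_assoc transpose_matrix_vector)
      then show ?thesis using psd_G[OF assms] by simp
    qed
  qed
  then have "trace (B ** B) \<ge> 0" using adj by (simp add: matrix_mul_assoc)
  also have "trace (B ** B) = trace (B ** A) + trace (B ** (P x ** transpose A ** G x))"
    by (simp add: B_def mat_alg trace_add)
  also have "trace (B ** (P x ** transpose A ** G x)) = trace (B ** A)"
  proof -
    have "trace (B ** (P x ** transpose A ** G x)) = trace ((P x ** transpose A ** G x) ** B)" by (rule trace_mul_sym)
    also have "\<dots> = trace ((P x ** transpose B ** G x) ** A)"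
      using trace_adj_mult[OF assms, of "\<lambda>_. A" "\<lambda>_. B"] by (simp add: adj_mat_def)
    finally show ?thesis by (simp add: adj)
  qed
  finally show ?thesis by (simp add: def_form_def B_def A_def adj_mat_def)
qed

end

section \<open>Hessians, the contracted Bianchi identity and the flux\<close>

context chart_metric
begin

lemma minus_matrix_vector: "(- A :: real^'m::finite^'k) *v v = - (A *v v)"
  by (simp add: vec_eq_iff matrix_vector_mult_def sum_negf)

text \<open>The derivative of \<open>P\<close> cancels the connection term of the raised index,
  which leaves the Hessian with one index raised.\<close>

lemma nabla_mat_grad:
  assumes "smooth_on f U" "x \<in> U"
  shows "nabla_mat G (grad G f) x = P x ** (\<chi> l i. nabla_covec G (\<lambda>j. pd j f) i l x)"
proof -
  have g: "partial i (grad G f) x = P x *v partial i (diff_vec f) x + partial i P x *v diff_vec f x" for i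
    unfolding grad_eq[abs_def] by (rule partial_matrix_vector_mult[OF smooth_P smooth_diff_vec[OF assms(1)] assms(2)])
  have h: "(\<chi> l. nabla_covec G (\<lambda>j. pd j f) i l x) = partial i (diff_vec f) x - transpose (\<Gamma> i x) *v diff_vec f x" for i
    using partial_nth[OF smooth_diff_vec[OF assms(1)] assms(2), symmetric]
    by (simp add: vec_eq_iff nabla_covec_def pd_eq_partial matrix_vector_mult_def transpose_def chr_mat_def
        del: transpose_matrix_vector) (simp add: diff_vec_def pd_eq_partial eta_contract_eq)
  have "nabla_mat G (grad G f) x $ j $ i = (P x *v (\<chi> l. nabla_covec G (\<lambda>j. pd j f) i l x)) $ j" for i j
    unfolding nabla_mat_nth[OF smooth_grad[OF assms(1)] assms(2)] g partial_P[OF assms(2)] grad_eq h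
    by (simp add: matrix_vector_mult_add_rdistrib matrix_vector_mult_diff_rdistrib matrix_vector_mult_diff_distrib
        minus_matrix_vector matrix_vector_mul_assoc del: transpose_matrix_vector)
  then show ?thesis by (simp add: vec_eq_iff matrix_nth matrix_vector_mult_def)
qed

lemma laplace_fun_eq:
  assumes "smooth_on f U" "x \<in> U"
  shows "laplace_fun G f x = divergence G (grad G f) x"
proof -
  have "P x $ i $ j = P x $ j $ i" for i j
    by (rule symmetric_nth[OF transpose_P[OF assms(2)]])
  then show ?thesis
    by (simp add: laplace_fun_def divergence_eq_trace nabla_mat_grad[OF assms] trace_def matrix_nth ginv_def)
qed

text \<open>\<open>P\<close> times a symmetric matrix is self-adjoint, and the Hessian is symmetric
  because partial derivatives commute and the connection has no torsion.\<close>

lemma adj_nabla_mat_grad: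
  assumes "smooth_on f U" "x \<in> U"
  shows "adj_mat G (nabla_mat G (grad G f)) x = nabla_mat G (grad G f) x"
proof -
  define H where "H = (\<chi> l i. nabla_covec G (\<lambda>j. pd j f) i l x)"
  have "transpose H = H"
    using pd_commute[OF assms(1) open_U assms(2)] christoffel_sym[OF assms(2)]
    by (simp add: H_def vec_eq_iff transpose_def nabla_covec_def)
  then have "P x ** transpose (P x ** H) ** G x = P x ** H ** (P x ** G x)"
    by (simp add: matrix_transpose_mul transpose_P[OF assms(2)] matrix_mul_assoc)
  then show ?thesis by (simp add: adj_mat_def nabla_mat_grad[OF assms] H_def PG[OF assms(2)])
qed

lemma div_mat_cong:
  assumes "\<And>y. y \<in> U \<Longrightarrow> S y = T y" "x \<in> U"
  shows "div_mat G S x = div_mat G T x"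
proof -
  have "partial i S x = partial i T x" for i by (rule partial_cong[OF open_U assms(2,1)])
  then show ?thesis by (simp add: div_mat_def cov_mat_def assms)
qed

lemma flow_op_grad:
  assumes "smooth_on f U" "x \<in> U"
  shows "G x *v flow_op G (grad G f) x =
    2 *\<^sub>R (diff_vec (divergence G (grad G f)) x + ricci_mat G x *v grad G f x)"
proof -
  let ?A = "nabla_mat G (grad G f)"
  have "G x *v flow_op G (grad G f) x = div_mat G (\<lambda>y. ?A y + adj_mat G ?A y) x"
    by (rule flow_op_eq[OF smooth_grad[OF assms(1)] assms(2)])
  also have "\<dots> = div_mat G (\<lambda>y. ?A y + ?A y) x"
    by (rule div_mat_cong) (simp_all add: adj_nabla_mat_grad assms)
  also have "\<dots> = div_mat G ?A x + div_mat G ?A x"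
    by (rule div_mat_add) (auto intro!: smooth_nabla_mat smooth_grad assms)
  finally show ?thesis
    by (simp add: div_nabla_mat[OF smooth_grad[OF assms(1)] assms(2)] scaleR_2)
qed

lemma partial_ricci:
  assumes "x \<in> U"
  shows "partial k (ricci_mat G) x $ j $ m = (\<Sum>i\<in>UNIV. partial k (curv_mat G i j) x $ i $ m)"
proof -
  have "partial k (ricci_mat G) x $ j $ m = partial k (\<lambda>y. ricci_mat G y $ j $ m) x"
    by (rule partial_nth2[OF smooth_ricci assms, symmetric])
  also have "\<dots> = partial k (\<lambda>y. \<Sum>i\<in>UNIV. curv_mat G i j y $ i $ m) x"
    by (simp add: ricci_mat_def ricci_def curv_mat_def)
  also have "\<dots> = (\<Sum>i\<in>UNIV. partial k (\<lambda>y. curv_mat G i j y $ i $ m) x)"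
    by (rule partial_sum) (auto intro!: smooth_on_nth smooth_curv open_U assms)
  finally show ?thesis by (simp add: partial_nth2[OF smooth_curv assms])
qed

text \<open>\<open>cov_ricci k\<close> is \<open>\<nabla>\<^sub>k R\<^sub>i\<^sub>j\<close>, and \<open>cov_curv m i j\<close> is \<open>\<nabla>\<^sub>m R\<^sup>l\<^sub>i\<^sub>j\<^sub>k\<close>.\<close>

definition cov_ricci :: "'n \<Rightarrow> real^'n \<Rightarrow> real^'n^'n" where
  "cov_ricci k x = partial k (ricci_mat G) x - transpose (\<Gamma> k x) ** ricci_mat G x - ricci_mat G x ** \<Gamma> k x"

definition cov_curv :: "'n \<Rightarrow> 'n \<Rightarrow> 'n \<Rightarrow> real^'n \<Rightarrow> real^'n^'n" where
  "cov_curv m i j x = cov_mat G m (curv_mat G i j) x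
     - (\<Sum>a\<in>UNIV. (\<Gamma> m x $ a $ i) *\<^sub>R curv_mat G a j x) - (\<Sum>a\<in>UNIV. (\<Gamma> m x $ a $ j) *\<^sub>R curv_mat G i a x)"

lemma partial_minus: "smooth_on F U \<Longrightarrow> x \<in> U \<Longrightarrow> partial i (\<lambda>x. - F x) x = - partial i F x"
  by (rule partial_linear[OF bounded_linear_minus[OF bounded_linear_ident]])

lemma cov_mat_curv_antisym:
  assumes "x \<in> U"
  shows "cov_mat G m (curv_mat G i j) x = - cov_mat G m (curv_mat G j i) x"
proof -
  have "curv_mat G i j = (\<lambda>x. - curv_mat G j i x)" using curv_mat_antisym by blast
  then show ?thesis
    using partial_minus[OF smooth_curv assms, of m j i]
    by (simp add: cov_mat_def matrix_minus_left matrix_minus_right)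
qed

lemma cov_curv_antisym:
  assumes "x \<in> U"
  shows "cov_curv m i j x = - cov_curv m j i x"
proof -
  have "(\<Sum>a\<in>UNIV. c a *\<^sub>R curv_mat G a k x) = - (\<Sum>a\<in>UNIV. c a *\<^sub>R curv_mat G k a x)" for c k
    by (subst curv_mat_antisym) (simp add: sum_negf)
  then show ?thesis
    by (simp add: cov_curv_def cov_mat_curv_antisym[OF assms, of m i j])
qed

text \<open>The corrections for the base indices cancel in the cyclic sum, by the symmetry of
  \<Gamma> and the antisymmetry of the curvature, so the identity is inherited from
  \<open>second_bianchi\<close>.\<close>

lemma cov_curv_bianchi:
  assumes "x \<in> U"
  shows "cov_curv m i j x + cov_curv i j m x + cov_curv j m i x = 0"
proof -
  have s: "(\<Sum>a\<in>UNIV. c a *\<^sub>R curv_mat G a k x) = - (\<Sum>a\<in>UNIV. c a *\<^sub>R curv_mat G k a x)" for c k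
    by (subst curv_mat_antisym) (simp add: sum_negf)
  have "\<Gamma> k x $ a $ l = \<Gamma> l x $ a $ k" for k l a
    by (simp add: chr_nth christoffel_sym[OF assms, of a k l])
  then have t: "(\<Sum>a\<in>UNIV. \<Gamma> k x $ a $ l *\<^sub>R curv_mat G b a x) = (\<Sum>a\<in>UNIV. \<Gamma> l x $ a $ k *\<^sub>R curv_mat G b a x)" for b k l
    by simp
  show ?thesis
    using second_bianchi[OF assms, of m i j] t[of m i j] t[of m j i] t[of i j m]
    by (simp add: cov_curv_def s algebra_simps)
qed

text \<open>Contraction commutes with covariant differentiation: the connection terms of the two
  contracted indices cancel by fact \<open>1\<close>, and those of the free indices are the ones in
  \<open>cov_ricci\<close>.\<close>

lemma sum_cov_curv:
  assumes "x \<in> U"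
  shows "(\<Sum>m\<in>UNIV. cov_curv j m i x $ m $ k) = cov_ricci j x $ i $ k"
proof -
  have ric: "ricci_mat G x $ i $ k = (\<Sum>m\<in>UNIV. curv_mat G m i x $ m $ k)" for i k
    by (simp add: ricci_mat_def ricci_def curv_mat_def)
  have 1: "(\<Sum>m\<in>UNIV. (\<Gamma> j x ** curv_mat G m i x) $ m $ k) =
      (\<Sum>m\<in>UNIV. \<Sum>a\<in>UNIV. \<Gamma> j x $ a $ m * curv_mat G a i x $ m $ k)"
    by (simp add: matrix_nth) (rule sum.swap)
  have 2: "(\<Sum>m\<in>UNIV. (curv_mat G m i x ** \<Gamma> j x) $ m $ k) = (ricci_mat G x ** \<Gamma> j x) $ i $ k"
    by (simp add: matrix_nth ric sum_distrib_right) (rule sum.swap)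
  have 3: "(\<Sum>m\<in>UNIV. \<Sum>a\<in>UNIV. \<Gamma> j x $ a $ i * curv_mat G m a x $ m $ k) = (transpose (\<Gamma> j x) ** ricci_mat G x) $ i $ k"
    by (simp add: matrix_nth transpose_def ric sum_distrib_left) (rule sum.swap)
  show ?thesis
    by (simp add: cov_curv_def cov_mat_def cov_ricci_def sum.distrib sum_subtractf 1 2 3 partial_ricci[OF assms])
qed

text \<open>Raising the last index turns skewness with respect to the metric into antisymmetry of an
  ordinary matrix, a property that can be differentiated directly.\<close>

lemma curv_mat_P:
  assumes "x \<in> U"
  shows "transpose (curv_mat G i j x ** P x) = - (curv_mat G i j x ** P x)"
proof -
  let ?C = "curv_mat G i j x"
  have "transpose (?C ** P x) = P x ** (transpose ?C ** G x) ** P x"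
    by (simp add: matrix_transpose_mul transpose_P[OF assms] matrix_mul_assoc[symmetric] GP[OF assms])
  also have "transpose ?C ** G x = - (G x ** ?C)" using curv_mat_skew[OF assms, of i j] by simp
  also have "P x ** (- (G x ** ?C)) ** P x = - ((P x ** G x) ** ?C ** P x)" by (simp add: mat_alg)
  finally show ?thesis by (simp add: PG[OF assms])
qed

lemma cov_curv_P:
  assumes "x \<in> U"
  shows "transpose (cov_curv m i j x ** P x) = - (cov_curv m i j x ** P x)"
proof -
  let ?C = "curv_mat G i j" let ?S = "\<lambda>y. ?C y ** P y"
  have S: "partial m ?S x = ?C x ** partial m P x + partial m ?C x ** P x"
    by (rule partial_matrix_mult[OF smooth_curv smooth_P assms])
  have "transpose (partial m ?S x) = partial m (\<lambda>y. transpose (?S y)) x"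
    by (rule partial_transpose[symmetric]) (auto intro!: smooths smooth_curv smooth_P assms)
  also have "\<dots> = partial m (\<lambda>y. - ?S y) x"
    by (rule partial_cong[OF open_U assms]) (rule curv_mat_P)
  also have "\<dots> = - partial m ?S x"
    by (rule partial_minus[OF _ assms]) (intro smooths smooth_curv smooth_P)
  finally have dS: "transpose (partial m ?S x) = - partial m ?S x" .
  \<comment> \<open>As \<open>P\<close> is parallel, the index may be raised before differentiating.
    The right-hand side is the covariant derivative of a tensor with two upper indices, which
    preserves antisymmetry.\<close>
  have "cov_mat G m ?C x ** P x = partial m ?S x + ?S x ** transpose (\<Gamma> m x) + \<Gamma> m x ** ?S x"
    by (simp add: S cov_mat_def partial_P[OF assms] mat_alg)
  then have "transpose (cov_mat G m ?C x ** P x) = - (cov_mat G m ?C x ** P x)"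
    by (simp add: transpose_add dS matrix_transpose_mul[of "?S x"] matrix_transpose_mul[of "\<Gamma> m x"]
        curv_mat_P[OF assms] matrix_minus_left matrix_minus_right)
  then show ?thesis
    by (simp add: cov_curv_def matrix_diff_rdistrib matrix_sum_left matrix_scaleR_left transpose_diff
        transpose_sum transpose_scalar curv_mat_P[OF assms] sum_negf)
qed

lemma cov_ricci_end:
  assumes "x \<in> U"
  shows "cov_mat G k (ricci_end G) x = P x ** cov_ricci k x"
  unfolding cov_mat_def ricci_end_def cov_ricci_def
  by (simp add: partial_matrix_mult[OF smooth_P smooth_ricci assms] partial_P[OF assms] mat_alg)

text \<open>Contract \<open>\<nabla>\<^sub>m R\<^sup>m\<^sub>i\<^sub>j\<^sub>k\<close> with \<open>g\<^sup>j\<^sup>k\<close>: skewness turns the first term of the second Bianchi identity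
  into the third.\<close>

lemma contracted_bianchi:
  assumes "x \<in> U"
  shows "2 *\<^sub>R div_mat G (ricci_end G) x = diff_vec (scalar_curvature G) x"
proof -
  have Ps: "P x $ i $ j = P x $ j $ i" for i j
    by (rule symmetric_nth[OF transpose_P[OF assms]])
  have Rs: "cov_ricci m x $ i $ k = cov_ricci m x $ k $ i" for m i k
  proof (rule symmetric_nth)
    have "transpose (partial m (ricci_mat G) x) = partial m (\<lambda>y. transpose (ricci_mat G y)) x"
      by (rule partial_transpose[symmetric, OF smooth_ricci assms])
    also have "\<dots> = partial m (ricci_mat G) x"
      by (rule partial_cong[OF open_U assms]) (rule ricci_sym)
    finally show "transpose (cov_ricci m x) = cov_ricci m x"
      by (simp add: cov_ricci_def transpose_diff matrix_transpose_mul ricci_sym[OF assms])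
  qed
  have dv: "div_mat G (ricci_end G) x $ i = (\<Sum>m\<in>UNIV. \<Sum>k\<in>UNIV. P x $ k $ m * cov_ricci m x $ i $ k)" for i
    by (simp add: div_mat_def cov_ricci_end[OF assms] matrix_nth Ps Rs[of _ i])
  have "2 * div_mat G (ricci_end G) x $ i = pd i (scalar_curvature G) x" for i
  proof -
    \<comment> \<open>The second Bianchi identity contracted over \<open>m\<close> and, with the
      inverse metric, over \<open>j\<close> and \<open>k\<close>. The middle term becomes
      -\<nabla>_i R, the outer two both become the divergence of Ricci.\<close>
    have "0 = (\<Sum>j\<in>UNIV. \<Sum>k\<in>UNIV. P x $ k $ j * (\<Sum>m\<in>UNIV. (cov_curv m i j x + cov_curv i j m x + cov_curv j m i x) $ m $ k))"
      by (simp add: cov_curv_bianchi[OF assms] del: vector_add_component)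
    also have "\<dots> = (\<Sum>j\<in>UNIV. \<Sum>k\<in>UNIV. P x $ k $ j * (\<Sum>m\<in>UNIV. cov_curv m i j x $ m $ k))
        - (\<Sum>j\<in>UNIV. \<Sum>k\<in>UNIV. P x $ k $ j * cov_ricci i x $ j $ k)
        + (\<Sum>j\<in>UNIV. \<Sum>k\<in>UNIV. P x $ k $ j * cov_ricci j x $ i $ k)"
    proof -
      have "(\<Sum>m\<in>UNIV. cov_curv i j m x $ m $ k) = - cov_ricci i x $ j $ k" for j k
        using cov_curv_antisym[OF assms, of i j] by (simp add: sum_cov_curv[OF assms, symmetric] sum_negf)
      then show ?thesis
        by (simp add: sum_cov_curv[OF assms] sum.distrib sum_subtractf sum_negf distrib_left right_diff_distrib)
    qed
    also have "(\<Sum>j\<in>UNIV. \<Sum>k\<in>UNIV. P x $ k $ j * cov_ricci j x $ i $ k) = div_mat G (ricci_end G) x $ i"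
      by (rule dv[symmetric])
    also have "(\<Sum>j\<in>UNIV. \<Sum>k\<in>UNIV. P x $ k $ j * cov_ricci i x $ j $ k) = trace (P x ** cov_ricci i x)"
      by (simp add: trace_def matrix_nth Ps Rs)
    also have "trace (P x ** cov_ricci i x) = partial i (\<lambda>y. trace (ricci_end G y)) x"
      using cov_mat_trace[OF smooth_ricci_end assms] by (simp add: cov_ricci_end[OF assms])
    also have "\<dots> = pd i (scalar_curvature G) x"
      unfolding pd_eq_partial by (rule partial_cong[OF open_U assms]) (simp add: scalar_curvature_trace)
    also have "(\<Sum>j\<in>UNIV. \<Sum>k\<in>UNIV. P x $ k $ j * (\<Sum>m\<in>UNIV. cov_curv m i j x $ m $ k)) =
        (\<Sum>m\<in>UNIV. \<Sum>j\<in>UNIV. (cov_curv m i j x ** P x) $ m $ j)"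
    proof -
      have "(\<Sum>j\<in>UNIV. \<Sum>k\<in>UNIV. P x $ k $ j * (\<Sum>m\<in>UNIV. cov_curv m i j x $ m $ k)) =
        (\<Sum>j\<in>UNIV. \<Sum>m\<in>UNIV. (cov_curv m i j x ** P x) $ m $ j)"
      proof (rule sum.cong[OF refl])
        show "(\<Sum>k\<in>UNIV. P x $ k $ j * (\<Sum>m\<in>UNIV. cov_curv m i j x $ m $ k)) =
            (\<Sum>m\<in>UNIV. (cov_curv m i j x ** P x) $ m $ j)" for j
          unfolding matrix_nth sum_distrib_left by (subst sum.swap) (simp add: mult.commute)
      qed
      also have "\<dots> = (\<Sum>m\<in>UNIV. \<Sum>j\<in>UNIV. (cov_curv m i j x ** P x) $ m $ j)"
        by (rule sum.swap)
      finally show ?thesis .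
    qed
    also have "\<dots> = (\<Sum>m\<in>UNIV. \<Sum>j\<in>UNIV. (cov_curv m j i x ** P x) $ j $ m)"
    proof -
      have "(cov_curv m i j x ** P x) $ m $ j = (cov_curv m j i x ** P x) $ j $ m" for m j
      proof -
        have "transpose (cov_curv m i j x ** P x) $ j $ m = (- (cov_curv m i j x ** P x)) $ j $ m"
          by (simp only: cov_curv_P[OF assms])
        then show ?thesis
          by (simp add: transpose_def cov_curv_antisym[OF assms, of m i j] matrix_minus_left)
      qed
      then show ?thesis by simp
    qed
    also have "\<dots> = (\<Sum>m\<in>UNIV. \<Sum>k\<in>UNIV. P x $ k $ m * (\<Sum>j\<in>UNIV. cov_curv m j i x $ j $ k))"
    proof (rule sum.cong[OF refl])
      show "(\<Sum>j\<in>UNIV. (cov_curv m j i x ** P x) $ j $ m) =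
          (\<Sum>k\<in>UNIV. P x $ k $ m * (\<Sum>j\<in>UNIV. cov_curv m j i x $ j $ k))" for m
        unfolding matrix_nth sum_distrib_left by (subst sum.swap) (simp add: mult.commute)
    qed
    also have "\<dots> = div_mat G (ricci_end G) x $ i"
      by (simp add: sum_cov_curv[OF assms] dv)
    finally show ?thesis by simp
  qed
  then show ?thesis by (simp add: vec_eq_iff diff_vec_def)
qed

lemma divergence_scaleR:
  assumes "smooth_on f U" "smooth_on X U" "x \<in> U"
  shows "divergence G (\<lambda>y. f y *\<^sub>R X y) x = f x * divergence G X x + diff_vec f x \<bullet> X x"
proof -
  have s: "smooth_on (\<lambda>y. f y *\<^sub>R X y) U" by (intro smooths assms)
  show ?thesis
    by (simp add: divergence_eq_trace trace_def nabla_mat_nth[OF s assms(3)] nabla_mat_nth[OF assms(2,3)]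
        partial_scaleR[OF assms] matrix_vector_mult_scaleR sum.distrib sum_distrib_left distrib_left
        Finite_Cartesian_Product.inner_vec_def diff_vec_def pd_eq_partial)
qed

lemma divergence_add:
  assumes "smooth_on X U" "smooth_on Y U" "x \<in> U"
  shows "divergence G (\<lambda>y. X y + Y y) x = divergence G X x + divergence G Y x"
proof -
  have s: "smooth_on (\<lambda>y. X y + Y y) U" by (intro smooths assms)
  show ?thesis
    by (simp add: divergence_eq_trace trace_def nabla_mat_nth[OF s assms(3)] nabla_mat_nth[OF assms(1,3)]
        nabla_mat_nth[OF assms(2,3)] partial_add[OF assms] matrix_vector_right_distrib sum.distrib)
qed

lemma nabla_covec_lower:
  assumes "smooth_on X U" "x \<in> U"
  shows "nabla_covec G (lower G X) i j x = (G x ** nabla_mat G X x) $ j $ i"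
proof -
  have l: "lower G X j y = (G y *v X y) $ j" for j y by (simp add: lower_def matrix_vector_mult_def)
  have "nabla_covec G (lower G X) i j x = partial i (\<lambda>y. G y *v X y) x $ j - (transpose (\<Gamma> i x) *v (G x *v X x)) $ j"
    using partial_nth[OF smooth_matrix_vector_mult[OF smooth_G assms(1)] assms(2)]
    by (simp add: nabla_covec_def l[abs_def] pd_eq_partial matrix_vector_mult_def transpose_def chr_mat_def
        del: transpose_matrix_vector)
  also have "partial i (\<lambda>y. G y *v X y) x = G x *v partial i X x + partial i G x *v X x"
    by (rule partial_matrix_vector_mult[OF smooth_G assms])
  finally have "nabla_covec G (lower G X) i j x = (G x *v (partial i X x + \<Gamma> i x *v X x)) $ j"
    by (simp add: partial_G[OF assms(2)] matrix_vector_mult_add_rdistrib matrix_vector_right_distrib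
        matrix_vector_mul_assoc del: transpose_matrix_vector)
  then show ?thesis
    by (simp add: matrix_nth nabla_mat_nth[OF assms] matrix_vector_mult_def)
qed

text \<open>Only the symmetric part of \<nabla>X pairs with the symmetric Ricci tensor, so Def may
  be replaced by \<nabla>X. In this form the term arises from div(Ric X).\<close>

lemma inner_ricci_Def:
  assumes "smooth_on X U" "x \<in> U"
  shows "inner_tensor G (ricci G) (Def G X) x = trace (ricci_end G x ** nabla_mat G X x)"
proof -
  define B where "B = G x ** nabla_mat G X x"
  define D where "D = (\<chi> i j. Def G X i j x)"
  let ?R = "ricci_mat G x"
  have D: "D = (1/2) *\<^sub>R (transpose B + B)"
    by (simp add: D_def B_def vec_eq_iff Def_def nabla_covec_lower[OF assms] transpose_def)
  have "inner_tensor G (ricci G) (Def G X) x = trace (?R ** (P x ** D ** P x))"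
  proof -
    have "P x $ i $ j = P x $ j $ i" "?R $ i $ j = ?R $ j $ i" for i j
      using symmetric_nth[OF transpose_P[OF assms(2)]] symmetric_nth[OF ricci_sym[OF assms(2)]] by blast+
    then have "trace (?R ** (P x ** D ** P x)) = (\<Sum>i\<in>UNIV. \<Sum>j\<in>UNIV. ?R $ j $ i * (\<Sum>l\<in>UNIV. \<Sum>k\<in>UNIV. P x $ j $ k * D $ k $ l * P x $ i $ l))"
      by (simp add: trace_def matrix_nth sum_distrib_right)
    also have "\<dots> = (\<Sum>j\<in>UNIV. \<Sum>i\<in>UNIV. ?R $ j $ i * (\<Sum>l\<in>UNIV. \<Sum>k\<in>UNIV. P x $ j $ k * D $ k $ l * P x $ i $ l))"
      by (rule sum.swap)
    also have "\<dots> = (\<Sum>j\<in>UNIV. \<Sum>i\<in>UNIV. ?R $ j $ i * (\<Sum>k\<in>UNIV. \<Sum>l\<in>UNIV. P x $ j $ k * D $ k $ l * P x $ i $ l))"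
      by (intro sum.cong refl arg_cong2[where f = "(*)"] sum.swap)
    finally show ?thesis
      by (simp add: inner_tensor_def ginv_def ricci_mat_def D_def mult_ac)
  qed
  also have "\<dots> = (1/2) * (trace (?R ** (P x ** transpose B ** P x)) + trace (?R ** (P x ** B ** P x)))"
    by (simp add: D matrix_scaleR_left matrix_scaleR_right matrix_add_ldistrib matrix_add_rdistrib distrib_left)
      (simp add: trace_def sum.distrib add_divide_distrib sum_divide_distrib)
  also have "trace (?R ** (P x ** transpose B ** P x)) = trace (?R ** (P x ** B ** P x))"
  proof -
    have "trace (?R ** (P x ** transpose B ** P x)) = trace (transpose (?R ** (P x ** transpose B ** P x)))"
      by (simp add: trace_transpose)
    also have "\<dots> = trace ((P x ** B ** P x) ** ?R)"
      by (simp add: matrix_transpose_mul transpose_P ricci_sym assms matrix_mul_assoc)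
    finally show ?thesis by (simp add: trace_mul_sym[of ?R])
  qed
  also have "trace (?R ** (P x ** B ** P x)) = trace (?R ** (nabla_mat G X x ** P x))"
    by (simp add: B_def matrix_mul_assoc PG[OF assms(2)])
  also have "\<dots> = trace (P x ** (?R ** nabla_mat G X x))"
    by (simp add: matrix_mul_assoc) (metis matrix_mul_assoc trace_mul_sym)
  finally show ?thesis by (simp add: ricci_end_def matrix_mul_assoc)
qed

text \<open>The summands are the fields whose divergences are split off from <L \<nabla>R, X>. The
  term 2 <\<nabla>\<Delta>R, X> gives the first, 2 Ric(\<nabla>R, X) the second. The latter leaves
  -R <\<nabla>R, X>, which is half the derivative of -R^2 along X and gives the third; this is the
  origin of R^2/4 in the theorem.\<close>

definition flux :: "(real^'n \<Rightarrow> real^'n) \<Rightarrow> real^'n \<Rightarrow> real^'n" where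
  "flux X y = (2 * laplace_fun G (scalar_curvature G) y) *\<^sub>R X y
     + (2 * scalar_curvature G y) *\<^sub>R ricci_vec G X y + (- (scalar_curvature G y)\<^sup>2 / 2) *\<^sub>R X y"

lemma smooth_laplace_fun: "smooth_on f U \<Longrightarrow> smooth_on (laplace_fun G f) U"
  by (subst smooth_on_cong[OF laplace_fun_eq]) (auto intro!: smooth_divergence smooth_grad)

lemma smooth_flux: "smooth_on X U \<Longrightarrow> smooth_on (flux X) U"
  unfolding flux_def power2_eq_square minus_divide_left[symmetric] divide_inverse
  by (intro smooths smooth_laplace_fun smooth_scalar_curvature smooth_ricci_vec)

lemma inner_flow_op_grad_scalar_curvature:
  assumes X: "smooth_on X U" and x: "x \<in> U"
  shows "inner_vec G (flow_op G (grad G (scalar_curvature G))) X x =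
    2 * ((- laplace_fun G (scalar_curvature G) x + (scalar_curvature G x)\<^sup>2 / 4) * divergence G X x)
    - 2 * (scalar_curvature G x * inner_tensor G (ricci G) (Def G X) x) + divergence G (flux X) x"
proof -
  let ?S = "scalar_curvature G" let ?L = "laplace_fun G ?S" let ?Q = "ricci_vec G X"
  note sS = smooth_scalar_curvature and sL = smooth_laplace_fun[OF smooth_scalar_curvature]
  have sc: "smooth_on (\<lambda>y. 2 * ?L y) U" "smooth_on (\<lambda>y. 2 * ?S y) U" "smooth_on (\<lambda>y. - (?S y)\<^sup>2 / 2) U"
    unfolding power2_eq_square minus_divide_left[symmetric] divide_inverse by (intro smooths sS sL)+
  have d2: "diff_vec (\<lambda>y. 2 * f y) x = 2 *\<^sub>R diff_vec f x" if "smooth_on f U" for f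
    using pd_cmult[OF smooth_differentiable[OF that x], of _ 2] by (simp add: diff_vec_def vec_eq_iff)
  have d3: "diff_vec (\<lambda>y. - (?S y)\<^sup>2 / 2) x = (- ?S x) *\<^sub>R diff_vec ?S x"
  proof -
    have "pd i (\<lambda>y. (- 1/2) * (?S y * ?S y)) x = - (?S x * pd i ?S x)" for i
      by (subst pd_cmult) (use smooth_mult[OF sS sS] smooth_differentiable[OF sS x] x in \<open>auto simp: pd_mult\<close>)
    then show ?thesis by (simp add: diff_vec_def vec_eq_iff power2_eq_square)
  qed
  have "inner_vec G (flow_op G (grad G ?S)) X x = (G x *v flow_op G (grad G ?S) x) \<bullet> X x"
    by (subst inner_vec_sym[OF x]) (simp add: inner_vec_eq inner_commute)
  also have "\<dots> = 2 * (diff_vec (divergence G (grad G ?S)) x \<bullet> X x) + 2 * ((ricci_mat G x *v grad G ?S x) \<bullet> X x)"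
    by (simp add: flow_op_grad[OF sS x] inner_add_left)
  also have "diff_vec (divergence G (grad G ?S)) x = diff_vec ?L x"
    using pd_cong[OF open_U x, of "divergence G (grad G ?S)" ?L] laplace_fun_eq[OF sS] by (simp add: diff_vec_def)
  also have "(ricci_mat G x *v grad G ?S x) \<bullet> X x = diff_vec ?S x \<bullet> ?Q x"
  proof -
    have "(ricci_mat G x *v (P x *v d)) \<bullet> v = d \<bullet> (P x *v (ricci_mat G x *v v))" for d v
      using ricci_sym[OF x] transpose_P[OF x]
      by (metis dot_lmul_matrix inner_commute transpose_matrix_vector)
    then show ?thesis by (simp add: grad_eq ricci_vec_eq ricci_end_def matrix_vector_mul_assoc[symmetric] del: matrix_vector_mul_assoc)
  qed
  finally have lhs: "inner_vec G (flow_op G (grad G ?S)) X x = 2 * (diff_vec ?L x \<bullet> X x) + 2 * (diff_vec ?S x \<bullet> ?Q x)" .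
  \<comment> \<open>The contracted Bianchi identity replaces twice the divergence of Ricci by the
    differential of the scalar curvature.\<close>
  have Q: "2 * divergence G ?Q x = diff_vec ?S x \<bullet> X x + 2 * inner_tensor G (ricci G) (Def G X) x"
    unfolding ricci_vec_eq[abs_def]
    by (simp add: divergence_matrix_vector[OF smooth_ricci_end X x] inner_ricci_Def[OF X x]
        contracted_bianchi[OF x, symmetric])
  have "divergence G (flux X) x = (2 * ?L x * divergence G X x + 2 * (diff_vec ?L x \<bullet> X x))
     + (2 * ?S x * divergence G ?Q x + 2 * (diff_vec ?S x \<bullet> ?Q x))
     + (- (?S x)\<^sup>2 / 2 * divergence G X x - ?S x * (diff_vec ?S x \<bullet> X x))"
    unfolding flux_def[abs_def]
      divergence_add[OF smooth_add[OF smooth_scaleR[OF sc(1) X] smooth_scaleR[OF sc(2) smooth_ricci_vec[OF X]]]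
        smooth_scaleR[OF sc(3) X] x]
      divergence_add[OF smooth_scaleR[OF sc(1) X] smooth_scaleR[OF sc(2) smooth_ricci_vec[OF X]] x]
      divergence_scaleR[OF sc(1) X x] divergence_scaleR[OF sc(2) smooth_ricci_vec[OF X] x]
      divergence_scaleR[OF sc(3) X x] d2[OF sS] d2[OF sL] d3
    by simp
  also have "2 * ?S x * divergence G ?Q x = ?S x * (diff_vec ?S x \<bullet> X x + 2 * inner_tensor G (ricci G) (Def G X) x)"
    by (simp add: Q[symmetric])
  finally show ?thesis by (simp add: lhs algebra_simps)
qed

end

section \<open>Change of coordinates\<close>

context chart_metric
begin

text \<open>The uniqueness of the Levi-Civita connection. The difference \<open>S\<close>, with its
  index lowered, is symmetric in one pair of indices and antisymmetric in another; alternating the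
  two swaps returns it to its own negative.\<close>

lemma chr_unique:
  assumes x: "x \<in> U"
    and metric: "\<And>i. partial i G x = transpose (C i) ** G x + G x ** C i"
    and sym: "\<And>i j l. C i $ l $ j = C j $ l $ i"
  shows "C i = \<Gamma> i x"
proof -
  define S where "S i = G x ** (C i - \<Gamma> i x)" for i
  have s1: "S i $ k $ j = S j $ k $ i" for i j k
    by (simp add: S_def matrix_nth sym[of i _ j] chr_nth christoffel_sym[OF x, of _ i j])
  have s2: "S i $ k $ j = - S i $ j $ k" for i j k
  proof -
    have "transpose (S i) = - S i"
      using metric[of i] partial_G[OF x, of i]
      by (simp add: S_def matrix_transpose_mul transpose_diff transpose_G[OF x] mat_alg algebra_simps)
    then have "transpose (S i) $ j $ k = (- S i) $ j $ k" by simp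
    then show ?thesis by (simp add: transpose_def)
  qed
  have "S i $ k $ j = 0" for i j k
    using s1[of i k j] s2[of i k j] s1[of i j k] s2[of j i k] s1[of j i k] s2[of k i j] s1[of k j i] by linarith
  then have "S i = 0" for i by (simp add: vec_eq_iff)
  then have "P x ** S i = 0" by (simp add: matrix_zero_right)
  then show ?thesis by (simp add: S_def matrix_mul_assoc PG[OF x])
qed

end

lemma frechet_derivative_expand:
  fixes F :: "real^'n::finite \<Rightarrow> 'b::real_normed_vector"
  assumes "F differentiable (at x)"
  shows "frechet_derivative F (at x) v = (\<Sum>i\<in>UNIV. v $ i *\<^sub>R partial i F x)"
proof -
  have "linear (frechet_derivative F (at x))"
    using assms frechet_derivative_works has_derivative_linear by blast
  then have "frechet_derivative F (at x) (\<Sum>i\<in>UNIV. v $ i *\<^sub>R axis i 1) = (\<Sum>i\<in>UNIV. v $ i *\<^sub>R partial i F x)"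
    by (simp add: linear_sum linear_cmul partial_def)
  then show ?thesis by (simp add: sum_axis)
qed

text \<open>In use, \<open>U\<close> is the overlap in the coordinates of one chart and
  \<open>V\<close> the whole image of the other, so \<tau> maps into \<open>V\<close> without having
  to be onto.\<close>

locale chart_change =
  A: chart_metric U G + B: chart_metric V G'
  for U V :: "(real^'n::finite) set" and G G' :: "'n local_metric" +
  fixes \<tau> :: "real^'n \<Rightarrow> real^'n"
  assumes smooth_\<tau>: "smooth_on \<tau> U" and \<tau>_V: "x \<in> U \<Longrightarrow> \<tau> x \<in> V"
    and metric_\<tau>: "x \<in> U \<Longrightarrow> frechet_derivative \<tau> (at x) v \<bullet> (G' (\<tau> x) *v frechet_derivative \<tau> (at x) w) = v \<bullet> (G x *v w)"
begin

definition J :: "real^'n \<Rightarrow> real^'n^'n" where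
  "J x = (\<chi> a i. partial i \<tau> x $ a)"

lemma smooth_J: "smooth_on J U"
  by (rule A.smooth_mat) (simp add: J_def A.smooth_nth A.smooth_partial smooth_\<tau>)

lemma J_nth: "J x $ a $ i = partial i \<tau> x $ a"
  by (simp add: J_def)

lemma J_mult: "x \<in> U \<Longrightarrow> J x *v v = frechet_derivative \<tau> (at x) v"
  by (simp add: frechet_derivative_expand[OF A.smooth_differentiable[OF smooth_\<tau>]])
    (simp add: vec_eq_iff matrix_vector_mult_def J_def mult.commute)

lemma G_eq:
  assumes "x \<in> U"
  shows "G x = transpose (J x) ** G' (\<tau> x) ** J x"
proof -
  have "v \<bullet> (G x *v w) = v \<bullet> ((transpose (J x) ** G' (\<tau> x) ** J x) *v w)" for v w
    by (simp add: metric_\<tau>[OF assms, symmetric] J_mult[OF assms, symmetric])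
      (metis dot_lmul_matrix matrix_vector_mul_assoc transpose_matrix_vector inner_commute)
  then have "G x *v w = (transpose (J x) ** G' (\<tau> x) ** J x) *v w" for w
    using vector_eq_ldot by blast
  then show ?thesis by (simp add: matrix_eq)
qed

text \<open>The metric relation forces this: det G is nonzero and has det J as a factor.\<close>

lemma J_invertible:
  assumes "x \<in> U"
  shows "invertible (J x)"
proof -
  have "det (G x) \<noteq> 0" using A.inv_G[OF assms] invertible_det_nz by blast
  then show ?thesis by (simp add: G_eq[OF assms] det_mul invertible_det_nz)
qed

abbreviation "K x \<equiv> matrix_inv (J x)"

lemma JK: "x \<in> U \<Longrightarrow> J x ** K x = mat 1" and KJ: "x \<in> U \<Longrightarrow> K x ** J x = mat 1"
  using J_invertible matrix_inv_left matrix_inv_right by blast+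

lemma smooth_comp:
  fixes F :: "real^'n \<Rightarrow> 'b::real_normed_vector"
  shows "smooth_on F V \<Longrightarrow> smooth_on (\<lambda>x. F (\<tau> x)) U"
  using \<tau>_V by (intro smooth_on_compose[OF _ smooth_\<tau> A.open_U B.open_U]) auto

lemma partial_comp:
  fixes F :: "real^'n \<Rightarrow> 'b::real_normed_vector"
  assumes "smooth_on F V" "x \<in> U"
  shows "partial i (\<lambda>x. F (\<tau> x)) x = (\<Sum>a\<in>UNIV. J x $ a $ i *\<^sub>R partial a F (\<tau> x))"
proof -
  have "partial i (\<lambda>x. F (\<tau> x)) x = frechet_derivative F (at (\<tau> x)) (partial i \<tau> x)"
    unfolding partial_def[of i \<tau>] by (rule partial_eqI[OF has_derivative_compose[OF A.smooth_der[OF smooth_\<tau> assms(2)] B.smooth_der[OF assms(1) \<tau>_V[OF assms(2)]]]])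
  then show ?thesis
    by (simp add: frechet_derivative_expand[OF B.smooth_differentiable[OF assms(1) \<tau>_V[OF assms(2)]]] J_def)
qed

text \<open>The connection form of \<open>G'\<close> pulled back along \<tau> and evaluated on the
  \<open>i\<close>-th coordinate direction; its matrix indices still refer to the target
  coordinates.\<close>

definition pulled_chr :: "'n \<Rightarrow> real^'n \<Rightarrow> real^'n^'n" where
  "pulled_chr i x = (\<Sum>b\<in>UNIV. J x $ b $ i *\<^sub>R chr_mat G' b (\<tau> x))"

lemma partial_J: "x \<in> U \<Longrightarrow> partial i J x $ a $ j = partial i (partial j \<tau>) x $ a"
  using A.partial_nth2[OF smooth_J, of x i a j] A.partial_nth[OF A.smooth_partial[OF smooth_\<tau>], of x i j a]
  by (simp add: J_nth)

lemma partial_J_sym: "x \<in> U \<Longrightarrow> partial i J x $ a $ j = partial j J x $ a $ i"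
  using A.partial_commute_vec[OF smooth_\<tau>, of x i j] by (simp add: partial_J)

text \<open>The gauge law of a connection. Rather than transforming the defining formula, the
  pulled-back connection \<open>C\<close> is checked to be torsion-free and compatible with
  \<open>G\<close>, and \<open>chr_unique\<close> identifies it.\<close>

lemma chr_transform:
  assumes x: "x \<in> U"
  shows "J x ** chr_mat G i x = partial i J x + pulled_chr i x ** J x"
proof -
  define C where "C i = K x ** (partial i J x + pulled_chr i x ** J x)" for i
  have pG: "partial i (\<lambda>y. G' (\<tau> y)) x = transpose (pulled_chr i x) ** G' (\<tau> x) + G' (\<tau> x) ** pulled_chr i x" for i
    by (simp add: partial_comp[OF B.smooth_G x] B.partial_G[OF \<tau>_V[OF x]] pulled_chr_def transpose_sum
        transpose_scalar matrix_sum_left matrix_sum_right matrix_scaleR_left matrix_scaleR_right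
        scaleR_add_right sum.distrib)
  have "C i = chr_mat G i x"
  proof (rule A.chr_unique[OF x])
    show "partial i G x = transpose (C i) ** G x + G x ** C i" for i
    proof -
      have GC: "G x ** C i = transpose (J x) ** G' (\<tau> x) ** (partial i J x + pulled_chr i x ** J x)"
      proof -
        have "G x ** C i = transpose (J x) ** G' (\<tau> x) ** (J x ** K x) ** (partial i J x + pulled_chr i x ** J x)"
          by (simp add: C_def G_eq[OF x] matrix_mul_assoc)
        then show ?thesis by (simp add: JK[OF x])
      qed
      have CG: "transpose (C i) ** G x = transpose (G x ** C i)"
        by (simp add: matrix_transpose_mul A.transpose_G[OF x])
      have "partial i G x = partial i (\<lambda>y. transpose (J y) ** G' (\<tau> y) ** J y) x"
        by (rule partial_cong[OF A.open_U x]) (rule G_eq)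
      also have "\<dots> = transpose (J x) ** G' (\<tau> x) ** partial i J x +
          (transpose (J x) ** (transpose (pulled_chr i x) ** G' (\<tau> x) + G' (\<tau> x) ** pulled_chr i x)
            + transpose (partial i J x) ** G' (\<tau> x)) ** J x"
        by (simp add: A.partial_matrix_mult A.smooth_matrix_mult A.smooth_transpose smooth_J smooth_comp B.smooth_G x
            A.partial_transpose pG)
      finally show ?thesis
        unfolding CG GC
        by (simp add: matrix_transpose_mul transpose_add B.transpose_G[OF \<tau>_V[OF x]] mat_alg algebra_simps)
    qed
    show "C i $ l $ j = C j $ l $ i" for i j l
    proof -
      have "(pulled_chr i x ** J x) $ a $ j = (\<Sum>m\<in>UNIV. \<Sum>b\<in>UNIV. J x $ b $ i * J x $ m $ j * christoffel G' a b m (\<tau> x))" for a i j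
        by (simp add: matrix_nth pulled_chr_def sum_distrib_right sum_component chr_mat_def sum_distrib_left mult_ac)
      moreover have "\<dots> a i j = (\<Sum>m\<in>UNIV. \<Sum>b\<in>UNIV. J x $ b $ j * J x $ m $ i * christoffel G' a b m (\<tau> x))" for a i j
        by (subst sum.swap) (simp add: B.christoffel_sym[OF \<tau>_V[OF x], of a] mult_ac)
      ultimately have "(pulled_chr i x ** J x) $ a $ j = (pulled_chr j x ** J x) $ a $ i" for a i j by simp
      then show ?thesis
        by (simp add: C_def matrix_nth[of "K x"] partial_J_sym[OF x, of i _ j])
    qed
  qed
  then have "J x ** chr_mat G i x = (J x ** K x) ** (partial i J x + pulled_chr i x ** J x)"
    by (metis C_def matrix_mul_assoc)
  then show ?thesis by (simp add: JK[OF x])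
qed

text \<open>The term in which \<open>J\<close> itself is differentiated is matched by the
  inhomogeneous term of \<open>chr_transform\<close>.\<close>

lemma nabla_mat_transform:
  assumes X: "smooth_on X U" "smooth_on X' V" and rel: "\<And>y. y \<in> U \<Longrightarrow> X' (\<tau> y) = J y *v X y" and x: "x \<in> U"
  shows "nabla_mat G' X' (\<tau> x) ** J x = J x ** nabla_mat G X x"
proof -
  have "(nabla_mat G' X' (\<tau> x) ** J x) $ j $ i = (J x ** nabla_mat G X x) $ j $ i" for i j
  proof -
    have p: "(\<Sum>a\<in>UNIV. J x $ a $ i *\<^sub>R partial a X' (\<tau> x)) = J x *v partial i X x + partial i J x *v X x"
      unfolding partial_comp[OF X(2) x, symmetric]
      by (subst partial_cong[OF A.open_U x rel]) (auto intro!: A.partial_matrix_vector_mult smooth_J X x)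
    have "(nabla_mat G' X' (\<tau> x) ** J x) $ j $ i =
        ((\<Sum>a\<in>UNIV. J x $ a $ i *\<^sub>R partial a X' (\<tau> x)) + pulled_chr i x *v X' (\<tau> x)) $ j"
      by (simp add: matrix_nth B.nabla_mat_nth[OF X(2) \<tau>_V[OF x]] pulled_chr_def matrix_vector_sum
          matrix_vector_scaleR sum.distrib distrib_left mult.commute)
    also have "\<dots> = (J x *v (partial i X x + chr_mat G i x *v X x)) $ j"
      by (simp add: p rel[OF x] matrix_vector_right_distrib matrix_vector_mul_assoc chr_transform[OF x]
          matrix_vector_mult_add_rdistrib)
    also have "\<dots> = (J x ** nabla_mat G X x) $ j $ i"
      by (simp add: matrix_nth A.nabla_mat_nth[OF X(1) x] matrix_vector_mult_def)
    finally show ?thesis .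
  qed
  then show ?thesis by (simp add: vec_eq_iff)
qed

lemma trace_transform:
  assumes "T' ** J x = J x ** T" "x \<in> U"
  shows "trace T' = trace T"
proof -
  have "T' = J x ** T ** K x"
    using assms by (metis JK matrix_mul_assoc matrix_mul_rid)
  then have "trace T' = trace (K x ** (J x ** T))" by (simp add: trace_mul_sym[of _ "K x"])
  then show ?thesis by (simp add: matrix_mul_assoc KJ[OF assms(2)])
qed

lemma divergence_transform:
  assumes "smooth_on X U" "smooth_on X' V" "\<And>y. y \<in> U \<Longrightarrow> X' (\<tau> y) = J y *v X y" "x \<in> U"
  shows "divergence G' X' (\<tau> x) = divergence G X x"
  by (simp add: A.divergence_eq_trace B.divergence_eq_trace trace_transform[OF nabla_mat_transform[OF assms] assms(4)])

lemma diff_vec_transform: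
  assumes "smooth_on f' V" "\<And>y. y \<in> U \<Longrightarrow> f' (\<tau> y) = f y" "x \<in> U"
  shows "diff_vec f x = transpose (J x) *v diff_vec f' (\<tau> x)"
proof -
  have "pd i f x = (\<Sum>a\<in>UNIV. J x $ a $ i * pd a f' (\<tau> x))" for i
    using partial_comp[OF assms(1,3), where i = i] pd_cong[OF A.open_U assms(3,2), where i = i]
    by (simp add: pd_eq_partial)
  then show ?thesis
    by (simp add: vec_eq_iff diff_vec_def matrix_vector_mult_def transpose_def del: transpose_matrix_vector)
qed

lemma P_transform:
  assumes "x \<in> U"
  shows "matrix_inv (G' (\<tau> x)) = J x ** matrix_inv (G x) ** transpose (J x)"
proof -
  let ?P = "matrix_inv (G x)" and ?P' = "matrix_inv (G' (\<tau> x))"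
  have "J x ** ?P ** transpose (J x) = (J x ** ?P ** transpose (J x)) ** (G' (\<tau> x) ** (J x ** K x) ** ?P')"
    by (simp add: JK[OF assms] B.GP[OF \<tau>_V[OF assms]])
  also have "\<dots> = J x ** (?P ** G x) ** K x ** ?P'"
    by (simp add: G_eq[OF assms] matrix_mul_assoc)
  finally show ?thesis by (simp add: A.PG[OF assms] JK[OF assms])
qed

lemma grad_transform:
  assumes "smooth_on f' V" "\<And>y. y \<in> U \<Longrightarrow> f' (\<tau> y) = f y" "x \<in> U"
  shows "grad G' f' (\<tau> x) = J x *v grad G f x"
  by (simp only: grad_eq diff_vec_transform[OF assms] P_transform[OF assms(3)] matrix_vector_mul_assoc matrix_mul_assoc)

text \<open>Differentiate the gauge law and antisymmetrise. The second derivatives of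
  \<open>J\<close> cancel, and its first derivatives are eliminated by the gauge law itself, so no
  inhomogeneous term survives.\<close>

lemma curv_transform:
  assumes x: "x \<in> U"
  shows "J x ** curv_mat G i j x =
    (\<Sum>b\<in>UNIV. \<Sum>e\<in>UNIV. (J x $ b $ i * J x $ e $ j) *\<^sub>R curv_mat G' b e (\<tau> x)) ** J x"
proof -
  let ?\<Gamma>' = "\<lambda>b y. chr_mat G' b (\<tau> y)"
  have sJ: "smooth_on (\<lambda>y. J y $ a $ i) U" for a i by (intro A.smooth_nth smooth_J)
  have sp: "smooth_on (pulled_chr j) U" for j
    unfolding pulled_chr_def by (intro A.smooths sJ smooth_comp B.smooth_chr)
  \<comment> \<open>The second sum comes from differentiating the coefficients; it is symmetric in
    \<open>i\<close> and \<open>j\<close> and drops out of the curvature.\<close>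
  have dp: "partial i (pulled_chr j) x = (\<Sum>b\<in>UNIV. \<Sum>e\<in>UNIV. (J x $ e $ i * J x $ b $ j) *\<^sub>R partial e (chr_mat G' b) (\<tau> x))
      + (\<Sum>b\<in>UNIV. (partial i J x $ b $ j) *\<^sub>R ?\<Gamma>' b x)" for i j
    unfolding pulled_chr_def
    by (simp add: A.partial_sum A.partial_scaleR A.smooth_scaleR sJ smooth_comp B.smooth_chr x partial_comp
        A.partial_nth2[OF smooth_J] scaleR_sum_right sum.distrib mult.commute)
  have pp: "pulled_chr i x ** pulled_chr j x = (\<Sum>b\<in>UNIV. \<Sum>e\<in>UNIV. (J x $ b $ i * J x $ e $ j) *\<^sub>R (?\<Gamma>' b x ** ?\<Gamma>' e x))" for i j
    by (simp add: pulled_chr_def matrix_sum_left matrix_sum_right matrix_scaleR_left matrix_scaleR_right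
        scaleR_sum_right mult.commute) (subst sum.swap, simp add: mult.commute)
  have curvP: "(\<Sum>b\<in>UNIV. \<Sum>e\<in>UNIV. (J x $ b $ i * J x $ e $ j) *\<^sub>R curv_mat G' b e (\<tau> x)) =
      partial i (pulled_chr j) x - partial j (pulled_chr i) x
      + pulled_chr i x ** pulled_chr j x - pulled_chr j x ** pulled_chr i x"
  proof -
    have 1: "(\<Sum>b\<in>UNIV. \<Sum>e\<in>UNIV. (J x $ b $ i * J x $ e $ j) *\<^sub>R partial b (chr_mat G' e) (\<tau> x)) =
      (\<Sum>b\<in>UNIV. \<Sum>e\<in>UNIV. (J x $ e $ i * J x $ b $ j) *\<^sub>R partial e (chr_mat G' b) (\<tau> x))" for i j
      by (rule sum.swap)
    have 2: "(\<Sum>b\<in>UNIV. \<Sum>e\<in>UNIV. (J x $ b $ j * J x $ e $ i) *\<^sub>R (?\<Gamma>' b x ** ?\<Gamma>' e x)) =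
      (\<Sum>b\<in>UNIV. \<Sum>e\<in>UNIV. (J x $ b $ i * J x $ e $ j) *\<^sub>R (?\<Gamma>' e x ** ?\<Gamma>' b x))"
      by (subst sum.swap) (simp add: mult.commute)
    show ?thesis
      unfolding B.curv_mat_eq[OF \<tau>_V[OF x]] dp pp 2
      by (simp add: scaleR_diff_right scaleR_add_right sum.distrib sum_subtractf 1 partial_J_sym[OF x, of i _ j])
        (simp add: mult.commute)
  qed
  have dC: "partial i J x ** chr_mat G j x + J x ** partial i (chr_mat G j) x =
      partial i (partial j J) x + (partial i (pulled_chr j) x ** J x + pulled_chr j x ** partial i J x)" for i j
  proof -
    have "J x ** partial i (chr_mat G j) x + partial i J x ** chr_mat G j x = partial i (\<lambda>y. J y ** chr_mat G j y) x"
      by (rule A.partial_matrix_mult[symmetric]) (auto intro: smooth_J A.smooth_chr x)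
    also have "\<dots> = partial i (\<lambda>y. partial j J y + pulled_chr j y ** J y) x"
      by (rule partial_cong[OF A.open_U x]) (rule chr_transform)
    also have "\<dots> = partial i (partial j J) x + (pulled_chr j x ** partial i J x + partial i (pulled_chr j) x ** J x)"
      by (simp add: A.partial_add A.partial_matrix_mult A.smooth_partial A.smooth_matrix_mult smooth_J sp x)
    finally show ?thesis by (simp add: add.commute)
  qed
  have dJ: "partial i J x = J x ** chr_mat G i x - pulled_chr i x ** J x" for i
    using chr_transform[OF x, of i] by simp
  have "J x ** partial i (chr_mat G j) x - J x ** partial j (chr_mat G i) x =
      (partial i (pulled_chr j) x ** J x + pulled_chr j x ** partial i J x - partial i J x ** chr_mat G j x)
      - (partial j (pulled_chr i) x ** J x + pulled_chr i x ** partial j J x - partial j J x ** chr_mat G i x)"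
  proof -
    have "J x ** partial i (chr_mat G j) x = partial i (partial j J) x + (partial i (pulled_chr j) x ** J x
        + pulled_chr j x ** partial i J x) - partial i J x ** chr_mat G j x" for i j
      using dC[of i j] by (simp add: eq_diff_eq add.commute)
    then show ?thesis using A.partial_commute_mat[OF smooth_J x, of i j] by simp
  qed
  then show ?thesis
    unfolding curvP A.curv_mat_eq[OF x] mat_alg dJ by (simp add: mat_alg algebra_simps)
qed

text \<open>In the contraction the upper index contributes \<open>K\<close> and the index
  \<open>i\<close> contributes \<open>J\<close>; these cancel, and only the two free indices keep a
  Jacobian.\<close>

lemma ricci_transform:
  assumes x: "x \<in> U"
  shows "ricci_mat G x = transpose (J x) ** ricci_mat G' (\<tau> x) ** J x"
proof -
  have c: "curv_mat G i j x = (\<Sum>b\<in>UNIV. \<Sum>e\<in>UNIV. (J x $ b $ i * J x $ e $ j) *\<^sub>R (K x ** (curv_mat G' b e (\<tau> x) ** J x)))" for i j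
  proof -
    have "curv_mat G i j x = K x ** (J x ** curv_mat G i j x)" by (simp add: matrix_mul_assoc KJ[OF x])
    then show ?thesis
      by (simp add: curv_transform[OF x] matrix_sum_left matrix_sum_right matrix_scaleR_left matrix_scaleR_right)
  qed
  have "ricci_mat G x $ j $ k = (transpose (J x) ** (ricci_mat G' (\<tau> x) ** J x)) $ j $ k" for j k
  proof -
    have "ricci_mat G x $ j $ k = (\<Sum>i\<in>UNIV. curv_mat G i j x $ i $ k)"
      by (simp add: ricci_mat_def ricci_def curv_mat_def)
    also have "\<dots> = (\<Sum>i\<in>UNIV. \<Sum>b\<in>UNIV. \<Sum>e\<in>UNIV. J x $ b $ i * J x $ e $ j * (K x ** (curv_mat G' b e (\<tau> x) ** J x)) $ i $ k)"
      by (simp add: c sum_component)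
    also have "\<dots> = (\<Sum>b\<in>UNIV. \<Sum>i\<in>UNIV. \<Sum>e\<in>UNIV. J x $ b $ i * J x $ e $ j * (K x ** (curv_mat G' b e (\<tau> x) ** J x)) $ i $ k)"
      by (rule sum.swap)
    also have "\<dots> = (\<Sum>b\<in>UNIV. \<Sum>e\<in>UNIV. \<Sum>i\<in>UNIV. J x $ b $ i * J x $ e $ j * (K x ** (curv_mat G' b e (\<tau> x) ** J x)) $ i $ k)"
      by (rule sum.cong[OF refl], rule sum.swap)
    also have "\<dots> = (\<Sum>b\<in>UNIV. \<Sum>e\<in>UNIV. J x $ e $ j * (curv_mat G' b e (\<tau> x) ** J x) $ b $ k)"
    proof (intro sum.cong refl)
      fix b e :: 'n
      have "(J x ** (K x ** (curv_mat G' b e (\<tau> x) ** J x))) $ b $ k = (curv_mat G' b e (\<tau> x) ** J x) $ b $ k"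
        by (simp add: matrix_mul_assoc JK[OF x])
      then show "(\<Sum>i\<in>UNIV. J x $ b $ i * J x $ e $ j * (K x ** (curv_mat G' b e (\<tau> x) ** J x)) $ i $ k) =
          J x $ e $ j * (curv_mat G' b e (\<tau> x) ** J x) $ b $ k"
        by (simp add: matrix_nth[of "J x"] sum_distrib_left[symmetric] mult.assoc mult.left_commute[of _ "J x $ e $ j"])
    qed
    also have "\<dots> = (\<Sum>e\<in>UNIV. J x $ e $ j * (\<Sum>b\<in>UNIV. (curv_mat G' b e (\<tau> x) ** J x) $ b $ k))"
      by (subst sum.swap) (simp add: sum_distrib_left)
    also have "\<dots> = (\<Sum>e\<in>UNIV. J x $ e $ j * (ricci_mat G' (\<tau> x) ** J x) $ e $ k)"
    proof (intro sum.cong refl arg_cong2[where f = "(*)"])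
      show "(\<Sum>b\<in>UNIV. (curv_mat G' b e (\<tau> x) ** J x) $ b $ k) = (ricci_mat G' (\<tau> x) ** J x) $ e $ k" for e
        by (simp add: matrix_nth ricci_mat_def ricci_def curv_mat_def sum_distrib_right) (rule sum.swap)
    qed
    finally show ?thesis unfolding matrix_nth[of "transpose (J x)"] by (simp add: transpose_def)
  qed
  then show ?thesis by (simp add: vec_eq_iff matrix_mul_assoc)
qed

lemma ricci_end_transform:
  assumes x: "x \<in> U"
  shows "ricci_end G' (\<tau> x) ** J x = J x ** ricci_end G x"
  by (simp add: ricci_end_def P_transform[OF x] ricci_transform[OF x] matrix_mul_assoc)

lemma scalar_curvature_transform: "x \<in> U \<Longrightarrow> scalar_curvature G' (\<tau> x) = scalar_curvature G x"
  using trace_transform[OF ricci_end_transform]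
  by (simp add: A.scalar_curvature_trace B.scalar_curvature_trace \<tau>_V)

lemma adj_transform:
  assumes "T' (\<tau> x) ** J x = J x ** T x" "x \<in> U"
  shows "adj_mat G' T' (\<tau> x) ** J x = J x ** adj_mat G T x"
proof -
  have "adj_mat G' T' (\<tau> x) ** J x = J x ** matrix_inv (G x) ** transpose (T' (\<tau> x) ** J x) ** G' (\<tau> x) ** J x"
    by (simp add: adj_mat_def P_transform[OF assms(2)] matrix_transpose_mul matrix_mul_assoc)
  also have "\<dots> = J x ** adj_mat G T x"
    by (simp add: assms(1) adj_mat_def G_eq[OF assms(2)] matrix_transpose_mul matrix_mul_assoc)
  finally show ?thesis .
qed

lemma end_vec_transform:
  assumes "T' ** J x = J x ** T" "v' = J x *v v"
  shows "T' *v v' = J x *v (T *v v)"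
  using assms by (simp add: matrix_vector_mul_assoc)

lemma def_vec_transform:
  assumes X: "smooth_on X U" "smooth_on X' V" "\<And>y. y \<in> U \<Longrightarrow> X' (\<tau> y) = J y *v X y"
    and Y: "\<And>y. y \<in> U \<Longrightarrow> Y' (\<tau> y) = J y *v Y y" and x: "x \<in> U"
  shows "def_vec G' X' Y' (\<tau> x) = J x *v def_vec G X Y x"
  unfolding def_vec_def
  by (rule end_vec_transform[OF _ Y[OF x]])
    (simp add: matrix_add_rdistrib matrix_add_ldistrib nabla_mat_transform[OF X x] adj_transform[where T = "nabla_mat G X" and T' = "nabla_mat G' X'", OF nabla_mat_transform[OF X x] x])

lemma laplace_scalar_curvature_transform:
  assumes x: "x \<in> U"
  shows "laplace_fun G' (scalar_curvature G') (\<tau> x) = laplace_fun G (scalar_curvature G) x"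
  unfolding A.laplace_fun_eq[OF A.smooth_scalar_curvature x] B.laplace_fun_eq[OF B.smooth_scalar_curvature \<tau>_V[OF x]]
  by (intro divergence_transform A.smooth_grad B.smooth_grad A.smooth_scalar_curvature B.smooth_scalar_curvature x
      grad_transform scalar_curvature_transform)

lemma flux_transform:
  assumes "X' (\<tau> x) = J x *v X x" and x: "x \<in> U"
  shows "B.flux X' (\<tau> x) = J x *v A.flux X x"
  using assms(1) end_vec_transform[OF ricci_end_transform[OF x] assms(1)]
  by (simp add: A.flux_def B.flux_def laplace_scalar_curvature_transform[OF x] scalar_curvature_transform[OF x]
      ricci_vec_eq matrix_vector_right_distrib matrix_vector_mult_diff_distrib matrix_vector_mult_scaleR)

end

section \<open>Integration\<close>

text \<open>The change of variables theorem of the library requires a well-ordered index type. The type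
  \<open>'a wo\<close> is a copy of \<open>'a\<close> with an arbitrary well-order.\<close>

typedef 'a wo = "UNIV :: 'a set" morphisms of_wo to_wo ..

lemma bij_of_wo: "bij (of_wo :: 'a wo \<Rightarrow> 'a)"
  by (metis bijI' of_wo_inject to_wo_inverse UNIV_I)

instance wo :: (finite) finite
proof
  show "finite (UNIV :: 'a wo set)"
    by (rule finite_imageD[of of_wo]) (auto intro: bij_is_inj[OF bij_of_wo])
qed

definition wo_index :: "'a::finite wo \<Rightarrow> nat" where
  "wo_index w = (SOME f :: 'a \<Rightarrow> nat. inj f) (of_wo w)"

lemma wo_index_inject: "wo_index v = wo_index w \<longleftrightarrow> v = w"
proof -
  have "\<exists>f :: 'a \<Rightarrow> nat. inj f" using finite_imp_inj_to_nat_seg[of "UNIV :: 'a set"] by auto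
  then have "inj (SOME f :: 'a \<Rightarrow> nat. inj f)" by (rule someI_ex)
  then show ?thesis by (simp add: wo_index_def inj_eq of_wo_inject)
qed

instantiation wo :: (finite) wellorder
begin

definition "v \<le> w \<longleftrightarrow> wo_index v \<le> wo_index w"
definition "v < w \<longleftrightarrow> wo_index v < wo_index w"

instance
proof
  show "P a" if "\<And>x. (\<And>y. y < x \<Longrightarrow> P y) \<Longrightarrow> P x" for P and a :: "'a wo"
  proof (induction a rule: measure_induct_rule[of wo_index])
    case (less x)
    then show ?case by - (rule that, simp only: less_wo_def)
  qed
qed (auto simp: less_eq_wo_def less_wo_def wo_index_inject)

end

text \<open>Conjugation by \<beta> matches the permutations of the two index types and preserves
  signs, so the Leibniz formulas agree term by term.\<close>

lemma det_reindex:
  fixes A :: "real^'n::finite^'n" and \<beta> :: "'b::finite \<Rightarrow> 'n"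
  assumes "bij \<beta>"
  shows "det (\<chi> i j. A $ \<beta> i $ \<beta> j) = det A"
proof -
  have inj: "inj \<beta>" and bb: "bij_betw \<beta> UNIV UNIV" "bij_betw (inv \<beta>) UNIV UNIV"
    using assms by (auto simp: bij_is_inj bij_imp_bij_inv)
  have inv: "\<beta> (inv \<beta> x) = x" "inv \<beta> (\<beta> y) = y" for x y
    using assms by (simp_all add: bij_is_surj surj_f_inv_f bij_is_inj)
  show ?thesis
    unfolding det_def
  proof (rule sum.reindex_bij_witness[of _ "map_permutation UNIV (inv \<beta>)" "map_permutation UNIV \<beta>"])
    fix p :: "'b \<Rightarrow> 'b" assume "p \<in> {p. p permutes UNIV}"
    then have p: "p permutes UNIV" by simp
    show "map_permutation UNIV (inv \<beta>) (map_permutation UNIV \<beta> p) = p"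
      by (rule map_permutation_compose_inv[OF bb(1) p]) (simp add: inv)
    show "map_permutation UNIV \<beta> p \<in> {p. p permutes UNIV}"
      using map_permutation_permutes[OF bb(1) p] by simp
    have "(\<Prod>i\<in>UNIV. A $ i $ map_permutation UNIV \<beta> p i) = (\<Prod>i\<in>UNIV. A $ \<beta> i $ map_permutation UNIV \<beta> p (\<beta> i))"
      by (rule prod.reindex_bij_betw[OF bb(1), symmetric])
    then show "of_int (sign (map_permutation UNIV \<beta> p)) * (\<Prod>i\<in>UNIV. A $ i $ map_permutation UNIV \<beta> p i) =
        of_int (sign p) * (\<Prod>i\<in>UNIV. (\<chi> i j. A $ \<beta> i $ \<beta> j) $ i $ p i)"
      by (simp add: sign_map_permutation[OF inj p] map_permutation_apply[OF inj])
  next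
    fix p :: "'n \<Rightarrow> 'n" assume "p \<in> {p. p permutes UNIV}"
    then have p: "p permutes UNIV" by simp
    show "map_permutation UNIV \<beta> (map_permutation UNIV (inv \<beta>) p) = p"
      by (rule map_permutation_compose_inv[OF bb(2) p]) (simp add: inv)
    show "map_permutation UNIV (inv \<beta>) p \<in> {p. p permutes UNIV}"
      using map_permutation_permutes[OF bb(2) p] by simp
  qed
qed

lemma Basis_real_vec: "(Basis :: (real^'n::finite) set) = range (\<lambda>i. axis i 1)"
  by (auto simp: Basis_vec_def)

lemma prod_Basis_vec: "(\<Prod>b\<in>(Basis :: (real^'n::finite) set). f b) = (\<Prod>i\<in>UNIV. f (axis i 1))"
  unfolding Basis_real_vec by (subst prod.reindex) (auto simp: inj_on_def axis_eq_axis)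

lemma bounded_linear_reindex: "bounded_linear (\<lambda>x::real^'n::finite. (\<chi> b. x $ \<beta> b) :: real^'b::finite)"
  by (rule linear_conv_bounded_linear[THEN iffD1], rule linearI) (simp_all add: vec_eq_iff)

text \<open>Lebesgue measure is determined by its values on boxes, and renaming coordinates turns
  boxes into boxes with the same side lengths.\<close>

lemma lborel_reindex:
  fixes \<beta> :: "'b::finite \<Rightarrow> 'n::finite"
  assumes "bij \<beta>"
  shows "distr lborel borel (\<lambda>x::real^'n. \<chi> b. x $ \<beta> b) = (lborel :: (real^'b) measure)"
proof (rule lborel_eqI[symmetric])
  let ?f = "\<lambda>x::real^'n. (\<chi> b. x $ \<beta> b) :: real^'b"
  have inv: "\<beta> (inv \<beta> x) = x" "inv \<beta> (\<beta> y) = y" for x y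
    using assms by (simp_all add: bij_is_surj surj_f_inv_f bij_is_inj)
  have [measurable]: "?f \<in> borel_measurable borel"
    by (rule borel_measurable_continuous_onI) (rule linear_continuous_on[OF bounded_linear_reindex])
  fix l u :: "real^'b" assume le: "\<And>b. b \<in> Basis \<Longrightarrow> l \<bullet> b \<le> u \<bullet> b"
  then have le': "l $ i \<le> u $ i" for i
    using inner_axis[of l i 1] inner_axis[of u i 1] by (force simp: Basis_real_vec inner_axis)
  have "emeasure (distr lborel borel ?f) (box l u) = emeasure lborel (?f -` box l u)"
    by (simp add: emeasure_distr)
  also have "?f -` box l u = box (\<chi> n. l $ inv \<beta> n) (\<chi> n. u $ inv \<beta> n)"
    by (auto simp: mem_box_cart inv) (metis inv)+
  also have "emeasure lborel \<dots> = (\<Prod>b\<in>Basis. ((\<chi> n. u $ inv \<beta> n) - (\<chi> n. l $ inv \<beta> n)) \<bullet> b)"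
    by (rule emeasure_lborel_box) (auto simp: Basis_real_vec inner_axis le')
  also have "(\<Prod>b\<in>Basis. ((\<chi> n. u $ inv \<beta> n) - (\<chi> n. l $ inv \<beta> n)) \<bullet> b) = (\<Prod>n\<in>UNIV. u $ inv \<beta> n - l $ inv \<beta> n)"
    by (simp add: prod_Basis_vec inner_axis)
  also have "\<dots> = (\<Prod>b\<in>UNIV. u $ b - l $ b)"
    using bij_imp_bij_inv[OF assms] by (rule prod.reindex_bij_betw)
  also have "\<dots> = (\<Prod>b\<in>Basis. (u - l) \<bullet> b)"
    by (simp add: prod_Basis_vec inner_axis)
  finally show "emeasure (distr lborel borel ?f) (box l u) = (\<Prod>b\<in>Basis. (u - l) \<bullet> b)" .
qed simp

lemma set_integral_reindex:
  fixes \<beta> :: "'b::finite \<Rightarrow> 'n::finite" and f :: "real^'b \<Rightarrow> real"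
  assumes "bij \<beta>"
  defines "\<phi> \<equiv> \<lambda>x::real^'n. (\<chi> b. x $ \<beta> b) :: real^'b"
  assumes "set_integrable lborel S (\<lambda>x. f (\<phi> x))"
  shows "set_integrable lborel (\<phi> ` S) f \<and> (LINT y:\<phi> ` S|lborel. f y) = (LINT x:S|lborel. f (\<phi> x))"
proof -
  have inv: "\<beta> (inv \<beta> x) = x" "inv \<beta> (\<beta> y) = y" for x y
    using assms(1) by (simp_all add: bij_is_surj surj_f_inv_f bij_is_inj)
  define \<psi> where "\<psi> = (\<lambda>y::real^'b. (\<chi> n. y $ inv \<beta> n) :: real^'n)"
  have \<psi>\<phi>: "\<psi> (\<phi> x) = x" and \<phi>\<psi>: "\<phi> (\<psi> y) = y" for x y
    by (simp_all add: \<psi>_def \<phi>_def vec_eq_iff inv)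
  have [measurable]: "\<phi> \<in> borel_measurable borel" "\<psi> \<in> borel_measurable borel"
    unfolding \<phi>_def \<psi>_def
    by (rule borel_measurable_continuous_onI, rule linear_continuous_on[OF bounded_linear_reindex])+
  have ind: "indicator S x *\<^sub>R f (\<phi> x) = indicator (\<phi> ` S) (\<phi> x) *\<^sub>R f (\<phi> x)" for x
    by (auto simp: indicator_def) (metis \<psi>\<phi> imageE)
  have int: "integrable lborel (\<lambda>x. indicator (\<phi> ` S) (\<phi> x) *\<^sub>R f (\<phi> x))"
    using assms(3) unfolding set_integrable_def ind .
  \<comment> \<open>Measurability is known only after composition with \<phi>; composing with the
    inverse \<psi> recovers it for \<open>f\<close> itself.\<close>
  have meas: "(\<lambda>y. indicator (\<phi> ` S) y *\<^sub>R f y) \<in> borel_measurable borel"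
  proof -
    have "(\<lambda>x. indicator (\<phi> ` S) (\<phi> x) *\<^sub>R f (\<phi> x)) \<in> borel_measurable borel"
      using int by (simp add: borel_measurable_integrable[of lborel])
    then have "(\<lambda>x. indicator (\<phi> ` S) (\<phi> x) *\<^sub>R f (\<phi> x)) \<circ> \<psi> \<in> borel_measurable borel"
      by (rule measurable_comp[rotated]) simp
    then show ?thesis by (simp add: o_def \<phi>\<psi>)
  qed
  have distr: "distr lborel borel \<phi> = (lborel :: (real^'b) measure)"
    unfolding \<phi>_def by (rule lborel_reindex[OF assms(1)])
  have "integrable (distr lborel borel \<phi>) (\<lambda>y. indicator (\<phi> ` S) y *\<^sub>R f y)"
    by (subst integrable_distr_eq) (use int meas in auto)
  moreover have "integral\<^sup>L (distr lborel borel \<phi>) (\<lambda>y. indicator (\<phi> ` S) y *\<^sub>R f y) =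
      (LINT x|lborel. indicator (\<phi> ` S) (\<phi> x) *\<^sub>R f (\<phi> x))"
    by (rule integral_distr) (use meas in auto)
  ultimately show ?thesis
    unfolding set_integrable_def set_lebesgue_integral_def ind distr by simp
qed

lemma set_integrable_lborel_absolutely:
  fixes f :: "'a::euclidean_space \<Rightarrow> real"
  shows "set_integrable lborel S f \<Longrightarrow> f absolutely_integrable_on S"
  unfolding set_integrable_def
  by (subst integrable_completion) (auto dest: borel_measurable_integrable)

lemma set_integral_change_of_variables_wo:
  fixes f :: "real^'n::{finite,wellorder} \<Rightarrow> real" and \<tau> :: "real^'n::_ \<Rightarrow> real^'n::_"
  assumes "open S" "\<And>x. x \<in> S \<Longrightarrow> (\<tau> has_derivative \<tau>' x) (at x)" "inj_on \<tau> S"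
    and "set_integrable lborel (\<tau> ` S) f" "set_integrable lborel S (\<lambda>x. \<bar>det (matrix (\<tau>' x))\<bar> * f (\<tau> x))"
  shows "(LINT y:\<tau> ` S|lborel. f y) = (LINT x:S|lborel. \<bar>det (matrix (\<tau>' x))\<bar> * f (\<tau> x))"
proof -
  \<comment> \<open>The integrand is wrapped into \<open>real^1\<close> because
    \<open>integral_change_of_variables\<close> speaks of vector-valued functions.\<close>
  have "integral (\<tau> ` S) (\<lambda>y. vec (f y) :: real^1) = integral S (\<lambda>x. \<bar>det (matrix (\<tau>' x))\<bar> *\<^sub>R (vec (f (\<tau> x)) :: real^1))"
  proof (rule integral_change_of_variables)
    show "S \<in> sets lebesgue" using assms(1) by simp
    show "(\<tau> has_derivative \<tau>' x) (at x within S)" if "x \<in> S" for x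
      using assms(2)[OF that] by (rule has_derivative_at_withinI)
    show "(\<lambda>y. vec (f y) :: real^1) absolutely_integrable_on \<tau> ` S \<or>
      (\<lambda>x. \<bar>det (matrix (\<tau>' x))\<bar> *\<^sub>R (vec (f (\<tau> x)) :: real^1)) absolutely_integrable_on S"
      using set_integrable_lborel_absolutely[OF assms(4)] by (simp add: absolutely_integrable_on_1_iff)
  qed fact
  then have "integral (\<tau> ` S) f = integral S (\<lambda>x. \<bar>det (matrix (\<tau>' x))\<bar> * f (\<tau> x))"
    by (simp add: integral_on_1_eq vec_eq_iff)
  then show ?thesis
    using set_borel_integral_eq_integral(2)[OF assms(4)] set_borel_integral_eq_integral(2)[OF assms(5)] by simp
qed

text \<open>Conjugate \<tau> with the renaming \<phi> of coordinates by the well-ordered copy of the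
  index type. Renaming preserves integrals, and by \<open>det_reindex\<close> also the Jacobian
  determinant.\<close>

lemma set_integral_change_of_variables:
  fixes f :: "real^'n::finite \<Rightarrow> real" and \<tau> :: "real^'n \<Rightarrow> real^'n"
  assumes S: "open S" and der: "\<And>x. x \<in> S \<Longrightarrow> (\<tau> has_derivative \<tau>' x) (at x)" and inj: "inj_on \<tau> S"
    and int: "set_integrable lborel (\<tau> ` S) f" "set_integrable lborel S (\<lambda>x. \<bar>det (matrix (\<tau>' x))\<bar> * f (\<tau> x))"
  shows "(LINT y:\<tau> ` S|lborel. f y) = (LINT x:S|lborel. \<bar>det (matrix (\<tau>' x))\<bar> * f (\<tau> x))"
proof -
  let ?\<beta> = "of_wo :: 'n wo \<Rightarrow> 'n"
  have inv: "?\<beta> (inv ?\<beta> x) = x" "inv ?\<beta> (?\<beta> y) = y" for x y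
    using bij_of_wo[where 'a = 'n] by (simp_all add: bij_is_surj surj_f_inv_f bij_is_inj)
  define \<phi> where "\<phi> = (\<lambda>x::real^'n. (\<chi> b. x $ ?\<beta> b) :: real^'n wo)"
  define \<psi> where "\<psi> = (\<lambda>y::real^'n wo. (\<chi> n. y $ inv ?\<beta> n) :: real^'n)"
  have \<psi>\<phi>: "\<psi> (\<phi> x) = x" and \<phi>\<psi>: "\<phi> (\<psi> y) = y" for x y
    by (simp_all add: \<psi>_def \<phi>_def vec_eq_iff inv)
  have \<phi>_app: "(\<chi> b. x $ ?\<beta> b) = \<phi> x" for x
    by (simp add: \<phi>_def)
  have bl: "bounded_linear \<phi>" "bounded_linear \<psi>"
    unfolding \<phi>_def \<psi>_def by (rule bounded_linear_reindex)+
  define \<sigma> where "\<sigma> = \<phi> \<circ> \<tau> \<circ> \<psi>"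
  define \<sigma>' where "\<sigma>' y = \<phi> \<circ> \<tau>' (\<psi> y) \<circ> \<psi>" for y
  have det: "det (matrix (\<sigma>' (\<phi> x))) = det (matrix (\<tau>' x))" for x
  proof -
    have ax: "\<psi> (axis j 1) = axis (?\<beta> j) 1" for j
      using inv by (auto simp: \<psi>_def vec_eq_iff axis_def)
    have "matrix (\<sigma>' (\<phi> x)) = (\<chi> i j. matrix (\<tau>' x) $ ?\<beta> i $ ?\<beta> j)"
      by (simp add: matrix_def \<sigma>'_def \<psi>\<phi> ax) (simp add: \<phi>_def)
    then show ?thesis using det_reindex[OF bij_of_wo] by metis
  qed
  have img: "\<phi> ` (\<tau> ` S) = \<sigma> ` (\<phi> ` S)"
    by (simp add: image_image \<sigma>_def \<psi>\<phi>)
  have i1: "set_integrable lborel (\<phi> ` \<tau> ` S) (\<lambda>y. f (\<psi> y)) \<and>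
      (LINT y:\<phi> ` \<tau> ` S|lborel. f (\<psi> y)) = (LINT x:\<tau> ` S|lborel. f x)"
    using set_integral_reindex[OF bij_of_wo, of "\<tau> ` S" "\<lambda>y. f (\<psi> y)"] int(1)
    unfolding \<phi>_app by (simp add: \<psi>\<phi> \<phi>_def[symmetric])
  have i2: "set_integrable lborel (\<phi> ` S) (\<lambda>y. \<bar>det (matrix (\<sigma>' y))\<bar> * f (\<psi> (\<sigma> y))) \<and>
      (LINT y:\<phi> ` S|lborel. \<bar>det (matrix (\<sigma>' y))\<bar> * f (\<psi> (\<sigma> y))) = (LINT x:S|lborel. \<bar>det (matrix (\<tau>' x))\<bar> * f (\<tau> x))"
    using set_integral_reindex[OF bij_of_wo, of S "\<lambda>y. \<bar>det (matrix (\<sigma>' y))\<bar> * f (\<psi> (\<sigma> y))"] int(2)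
    unfolding \<phi>_app by (simp add: \<psi>\<phi> \<sigma>_def det \<phi>_def[symmetric])
  have "(LINT y:\<sigma> ` \<phi> ` S|lborel. f (\<psi> y)) = (LINT y:\<phi> ` S|lborel. \<bar>det (matrix (\<sigma>' y))\<bar> * f (\<psi> (\<sigma> y)))"
  proof (rule set_integral_change_of_variables_wo)
    have "\<phi> ` S = \<psi> -` S" by (auto simp: \<psi>\<phi>) (metis \<phi>\<psi> imageI)
    then show "open (\<phi> ` S)"
      using S bl(2) by (simp add: continuous_open_vimage linear_continuous_at)
    show "(\<sigma> has_derivative \<sigma>' y) (at y)" if "y \<in> \<phi> ` S" for y
    proof -
      have "\<psi> y \<in> S" using that \<psi>\<phi> by auto
      then show ?thesis
        unfolding \<sigma>_def \<sigma>'_def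
        by (auto intro!: diff_chain_at bounded_linear_imp_has_derivative bl der)
    qed
    show "inj_on \<sigma> (\<phi> ` S)"
    proof (rule inj_onI)
      fix y z assume yz: "y \<in> \<phi> ` S" "z \<in> \<phi> ` S" "\<sigma> y = \<sigma> z"
      then have "\<tau> (\<psi> y) = \<tau> (\<psi> z)" by (metis \<sigma>_def comp_apply \<psi>\<phi>)
      then have "\<psi> y = \<psi> z" using yz(1,2) inj by (auto simp: \<psi>\<phi> dest: inj_onD)
      then show "y = z" by (metis \<phi>\<psi>)
    qed
  qed (use i1 i2 img in auto)
  then show ?thesis using i1 i2 img by simp
qed

section \<open>Functions with compact support in an open set\<close>

definition zero_ext :: "'a set \<Rightarrow> ('a \<Rightarrow> 'b::zero) \<Rightarrow> 'a \<Rightarrow> 'b" where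
  "zero_ext U f x = (if x \<in> U then f x else 0)"

lemma has_real_derivative_transform:
  "t \<in> T \<Longrightarrow> (\<And>s. s \<in> T \<Longrightarrow> h s = f s) \<Longrightarrow> (f has_real_derivative D) (at t within T) \<Longrightarrow>
    (h has_real_derivative D) (at t within T)"
  unfolding has_field_derivative_def by (rule has_derivative_transform)

text \<open>\<open>U\<close> and the complement of \<open>K\<close> form an open cover of the space.
  A function on \<open>U\<close> that vanishes off \<open>K\<close> is therefore as regular after
  extension by 0 as before, and its integral becomes one over a compact box.\<close>

locale compact_support = open_set U for U :: "(real^'n::finite) set" +
  fixes K :: "(real^'n) set"
  assumes compact_K: "compact K" and K_U: "K \<subseteq> U"
begin

lemma open_compl_K: "open (- K)"
  using compact_K by (simp add: compact_imp_closed open_Compl)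

lemma U_compl_K: "U \<union> - K = UNIV"
  using K_U by auto

lemma continuous_on_zero_ext:
  fixes f :: "'s::topological_space \<Rightarrow> real^'n \<Rightarrow> real"
  assumes "continuous_on (T \<times> U) (\<lambda>(s, x). f s x)" "\<And>s x. s \<in> T \<Longrightarrow> x \<in> U - K \<Longrightarrow> f s x = 0"
  shows "continuous_on (T \<times> UNIV) (\<lambda>(s, x). zero_ext U (f s) x)"
proof -
  have "continuous_on (T \<times> U \<union> T \<times> (- K)) (\<lambda>(s, x). zero_ext U (f s) x)"
  proof (rule continuous_on_Un_local_open)
    have "T \<times> U = (T \<times> U \<union> T \<times> (- K)) \<inter> (UNIV \<times> U)" "T \<times> (- K) = (T \<times> U \<union> T \<times> (- K)) \<inter> (UNIV \<times> (- K))"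
      by auto
    then show "openin (top_of_set (T \<times> U \<union> T \<times> (- K))) (T \<times> U)"
      "openin (top_of_set (T \<times> U \<union> T \<times> (- K))) (T \<times> (- K))"
      using open_Times[OF open_UNIV open_U] open_Times[OF open_UNIV open_compl_K]
      unfolding openin_open by blast+
    show "continuous_on (T \<times> U) (\<lambda>(s, x). zero_ext U (f s) x)"
      by (rule continuous_on_cong[THEN iffD1, OF refl _ assms(1)]) (auto simp: zero_ext_def)
    have "continuous_on (T \<times> (- K)) (\<lambda>_. 0 :: real)" by simp
    then show "continuous_on (T \<times> (- K)) (\<lambda>(s, x). zero_ext U (f s) x)"
      by (rule continuous_on_cong[THEN iffD1, OF refl, rotated]) (use assms(2) in \<open>auto simp: zero_ext_def\<close>)
  qed
  moreover have "T \<times> U \<union> T \<times> (- K) = T \<times> UNIV" using U_compl_K by auto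
  ultimately show ?thesis by simp
qed

lemma continuous_on_zero_ext1:
  fixes f :: "real^'n \<Rightarrow> real"
  assumes "continuous_on U f" "\<And>x. x \<in> U - K \<Longrightarrow> f x = 0"
  shows "continuous_on UNIV (zero_ext U f)"
proof -
  have "continuous_on (U \<union> - K) (zero_ext U f)"
  proof (rule continuous_on_open_Un[OF open_U open_compl_K])
    show "continuous_on U (zero_ext U f)"
      by (rule continuous_on_cong[THEN iffD1, OF refl _ assms(1)]) (auto simp: zero_ext_def)
    have "continuous_on (- K) (\<lambda>_. 0 :: real)" by simp
    then show "continuous_on (- K) (zero_ext U f)"
      by (rule continuous_on_cong[THEN iffD1, OF refl, rotated]) (use assms(2) in \<open>auto simp: zero_ext_def\<close>)
  qed
  then show ?thesis by (simp add: U_compl_K)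
qed

lemma smooth_on_zero_ext:
  fixes f :: "real^'n \<Rightarrow> real"
  assumes "smooth_on f U" "\<And>x. x \<in> U - K \<Longrightarrow> f x = 0"
  shows "smooth_on (zero_ext U f) UNIV"
proof -
  have "smooth_on (zero_ext U f) (\<Union>{U, - K})"
  proof (rule smooth_on_Union)
    show "smooth_on (zero_ext U f) T" if "T \<in> {U, - K}" for T
    proof (cases "T = U")
      case True
      then show ?thesis using assms(1) smooth_on_cong[of U "zero_ext U f" f] by (simp add: zero_ext_def)
    next
      case False
      then have "T = - K" using that by simp
      then show ?thesis
        using assms(2) smooth_on_cong[of "- K" "zero_ext U f" "\<lambda>_. 0"] open_compl_K
        by (auto simp: zero_ext_def)
    qed
  qed (use open_U open_compl_K in auto)
  then show ?thesis using U_compl_K by simp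
qed

lemma set_integrable_support:
  fixes f :: "real^'n \<Rightarrow> real"
  assumes "continuous_on U f" "\<And>x. x \<in> U - K \<Longrightarrow> f x = 0"
  shows "set_integrable lborel U f"
proof -
  have "integrable lborel (\<lambda>x. indicator K x *\<^sub>R f x)"
    using compact_K continuous_on_subset[OF assms(1) K_U] by (rule borel_integrable_compact)
  also have "(\<lambda>x. indicator K x *\<^sub>R f x) = (\<lambda>x. indicator U x *\<^sub>R f x)"
    using assms(2) K_U by (auto simp: indicator_def fun_eq_iff)
  finally show ?thesis by (simp add: set_integrable_def)
qed

lemma set_integral_eq_integral_cbox:
  fixes f :: "real^'n \<Rightarrow> real"
  assumes "continuous_on U f" "\<And>x. x \<in> U - K \<Longrightarrow> f x = 0" "K \<subseteq> cbox a b"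
  shows "(LINT x:U|lborel. f x) = integral (cbox a b) (zero_ext U f)"
proof -
  have "(LINT x:U|lborel. f x) = integral U f"
    by (rule set_borel_integral_eq_integral(2)[OF set_integrable_support[OF assms(1,2)]])
  also have "\<dots> = integral UNIV (zero_ext U f)"
    unfolding zero_ext_def[abs_def] by (rule integral_restrict_UNIV[symmetric])
  also have "\<dots> = integral UNIV (\<lambda>x. if x \<in> cbox a b then zero_ext U f x else 0)"
    by (rule Henstock_Kurzweil_Integration.integral_cong) (use assms(2,3) in \<open>auto simp: zero_ext_def\<close>)
  also have "\<dots> = integral (cbox a b) (zero_ext U f)" by (rule integral_restrict_UNIV)
  finally show ?thesis .
qed

text \<open>Extension by 0 moves the problem from an open set to a compact box, where the Leibniz
  rule applies. Differentiating within \<open>T\<close> admits one-sided derivatives at an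
  endpoint.\<close>

lemma has_derivative_set_integral:
  fixes f f' :: "real \<Rightarrow> real^'n \<Rightarrow> real"
  assumes der: "\<And>s x. s \<in> T \<Longrightarrow> x \<in> U \<Longrightarrow> ((\<lambda>s. f s x) has_real_derivative f' s x) (at s within T)"
    and cont: "\<And>s. s \<in> T \<Longrightarrow> continuous_on U (f s)" "continuous_on (T \<times> U) (\<lambda>(s, x). f' s x)"
    and supp: "\<And>s x. s \<in> T \<Longrightarrow> x \<in> U - K \<Longrightarrow> f s x = 0" "\<And>s x. s \<in> T \<Longrightarrow> x \<in> U - K \<Longrightarrow> f' s x = 0"
    and t: "t \<in> T" "convex T"
  shows "((\<lambda>s. LINT x:U|lborel. f s x) has_real_derivative (LINT x:U|lborel. f' t x)) (at t within T)"
proof -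
  obtain a b where ab: "K \<subseteq> cbox a b"
    using compact_K bounded_subset_cbox_symmetric compact_imp_bounded by metis
  have c': "continuous_on U (f' s)" if "s \<in> T" for s
    using continuous_on_compose2[OF cont(2) continuous_on_Pair[OF continuous_on_const continuous_on_id]] that
    by (auto simp: image_subset_iff)
  have "((\<lambda>s. integral (cbox a b) (zero_ext U (f s))) has_real_derivative integral (cbox a b) (zero_ext U (f' t))) (at t within T)"
  proof (rule leibniz_rule_field_derivative[OF _ _ _ t])
    show "((\<lambda>s. zero_ext U (f s) x) has_real_derivative zero_ext U (f' s) x) (at s within T)"
      if "s \<in> T" for s x
      using der[OF that] by (cases "x \<in> U") (auto simp: zero_ext_def)
    show "zero_ext U (f s) integrable_on cbox a b" if "s \<in> T" for s
      using continuous_on_zero_ext1[OF cont(1)[OF that] supp(1)[OF that]]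
      by (auto intro!: integrable_continuous intro: continuous_on_subset)
    show "continuous_on (T \<times> cbox a b) (\<lambda>(s, x). zero_ext U (f' s) x)"
      by (rule continuous_on_subset[OF continuous_on_zero_ext[OF cont(2) supp(2)]]) auto
  qed
  moreover have "(LINT x:U|lborel. f s x) = integral (cbox a b) (zero_ext U (f s))" if "s \<in> T" for s
    by (rule set_integral_eq_integral_cbox[OF cont(1)[OF that] supp(1)[OF that] ab])
  moreover have "(LINT x:U|lborel. f' t x) = integral (cbox a b) (zero_ext U (f' t))"
    by (rule set_integral_eq_integral_cbox[OF c'[OF t(1)] supp(2)[OF t(1)] ab])
  ultimately show ?thesis
    by (simp add: has_real_derivative_transform[OF t(1)])
qed

text \<open>The integral of a translate does not depend on the translation; differentiate in it.\<close>

lemma set_integral_pd: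
  fixes f :: "real^'n \<Rightarrow> real"
  assumes "smooth_on f U" "\<And>x. x \<in> U - K \<Longrightarrow> f x = 0"
  shows "(LINT x:U|lborel. pd i f x) = 0"
proof -
  let ?e = "axis i 1 :: real^'n"
  define F where "F = zero_ext U f"
  have F: "smooth_on F UNIV" unfolding F_def by (rule smooth_on_zero_ext[OF assms])
  note Fc = smooth_on_imp_continuous_on[OF F] smooth_on_imp_continuous_on[OF smooth_on_pd[OF F open_UNIV]]
  obtain r where r: "r > 0" "K \<subseteq> cball 0 r"
    using compact_imp_bounded[OF compact_K] unfolding bounded_pos by (auto simp: subset_iff)
  \<comment> \<open>The margin 1 keeps every translate by |h| at most 1 supported in the same
    box.\<close>
  obtain a b where ab: "cball 0 (r + 1) \<subseteq> cbox a b" "K \<subseteq> cbox a b"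
    using bounded_subset_cbox_symmetric[OF bounded_cball, of 0 "r + 1"] r
    by (metis (no_types, lifting) subset_cball order_trans le_add_same_cancel1 zero_le_one)
  have F0: "F x = 0" if "x \<notin> K" for x using that assms(2) by (auto simp: F_def zero_ext_def)
  have dF: "pd i F x = zero_ext U (pd i f) x" for x
  proof (cases "x \<in> U")
    case True
    then show ?thesis
      using pd_cong[OF open_U True, of F f i] by (simp add: F_def zero_ext_def)
  next
    case False
    then show ?thesis
      using pd_cong[OF open_compl_K, of x F "\<lambda>_. 0" i] F0 K_U by (auto simp: zero_ext_def)
  qed
  have eq: "integral (cbox a b) (\<lambda>x. F (x + h *\<^sub>R ?e)) = integral\<^sup>L lborel F" if "h \<in> {-1..1}" for h
  proof -
    let ?g = "\<lambda>x. F (x + h *\<^sub>R ?e)"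
    have z: "?g x = 0" if "x \<notin> cbox a b" for x
    proof -
      have "norm x > r + 1" using that ab(1) by (metis mem_cball_0 not_le subsetD)
      moreover have "norm (h *\<^sub>R ?e) \<le> 1" using \<open>h \<in> {-1..1}\<close> by auto
      ultimately have "norm (x + h *\<^sub>R ?e) > r" using norm_triangle_ineq4[of "x + h *\<^sub>R ?e" "h *\<^sub>R ?e"] by simp
      then show ?thesis using r(2) by (intro F0) auto
    qed
    have gc: "continuous_on UNIV ?g"
      by (intro continuous_on_compose2[OF Fc(1)] continuous_intros) auto
    have "?g x = indicator (cbox a b) x *\<^sub>R ?g x" for x using z by (auto simp: indicator_def)
    then have "integrable lborel ?g"
      using borel_integrable_compact[OF compact_cbox continuous_on_subset[OF gc]] by (metis (no_types, lifting) ext subset_UNIV)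
    then have "integral UNIV ?g = (LINT x|lborel. ?g x)" by (rule integral_lborel)
    also have "\<dots> = (LINT x|distr lborel borel ((+) (h *\<^sub>R ?e)). F x)"
      using borel_measurable_continuous_onI[OF Fc(1)] by (subst integral_distr) (auto simp: add.commute)
    also have "\<dots> = integral\<^sup>L lborel F" by (simp add: lborel_distr_plus)
    also have "integral UNIV ?g = integral UNIV (\<lambda>x. if x \<in> cbox a b then ?g x else 0)"
      by (rule Henstock_Kurzweil_Integration.integral_cong) (use z in auto)
    finally show ?thesis by (simp add: integral_restrict_UNIV)
  qed
  have "((\<lambda>h. integral (cbox a b) (\<lambda>x. F (x + h *\<^sub>R ?e))) has_real_derivative
      integral (cbox a b) (\<lambda>x. pd i F (x + 0 *\<^sub>R ?e))) (at 0 within {-1..1})"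
  proof (rule leibniz_rule_field_derivative)
    show "((\<lambda>h. F (x + h *\<^sub>R ?e)) has_real_derivative pd i F (x + h *\<^sub>R ?e)) (at h within {-1..1})" for h x
      by (rule has_field_derivative_at_within[OF DERIV_line[OF smooth_on_differentiable[OF F open_UNIV UNIV_I]]])
    show "(\<lambda>x. F (x + h *\<^sub>R ?e)) integrable_on cbox a b" for h
      by (intro integrable_continuous continuous_on_compose2[OF Fc(1)] continuous_intros) auto
    show "continuous_on ({-1..1} \<times> cbox a b) (\<lambda>(h, x). pd i F (x + h *\<^sub>R ?e))"
      unfolding case_prod_beta by (intro continuous_on_compose2[OF Fc(2)] continuous_intros) auto
  qed auto
  moreover have "((\<lambda>h. integral (cbox a b) (\<lambda>x. F (x + h *\<^sub>R ?e))) has_real_derivative 0) (at 0 within {-1..1})"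
    by (rule has_real_derivative_transform[of _ _ _ "\<lambda>_. integral\<^sup>L lborel F"]) (auto simp: eq)
  \<comment> \<open>Since 0 is interior to the range of \<open>h\<close>, both derivatives just
    found are two-sided and must coincide.\<close>
  moreover have "at (0::real) within {-1..1} = at 0" by (rule at_within_interior) simp
  ultimately have "integral (cbox a b) (pd i F) = 0" using DERIV_unique by fastforce
  moreover have "(LINT x:U|lborel. pd i f x) = integral (cbox a b) (zero_ext U (pd i f))"
  proof (rule set_integral_eq_integral_cbox[OF _ _ ab(2)])
    show "continuous_on U (pd i f)" by (rule smooth_on_imp_continuous_on[OF smooth_pd[OF assms(1)]])
    show "pd i f x = 0" if "x \<in> U - K" for x
      using pd_cong[of "U - K" x f "\<lambda>_. 0" i] that assms(2) open_U compact_K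
      by (auto simp: compact_imp_closed open_Diff)
  qed
  moreover have "pd i F = zero_ext U (pd i f)" using dF by blast
  ultimately show ?thesis by simp
qed

end

definition bump :: "real \<Rightarrow> real" where
  "bump t = (if t > 0 then exp (- inverse t) else 0)"

lemma tendsto_poly_exp_at_right_0:
  "((\<lambda>t. poly p (inverse t) * exp (- inverse t)) \<longlongrightarrow> (0::real)) (at_right 0)"
proof -
  have "((\<lambda>s. \<Sum>i\<le>degree p. coeff p i * (s ^ i / exp s)) \<longlongrightarrow> (\<Sum>i\<le>degree p. coeff p i * 0)) at_top"
    by (intro tendsto_sum tendsto_mult tendsto_const tendsto_power_div_exp_0)
  then have "((\<lambda>s. poly p s * exp (- s)) \<longlongrightarrow> 0) at_top"
    by (simp add: poly_altdef sum_distrib_right sum_divide_distrib exp_minus field_simps)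
  then show ?thesis by (rule filterlim_compose[OF _ filterlim_inverse_at_top_right])
qed

text \<open>The functions p(1/t) exp(-1/t), extended by 0 to t <= 0, are closed under
  differentiation. At 0 this holds because the exponential beats every polynomial in 1/t.\<close>

lemma smooth_on_bump: "smooth_on bump UNIV"
proof (rule smooth_on_real_deriv_induct[where P = "\<lambda>f. \<exists>p. \<forall>t. f t = (if t > 0 then poly p (inverse t) * exp (- inverse t) else 0)"])
  fix f :: "real \<Rightarrow> real"
  assume "\<exists>p. \<forall>t. f t = (if t > 0 then poly p (inverse t) * exp (- inverse t) else 0)"
  then obtain p where f: "\<And>t. f t = (if t > 0 then poly p (inverse t) * exp (- inverse t) else 0)" by blast
  \<comment> \<open>With s = 1/t one has ds/dt = -s^2, so p(s) exp(-s) has the derivative s^2 (p(s)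
    - p'(s)) exp(-s).\<close>
  define q where "q = [:0, 0, 1:] * (p - pderiv p)"
  define f' where "f' t = (if t > 0 then poly q (inverse t) * exp (- inverse t) else 0)" for t :: real
  have "(f has_real_derivative f' t) (at t)" for t
  proof -
    consider "t > 0" | "t < 0" | "t = 0" by linarith
    then show ?thesis
    proof cases
      case 1
      have "((\<lambda>t. poly p (inverse t) * exp (- inverse t)) has_real_derivative f' t) (at t)"
        using 1 by (auto intro!: derivative_eq_intros simp: f'_def q_def algebra_simps power2_eq_square)
      then show ?thesis
        by (rule has_field_derivative_transform_within_open[of _ _ _ "{0<..}"]) (use 1 f in auto)
    next
      case 2
      have "((\<lambda>t. 0) has_real_derivative f' t) (at t)" using 2 by (simp add: f'_def)
      then show ?thesis
        by (rule has_field_derivative_transform_within_open[of _ _ _ "{..<0}"]) (use 2 f in auto)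
    next
      case 3
      have "((\<lambda>h. (f (0 + h) - f 0) / h) \<longlongrightarrow> 0) (at_right 0)"
      \<comment> \<open>Dividing by h = 1/s in the difference quotient at 0 multiplies the
        polynomial by s.\<close>
      proof (rule Lim_transform_eventually[OF tendsto_poly_exp_at_right_0[of "[:0, 1:] * p"]])
        show "\<forall>\<^sub>F h in at_right 0. poly ([:0, 1:] * p) (inverse h) * exp (- inverse h) = (f (0 + h) - f 0) / h"
          unfolding eventually_at_filter by (simp add: f field_simps)
      qed
      moreover have "((\<lambda>h. (f (0 + h) - f 0) / h) \<longlongrightarrow> 0) (at_left 0)"
        by (rule Lim_transform_eventually[OF tendsto_const])
          (simp add: eventually_at_filter f)
      ultimately have "((\<lambda>h. (f (0 + h) - f 0) / h) \<longlongrightarrow> 0) (at 0)"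
        by (rule filterlim_split_at[rotated])
      then show ?thesis using 3 by (simp add: DERIV_def f'_def)
    qed
  qed
  then show "\<exists>f'. (\<exists>p. \<forall>t. f' t = (if t > 0 then poly p (inverse t) * exp (- inverse t) else 0)) \<and>
      (\<forall>x\<in>UNIV. (f has_real_derivative f' x) (at x))"
    by (intro exI[of _ f']) (auto simp: f'_def)
qed (auto simp: bump_def intro!: exI[of _ "[:1:]"])

section \<open>Charts and partitions of unity\<close>

locale one_chart =
  fixes M :: "'m topology" and c :: "('m, 'n::finite) chart"
  assumes chart: "is_chart M c"
begin

lemma openin_dom: "openin M (chart_dom c)" and open_img: "open (chart_img c)"
  and homeo: "homeomorphic_map (subtopology M (chart_dom c)) (top_of_set (chart_img c)) (chart_map c)"
  using chart by (auto simp: is_chart_def)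

lemma dom_subset: "chart_dom c \<subseteq> topspace M"
  by (rule openin_subset[OF openin_dom])

lemma topspace_dom: "topspace (subtopology M (chart_dom c)) = chart_dom c"
  using dom_subset by auto

lemma inj_chart_map: "inj_on (chart_map c) (chart_dom c)"
  using homeomorphic_imp_injective_map[OF homeo] unfolding topspace_dom .

lemma chart_inv_map [simp]: "p \<in> chart_dom c \<Longrightarrow> chart_inv c (chart_map c p) = p"
  by (simp add: chart_inv_def inj_chart_map)

lemma chart_map_inv [simp]: "x \<in> chart_img c \<Longrightarrow> chart_map c (chart_inv c x) = x"
  by (simp add: chart_inv_def chart_img_def f_inv_into_f)

lemma chart_inv_dom [simp]: "x \<in> chart_img c \<Longrightarrow> chart_inv c x \<in> chart_dom c"
  by (simp add: chart_inv_def chart_img_def inv_into_into)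

lemma chart_map_img [simp]: "p \<in> chart_dom c \<Longrightarrow> chart_map c p \<in> chart_img c"
  by (simp add: chart_img_def)

lemma open_chart_image:
  assumes "openin M W" "W \<subseteq> chart_dom c"
  shows "open (chart_map c ` W)"
proof -
  have "openin (subtopology M (chart_dom c)) W"
    using assms by (simp add: openin_open_subtopology[OF openin_dom])
  then have "openin (top_of_set (chart_img c)) (chart_map c ` W)"
    using homeomorphic_imp_open_map[OF homeo] by (simp add: open_map_def)
  then show ?thesis using open_img by (simp add: openin_open_eq)
qed

lemma openin_chart_vimage:
  assumes "open B"
  shows "openin M {q \<in> chart_dom c. chart_map c q \<in> B}"
proof -
  have "openin (top_of_set (chart_img c)) (chart_img c \<inter> B)" using assms by (rule openin_open_Int)
  then have "openin (subtopology M (chart_dom c))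
      {q \<in> topspace (subtopology M (chart_dom c)). chart_map c q \<in> chart_img c \<inter> B}"
    by (rule openin_continuous_map_preimage[OF homeomorphic_imp_continuous_map[OF homeo]])
  moreover have "{q \<in> topspace (subtopology M (chart_dom c)). chart_map c q \<in> chart_img c \<inter> B} =
      {q \<in> chart_dom c. chart_map c q \<in> B}"
    unfolding topspace_dom by auto
  ultimately show ?thesis by (simp add: openin_open_subtopology[OF openin_dom])
qed

lemma compact_chart_image:
  assumes "compactin M C" "C \<subseteq> chart_dom c"
  shows "compact (chart_map c ` C)"
proof -
  have "compactin (subtopology M (chart_dom c)) C" using assms by (simp add: compactin_subtopology)
  then have "compactin (top_of_set (chart_img c)) (chart_map c ` C)"
    by (rule image_compactin[OF _ homeomorphic_imp_continuous_map[OF homeo]])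
  then show ?thesis by (simp add: compactin_subtopology)
qed

lemma compactin_chart_vimage:
  assumes "compact B" "B \<subseteq> chart_img c"
  shows "compactin M {q \<in> chart_dom c. chart_map c q \<in> B}"
proof -
  let ?C = "{q \<in> chart_dom c. chart_map c q \<in> B}"
  have "chart_map c ` ?C = B" using assms(2) by (auto simp: chart_img_def)
  then have "compactin (top_of_set (chart_img c)) (chart_map c ` ?C)"
    using assms by (simp add: compactin_subtopology)
  moreover have "?C \<subseteq> topspace (subtopology M (chart_dom c))" unfolding topspace_dom by auto
  ultimately have "compactin (subtopology M (chart_dom c)) ?C"
    using homeomorphic_map_compactness_eq[OF homeo, of ?C] by simp
  then show ?thesis by (simp add: compactin_subtopology)
qed

end

lemma transition_overlap:
  assumes "is_chart M c" "is_chart M d" "x \<in> overlap c d"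
  shows "chart_inv c x \<in> chart_dom c" "chart_inv c x \<in> chart_dom d"
    "transition c d x \<in> overlap d c" "chart_inv d (transition c d x) = chart_inv c x"
    "x \<in> chart_img c" "transition c d x \<in> chart_img d" "transition d c (transition c d x) = x"
proof -
  interpret c: one_chart M c by unfold_locales fact
  interpret d: one_chart M d by unfold_locales fact
  obtain p where p: "p \<in> chart_dom c" "p \<in> chart_dom d" "x = chart_map c p"
    using assms(3) by (auto simp: overlap_def)
  have "transition c d x = chart_map d p" using p by (simp add: transition_def)
  then show "chart_inv c x \<in> chart_dom c" "chart_inv c x \<in> chart_dom d"
    "transition c d x \<in> overlap d c" "chart_inv d (transition c d x) = chart_inv c x"
    "x \<in> chart_img c" "transition c d x \<in> chart_img d" "transition d c (transition c d x) = x"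
    using p by (auto simp: overlap_def transition_def)
qed

lemma open_overlap:
  assumes "is_chart M c" "is_chart M d"
  shows "open (overlap c d)"
proof -
  interpret c: one_chart M c by unfold_locales fact
  interpret d: one_chart M d by unfold_locales fact
  show ?thesis
    unfolding overlap_def by (rule c.open_chart_image) (auto intro: openin_Int c.openin_dom d.openin_dom)
qed

lemma transition_image:
  assumes "is_chart M c" "is_chart M d"
  shows "transition c d ` overlap c d = overlap d c" "inj_on (transition c d) (overlap c d)"
proof -
  have "y \<in> transition c d ` overlap c d" if "y \<in> overlap d c" for y
    using transition_overlap[OF assms(2,1) that] by (metis imageI)
  then show "transition c d ` overlap c d = overlap d c"
    using transition_overlap(3)[OF assms] by blast
  show "inj_on (transition c d) (overlap c d)"
    using transition_overlap(7)[OF assms] by (metis inj_onI)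
qed

lemma overlap_memI:
  assumes "is_chart M c" "x \<in> chart_img c" "chart_inv c x \<in> chart_dom d"
  shows "x \<in> overlap c d"
proof -
  interpret one_chart M c by unfold_locales fact
  show ?thesis
    unfolding overlap_def using assms(2,3) by (intro image_eqI[of _ _ "chart_inv c x"]) auto
qed

context
  fixes M :: "'m topology" and A :: "('m, 'n::finite) chart set"
  assumes closed: "closed_manifold M A"
begin

lemma atlas_chart: "c \<in> A \<Longrightarrow> is_chart M c"
  and atlas_cover: "(\<Union>c\<in>A. chart_dom c) = topspace M"
  and atlas_transition: "c \<in> A \<Longrightarrow> d \<in> A \<Longrightarrow> smooth_on (transition c d) (overlap c d)"
  and compact_M: "compact_space M" and Hausdorff_M: "Hausdorff_space M"
  using closed by (auto simp: closed_manifold_def smooth_atlas_def)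

text \<open>A bump in one chart, extended by 0. The set \<open>C\<close> is a closed coordinate
  ball: compact, hence closed because \<open>M\<close> is Hausdorff, and this makes the extension
  smooth in all other charts.\<close>

lemma bump_function_exists:
  assumes p: "p \<in> topspace M"
  shows "\<exists>c\<in>A. \<exists>\<psi> C. smooth_fun A \<psi> \<and> closedin M C \<and> C \<subseteq> chart_dom c \<and>
    (\<forall>q\<in>topspace M. \<psi> q \<ge> 0) \<and> (\<forall>q\<in>topspace M - C. \<psi> q = 0) \<and>
    openin M {q \<in> topspace M. \<psi> q > 0} \<and> \<psi> p > 0"
proof -
  have "p \<in> (\<Union>c\<in>A. chart_dom c)" using p unfolding atlas_cover .
  then obtain c where c: "c \<in> A" "p \<in> chart_dom c" by (rule UN_E)
  interpret c: one_chart M c by unfold_locales (rule atlas_chart[OF c(1)])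
  let ?x = "chart_map c p"
  obtain r where r: "r > 0" "cball ?x r \<subseteq> chart_img c"
    using c.open_img c.chart_map_img[OF c(2)] open_contains_cball by blast
  define C where "C = {q \<in> chart_dom c. chart_map c q \<in> cball ?x r}"
  define b where "b y = bump (r\<^sup>2 - (y - ?x) \<bullet> (y - ?x))" for y
  define \<psi> where "\<psi> q = (if q \<in> chart_dom c then b (chart_map c q) else 0)" for q
  have "compactin M C" unfolding C_def by (rule c.compactin_chart_vimage[OF compact_cball r(2)])
  then have C: "closedin M C" by (rule compactin_imp_closedin[OF Hausdorff_M])
  have b_pos: "b y > 0 \<longleftrightarrow> y \<in> ball ?x r" for y
  proof -
    have "y \<in> ball ?x r \<longleftrightarrow> (norm (y - ?x))\<^sup>2 < r\<^sup>2"
      using r(1) by (simp add: dist_norm norm_minus_commute abs_square_less_1 flip: abs_le_square_iff not_le)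
    then show ?thesis by (simp add: b_def bump_def power2_norm_eq_inner)
  qed
  have b_nonneg: "b y \<ge> 0" for y by (simp add: b_def bump_def)
  then have b_zero: "b y = 0" if "y \<notin> cball ?x r" for y
    using that b_pos[of y] by (metis antisym_conv2 ball_subset_cball subsetD)
  have smooth_b: "smooth_on b UNIV"
  proof -
    have "smooth_on (\<lambda>y. y - ?x) UNIV"
      by (rule smooth_on_diff[OF smooth_on_linear[OF open_UNIV bounded_linear_ident] smooth_on_const[OF open_UNIV] open_UNIV])
    then have "smooth_on (\<lambda>y. r\<^sup>2 - (y - ?x) \<bullet> (y - ?x)) UNIV"
      by (intro smooth_on_diff[OF smooth_on_const] smooth_on_inner) auto
    then show ?thesis unfolding b_def by (rule smooth_on_compose[OF smooth_on_bump]) auto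
  qed
  have "smooth_fun A \<psi>"
    unfolding smooth_fun_def
  proof
    fix d assume d: "d \<in> A"
    interpret d: one_chart M d by unfold_locales (rule atlas_chart[OF d])
    note dc = atlas_chart[OF d] atlas_chart[OF c(1)]
    let ?N = "chart_map d ` (chart_dom d - C)"
    have N: "open ?N"
      using openin_diff[OF d.openin_dom C] by (rule d.open_chart_image) auto
    \<comment> \<open>Two open sets cover the image of \<open>d\<close>: on the overlap the function
      is \<open>b\<close> after the transition map, and off the closed set \<open>C\<close> it is
      0.\<close>
    have "smooth_on (\<psi> \<circ> chart_inv d) (\<Union>{overlap d c, ?N})"
    proof (rule smooth_on_Union)
      fix T assume T: "T \<in> {overlap d c, ?N}"
      then show "open T" using N open_overlap[OF dc] by auto
      show "smooth_on (\<psi> \<circ> chart_inv d) T"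
      proof (cases "T = overlap d c")
        case True
        have "smooth_on (\<lambda>y. b (transition d c y)) (overlap d c)"
          by (rule smooth_on_compose[OF smooth_b atlas_transition[OF d c(1)] open_overlap[OF dc]]) auto
        moreover have "(\<psi> \<circ> chart_inv d) y = b (transition d c y)" if "y \<in> overlap d c" for y
          using transition_overlap[OF dc that] by (simp add: \<psi>_def transition_def)
        ultimately show ?thesis
          unfolding True by (subst smooth_on_cong[where h = "\<lambda>y. b (transition d c y)"]) auto
      next
        case False
        then have "T = ?N" using T by simp
        moreover have "(\<psi> \<circ> chart_inv d) y = 0" if "y \<in> ?N" for y
          using that by (auto simp: \<psi>_def C_def) (metis b_zero mem_cball)
        ultimately show ?thesis
          using smooth_on_cong[of T "\<psi> \<circ> chart_inv d" "\<lambda>_. 0"] N by auto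
      qed
    qed
    moreover have "\<Union>{overlap d c, ?N} = chart_img d"
      using C_def by (auto simp: overlap_def chart_img_def)
    ultimately show "smooth_on (\<psi> \<circ> chart_inv d) (chart_img d)" by simp
  qed
  moreover have "C \<subseteq> chart_dom c" by (auto simp: C_def)
  moreover have "\<forall>q\<in>topspace M. \<psi> q \<ge> 0" by (simp add: \<psi>_def b_nonneg)
  moreover have "\<forall>q\<in>topspace M - C. \<psi> q = 0"
    using b_zero by (auto simp: \<psi>_def C_def)
  moreover have "openin M {q \<in> topspace M. \<psi> q > 0}"
  proof -
    have "{q \<in> topspace M. \<psi> q > 0} = {q \<in> chart_dom c. chart_map c q \<in> ball ?x r}"
      using c.dom_subset b_pos by (auto simp: \<psi>_def split: if_splits)
    then show ?thesis using c.openin_chart_vimage[of "ball ?x r"] by simp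
  qed
  moreover have "\<psi> p > 0" using c(2) r(1) b_pos by (simp add: \<psi>_def)
  ultimately show ?thesis using C c(1) by blast
qed

lemma smooth_fun_sum:
  assumes "\<And>i. i \<in> I \<Longrightarrow> smooth_fun A (f i)"
  shows "smooth_fun A (\<lambda>q. \<Sum>i\<in>I. f i q)"
  unfolding smooth_fun_def o_def
proof
  fix c assume c: "c \<in> A"
  then have "open (chart_img c)" using atlas_chart by (simp add: is_chart_def)
  then show "smooth_on (\<lambda>x. \<Sum>i\<in>I. f i (chart_inv c x)) (chart_img c)"
    using assms c by (intro smooth_on_sum) (auto simp: smooth_fun_def o_def)
qed

text \<open>Compactness selects finitely many bumps whose sum is positive everywhere; dividing by
  that sum normalises them.\<close>

lemma partition_of_unity_exists: "\<exists>F \<rho>. partition_of_unity M A F \<rho>"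
proof -
  define Q where "Q p c \<psi> C \<longleftrightarrow> c \<in> A \<and> smooth_fun A \<psi> \<and> closedin M C \<and> C \<subseteq> chart_dom c \<and>
    (\<forall>q\<in>topspace M. \<psi> q \<ge> 0) \<and> (\<forall>q\<in>topspace M - C. \<psi> q = 0) \<and>
    openin M {q \<in> topspace M. \<psi> q > 0} \<and> \<psi> p > 0" for p c \<psi> C
  have "\<forall>p\<in>topspace M. \<exists>t. Q p (fst t) (fst (snd t)) (snd (snd t))"
  proof
    fix p assume "p \<in> topspace M"
    from bump_function_exists[OF this] have "\<exists>c \<psi> C. Q p c \<psi> C"
      unfolding Q_def Bex_def by (simp only: ex_simps)
    then obtain c \<psi> C where "Q p c \<psi> C" by (elim exE)
    then show "\<exists>t. Q p (fst t) (fst (snd t)) (snd (snd t))"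
      by (intro exI[of _ "(c, \<psi>, C)"]) simp
  qed
  then obtain t where t: "\<forall>p\<in>topspace M. Q p (fst (t p)) (fst (snd (t p))) (snd (snd (t p)))"
    by (rule bchoice[THEN exE])
  define c \<psi> C where "c p = fst (t p)" and "\<psi> p = fst (snd (t p))" and "C p = snd (snd (t p))" for p
  have Q: "p \<in> topspace M \<Longrightarrow> Q p (c p) (\<psi> p) (C p)" for p
    using t by (simp add: c_def \<psi>_def C_def)
  then have c: "\<And>p. p \<in> topspace M \<Longrightarrow> c p \<in> A"
    and \<psi>: "\<And>p. p \<in> topspace M \<Longrightarrow> smooth_fun A (\<psi> p)"
    and C: "\<And>p. p \<in> topspace M \<Longrightarrow> closedin M (C p)" "\<And>p. p \<in> topspace M \<Longrightarrow> C p \<subseteq> chart_dom (c p)"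
    and nonneg: "\<And>p q. p \<in> topspace M \<Longrightarrow> q \<in> topspace M \<Longrightarrow> \<psi> p q \<ge> 0"
    and zero: "\<And>p q. p \<in> topspace M \<Longrightarrow> q \<in> topspace M \<Longrightarrow> q \<notin> C p \<Longrightarrow> \<psi> p q = 0"
    and opn: "\<And>p. p \<in> topspace M \<Longrightarrow> openin M {q \<in> topspace M. \<psi> p q > 0}"
    and pos: "\<And>p. p \<in> topspace M \<Longrightarrow> \<psi> p p > 0"
    unfolding Q_def by simp_all
  let ?W = "\<lambda>p. {q \<in> topspace M. \<psi> p q > 0}"
  have "\<exists>\<F>. finite \<F> \<and> \<F> \<subseteq> ?W ` topspace M \<and> topspace M \<subseteq> \<Union>\<F>"
  proof -
    have "topspace M \<subseteq> \<Union>(?W ` topspace M)" using pos by auto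
    moreover have "\<forall>U\<in>?W ` topspace M. openin M U" using opn by auto
    ultimately show ?thesis using compact_M unfolding compact_space_alt by meson
  qed
  then obtain T where T: "finite T" "T \<subseteq> topspace M" "topspace M \<subseteq> (\<Union>p\<in>T. ?W p)"
    by (metis (no_types, lifting) finite_subset_image)
  define \<sigma> where "\<sigma> q = (\<Sum>p\<in>T. \<psi> p q)" for q
  \<comment> \<open>Several points of \<open>T\<close> may share a chart while the partition is
    indexed by charts, so the bumps are grouped by chart.\<close>
  define \<rho> where "\<rho> d q = (\<Sum>p\<in>{p\<in>T. c p = d}. \<psi> p q) / \<sigma> q" for d q
  have \<sigma>: "\<sigma> q > 0" if q: "q \<in> topspace M" for q
  proof -
    obtain p where p: "p \<in> T" "\<psi> p q > 0" using q T(3) by auto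
    show ?thesis unfolding \<sigma>_def by (rule sum_pos2[where f = "\<lambda>p. \<psi> p q", OF T(1) p]) (use nonneg q T(2) in auto)
  qed
  have "partition_of_unity M A (c ` T) \<rho>"
    unfolding partition_of_unity_def
  proof (intro conjI ballI)
    show "finite (c ` T)" using T by simp
    show "c ` T \<subseteq> A" using c T by auto
    show "(\<Sum>d\<in>c ` T. \<rho> d q) = 1" if q: "q \<in> topspace M" for q
    proof -
      have "(\<Sum>d\<in>c ` T. \<rho> d q) = (\<Sum>d\<in>c ` T. \<Sum>p\<in>{p\<in>T. c p = d}. \<psi> p q) / \<sigma> q"
        by (simp add: \<rho>_def sum_divide_distrib)
      also have "(\<Sum>d\<in>c ` T. \<Sum>p\<in>{p\<in>T. c p = d}. \<psi> p q) = \<sigma> q"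
        unfolding \<sigma>_def using T(1) by (rule sum.image_gen[symmetric])
      finally show ?thesis using \<sigma>[OF q] by simp
    qed
    fix d assume d: "d \<in> c ` T"
    show "smooth_fun A (\<rho> d)"
      unfolding smooth_fun_def
    proof
      fix e assume e: "e \<in> A"
      interpret e: one_chart M e by unfold_locales (rule atlas_chart[OF e])
      have s: "smooth_fun A (\<lambda>q. \<Sum>p\<in>{p\<in>T. c p = d}. \<psi> p q)" "smooth_fun A \<sigma>"
        unfolding \<sigma>_def using \<psi> T(2) by (auto intro!: smooth_fun_sum)
      show "smooth_on (\<rho> d \<circ> chart_inv e) (chart_img e)"
        unfolding o_def \<rho>_def
      proof (rule smooth_on_divide_pos)
        show "\<sigma> (chart_inv e x) > 0" if "x \<in> chart_img e" for x
          using \<sigma> e.chart_inv_dom[OF that] e.dom_subset by blast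
      qed (use s e e.open_img in \<open>auto simp: smooth_fun_def o_def\<close>)
    qed
    show "\<rho> d q \<ge> 0" if "q \<in> topspace M" for q
      unfolding \<rho>_def using nonneg \<sigma>[OF that] that T(2) by (auto intro!: divide_nonneg_pos sum_nonneg)
    have "M closure_of {q \<in> topspace M. \<rho> d q \<noteq> 0} \<subseteq> (\<Union>p\<in>{p\<in>T. c p = d}. C p)"
    proof (rule closure_of_minimal)
      show "closedin M (\<Union>p\<in>{p\<in>T. c p = d}. C p)"
        using T C(1) by (intro closedin_Union) auto
      show "{q \<in> topspace M. \<rho> d q \<noteq> 0} \<subseteq> (\<Union>p\<in>{p\<in>T. c p = d}. C p)"
      proof
        fix q assume q: "q \<in> {q \<in> topspace M. \<rho> d q \<noteq> 0}"
        then have "(\<Sum>p\<in>{p\<in>T. c p = d}. \<psi> p q) \<noteq> 0" by (auto simp: \<rho>_def)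
        then obtain p where "p \<in> T" "c p = d" "\<psi> p q \<noteq> 0" by (metis (mono_tags, lifting) mem_Collect_eq sum.neutral)
        then show "q \<in> (\<Union>p\<in>{p\<in>T. c p = d}. C p)" using zero q T(2) by blast
      qed
    qed
    also have "\<dots> \<subseteq> chart_dom d" using C(2) T(2) by blast
    finally show "M closure_of {p \<in> topspace M. \<rho> d p \<noteq> 0} \<subseteq> chart_dom d" .
  qed
  then show ?thesis by blast
qed

end

section \<open>The divergence theorem\<close>

context chart_metric
begin

definition vol :: "real^'n \<Rightarrow> real" where
  "vol x = sqrt (det (G x))"

lemma det_pos: "x \<in> U \<Longrightarrow> det (G x) > 0"
  by (rule posdef_det_pos[OF posdef_G])

lemma vol_pos: "x \<in> U \<Longrightarrow> vol x > 0"
  using det_pos by (simp add: vol_def)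

lemma smooth_G_nth: "smooth_on (\<lambda>x. G x $ i $ j) U"
  by (intro smooth_on_nth smooth_G open_U)

lemma smooth_vol: "smooth_on vol U"
  unfolding vol_def by (intro smooth_on_sqrt smooth_on_det smooth_G_nth open_U det_pos)

text \<open>Jacobi's formula for det G combined with metric compatibility: the trace of P
  \<partial>_k G is twice the trace of \<Gamma>_k.\<close>

lemma pd_vol:
  assumes x: "x \<in> U"
  shows "pd k vol x = vol x * trace (\<Gamma> k x)"
proof -
  have "pd k (\<lambda>y. det (G y)) x = det (G x) * trace (P x ** partial k G x)"
    by (subst pd_det[OF smooth_differentiable[OF smooth_G_nth x] inv_G[OF x]])
      (simp add: trace_def matrix_nth pd_eq_partial partial_nth2[OF smooth_G x])
  also have "trace (P x ** partial k G x) = trace (P x ** transpose (\<Gamma> k x) ** G x) + trace (P x ** G x ** \<Gamma> k x)"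
    by (simp add: partial_G[OF x] mat_alg trace_add)
  also have "trace (P x ** transpose (\<Gamma> k x) ** G x) = trace (\<Gamma> k x)"
  proof -
    have "trace (P x ** transpose (\<Gamma> k x) ** G x) = trace (G x ** (P x ** transpose (\<Gamma> k x)))" by (rule trace_mul_sym)
    then show ?thesis by (simp add: matrix_mul_assoc GP[OF x] trace_transpose)
  qed
  also have "trace (P x ** G x ** \<Gamma> k x) = trace (\<Gamma> k x)" by (simp add: PG[OF x])
  finally have d: "pd k (\<lambda>y. det (G y)) x = det (G x) * (2 * trace (\<Gamma> k x))" by simp
  \<comment> \<open>Differentiating vol^2 = det G spares the derivative of the square root.\<close>
  have "pd k (\<lambda>y. det (G y)) x = pd k (\<lambda>y. vol y * vol y) x"
    by (rule pd_cong[OF open_U x]) (use det_pos in \<open>simp add: vol_def less_imp_le\<close>)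
  also have "\<dots> = 2 * vol x * pd k vol x"
    using smooth_differentiable[OF smooth_vol x] by (simp add: pd_mult)
  finally have v: "pd k (\<lambda>y. det (G y)) x = 2 * vol x * pd k vol x" .
  have "det (G x) = vol x * vol x" using det_pos[OF x] by (simp add: vol_def)
  then have "2 * vol x * pd k vol x = 2 * vol x * (vol x * trace (\<Gamma> k x))"
    using d v by simp
  then show ?thesis using vol_pos[OF x] by simp
qed

text \<open>The Voss-Weyl formula: weighted with the volume density, the divergence is a sum of
  plain partial derivatives, to which \<open>set_integral_pd\<close> applies.\<close>

lemma sum_pd_vol:
  assumes Y: "smooth_on Y U" and x: "x \<in> U"
  shows "(\<Sum>i\<in>UNIV. pd i (\<lambda>y. vol y * Y y $ i) x) = vol x * divergence G Y x"
proof -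
  have "pd i (\<lambda>y. vol y * Y y $ i) x = vol x * partial i Y x $ i + vol x * (trace (\<Gamma> i x) * Y x $ i)" for i
    using pd_mult[OF smooth_differentiable[OF smooth_vol x] smooth_differentiable[OF smooth_nth[OF Y] x]]
    by (simp add: pd_vol[OF x, unfolded pd_eq_partial] pd_eq_partial partial_nth[OF Y x])
  moreover have "(\<Sum>i\<in>UNIV. trace (\<Gamma> i x) * Y x $ i) = (\<Sum>i\<in>UNIV. (\<Gamma> i x *v Y x) $ i)"
    by (simp add: trace_def chr_nth matrix_vector_mult_def sum_distrib_right christoffel_sym[OF x, of _ _ i for i])
      (subst sum.swap, simp add: christoffel_sym[OF x])
  ultimately show ?thesis
    by (simp add: divergence_eq_trace trace_def nabla_mat_nth[OF Y x] sum.distrib sum_distrib_left[symmetric] distrib_left)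
qed

end

lemma riemannian_chart_metric:
  assumes "closed_riemannian_manifold M A g" "c \<in> A"
  shows "chart_metric (chart_img c) (g c)"
proof -
  have "is_chart M c" and r: "riemannian_metric A g"
    using assms by (auto simp: closed_riemannian_manifold_def closed_manifold_def smooth_atlas_def)
  then show ?thesis
    using assms(2) by unfold_locales (auto simp: is_chart_def riemannian_metric_def posdef_def)
qed

lemma riemannian_chart_change:
  assumes cr: "closed_riemannian_manifold M A g" and cd: "c \<in> A" "d \<in> A"
  shows "chart_change (overlap c d) (chart_img d) (g c) (g d) (transition c d)"
proof -
  have cm: "closed_manifold M A" and r: "riemannian_metric A g"
    using cr by (auto simp: closed_riemannian_manifold_def)
  have ch: "is_chart M c" "is_chart M d" using atlas_chart[OF cm] cd by auto
  interpret c: chart_metric "chart_img c" "g c" by (rule riemannian_chart_metric[OF cr cd(1)])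
  interpret d: chart_metric "chart_img d" "g d" by (rule riemannian_chart_metric[OF cr cd(2)])
  have sub: "overlap c d \<subseteq> chart_img c" using transition_overlap(5)[OF ch] by blast
  show ?thesis
  proof unfold_locales
    show "open (overlap c d)" by (rule open_overlap[OF ch])
    show "smooth_on (g c) (overlap c d)"
      by (rule smooth_on_subset[OF c.smooth_G c.open_U open_overlap[OF ch] sub])
    show "posdef (g c x)" if "x \<in> overlap c d" for x using that sub c.posdef_G by blast
    show "smooth_on (transition c d) (overlap c d)" by (rule atlas_transition[OF cm cd])
    show "transition c d x \<in> chart_img d" if "x \<in> overlap c d" for x by (rule transition_overlap(6)[OF ch that])
    show "frechet_derivative (transition c d) (at x) v \<bullet> (g d (transition c d x) *v frechet_derivative (transition c d) (at x) w)
      = v \<bullet> (g c x *v w)" if "x \<in> overlap c d" for x v w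
      using r cd that unfolding riemannian_metric_def Let_def by blast
  qed
qed

text \<open>The partition is arbitrary but fixed, and all integrals are formed with it. Integrals in
  different charts are compared only inside the divergence theorem.\<close>

locale riemannian_pou =
  fixes M :: "'m topology" and A :: "('m, 'n::finite) chart set"
    and g :: "('m, 'n) chart \<Rightarrow> 'n local_metric" and F \<rho>
  assumes crm: "closed_riemannian_manifold M A g" and pou: "partition_of_unity M A F \<rho>"
begin

lemma closed_M: "closed_manifold M A"
  using crm by (simp add: closed_riemannian_manifold_def)

lemmas chart_A = atlas_chart[OF closed_M]
lemmas metric_A = riemannian_chart_metric[OF crm]
lemmas change_A = riemannian_chart_change[OF crm]

lemma F_A: "c \<in> F \<Longrightarrow> c \<in> A"
  using pou by (auto simp: partition_of_unity_def)

text \<open>The first chart labels the member of the partition, the second the coordinates in which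
  it is expressed; the weights of the integral are the functions \<open>cut c c\<close>.\<close>

definition cut :: "('m, 'n) chart \<Rightarrow> ('m, 'n) chart \<Rightarrow> real^'n \<Rightarrow> real" where
  "cut d c x = \<rho> d (chart_inv c x)"

definition supp :: "('m, 'n) chart \<Rightarrow> (real^'n) set" where
  "supp c = chart_map c ` (M closure_of {p \<in> topspace M. \<rho> c p \<noteq> 0})"

definition pou_integral :: "(('m, 'n) chart \<Rightarrow> real^'n \<Rightarrow> real) \<Rightarrow> real" where
  "pou_integral f = (\<Sum>c\<in>F. LINT x:chart_img c|lborel. cut c c x * f c x * sqrt (det (g c x)))"

lemma smooth_cut: "d \<in> F \<Longrightarrow> c \<in> A \<Longrightarrow> smooth_on (cut d c) (chart_img c)"
  using pou by (simp add: partition_of_unity_def smooth_fun_def cut_def[abs_def] o_def)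

lemma chart_inv_topspace: "c \<in> A \<Longrightarrow> x \<in> chart_img c \<Longrightarrow> chart_inv c x \<in> topspace M"
proof -
  assume "c \<in> A" "x \<in> chart_img c"
  then interpret one_chart M c by unfold_locales (rule chart_A)
  show ?thesis using chart_inv_dom[OF \<open>x \<in> chart_img c\<close>] dom_subset by blast
qed

lemma cut_nonneg: "d \<in> F \<Longrightarrow> c \<in> A \<Longrightarrow> x \<in> chart_img c \<Longrightarrow> cut d c x \<ge> 0"
  using pou chart_inv_topspace by (simp add: partition_of_unity_def cut_def)

lemma sum_cut: "c \<in> A \<Longrightarrow> x \<in> chart_img c \<Longrightarrow> (\<Sum>d\<in>F. cut d c x) = 1"
  using pou chart_inv_topspace by (simp add: partition_of_unity_def cut_def)

lemma supp_dom: "d \<in> F \<Longrightarrow> M closure_of {p \<in> topspace M. \<rho> d p \<noteq> 0} \<subseteq> chart_dom d"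
  using pou by (simp add: partition_of_unity_def)

lemma cut_zero_overlap:
  assumes "d \<in> F" "c \<in> A" "x \<in> chart_img c" "x \<notin> overlap c d"
  shows "cut d c x = 0"
proof (rule ccontr)
  assume ne: "cut d c x \<noteq> 0"
  have "chart_inv c x \<in> {p \<in> topspace M. \<rho> d p \<noteq> 0}"
    using ne chart_inv_topspace[OF assms(2,3)] by (simp add: cut_def)
  then have "chart_inv c x \<in> chart_dom d"
    using supp_dom[OF assms(1)] closure_of_subset[of "{p \<in> topspace M. \<rho> d p \<noteq> 0}" M] by blast
  then show False using overlap_memI[OF chart_A[OF assms(2)] assms(3)] assms(4) by blast
qed

lemma support_F:
  assumes c: "c \<in> F"
  shows "compact_support (chart_img c) (supp c)"
proof -
  interpret one_chart M c by unfold_locales (rule chart_A[OF F_A[OF c]])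
  have "compactin M (M closure_of {p \<in> topspace M. \<rho> c p \<noteq> 0})"
    using compact_M[OF closed_M] closedin_closure_of by (rule closedin_compact_space)
  then have "compact (supp c)" unfolding supp_def by (rule compact_chart_image[OF _ supp_dom[OF c]])
  moreover have "supp c \<subseteq> chart_img c"
    using supp_dom[OF c] by (auto simp: supp_def)
  ultimately show ?thesis using open_img by unfold_locales
qed

lemma cut_zero_supp:
  assumes c: "c \<in> F" and x: "x \<in> chart_img c - supp c"
  shows "cut c c x = 0"
proof (rule ccontr)
  interpret one_chart M c by unfold_locales (rule chart_A[OF F_A[OF c]])
  assume ne: "cut c c x \<noteq> 0"
  have "chart_inv c x \<in> {p \<in> topspace M. \<rho> c p \<noteq> 0}"
    using ne chart_inv_topspace[OF F_A[OF c]] x by (simp add: cut_def)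
  then have "chart_inv c x \<in> M closure_of {p \<in> topspace M. \<rho> c p \<noteq> 0}"
    using closure_of_subset[of "{p \<in> topspace M. \<rho> c p \<noteq> 0}" M] by blast
  then have "chart_map c (chart_inv c x) \<in> supp c" unfolding supp_def by (rule imageI)
  then show False using x by simp
qed

lemma continuous_cut: "d \<in> F \<Longrightarrow> c \<in> A \<Longrightarrow> continuous_on (chart_img c) (cut d c)"
  by (rule smooth_on_imp_continuous_on[OF smooth_cut])

lemma continuous_vol: "c \<in> A \<Longrightarrow> continuous_on (chart_img c) (\<lambda>x. sqrt (det (g c x)))"
proof -
  assume c: "c \<in> A"
  have "chart_metric.vol (g c) = (\<lambda>x. sqrt (det (g c x)))"
    by (rule ext) (rule chart_metric.vol_def[OF metric_A[OF c]])
  then show ?thesis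
    using smooth_on_imp_continuous_on[OF chart_metric.smooth_vol[OF metric_A[OF c]]] by simp
qed

lemma integrable_F:
  assumes "c \<in> F" "continuous_on (chart_img c) f"
  shows "set_integrable lborel (chart_img c) (\<lambda>x. cut c c x * f x * sqrt (det (g c x)))"
  using assms by (intro compact_support.set_integrable_support[OF support_F] continuous_on_mult
      continuous_cut continuous_vol F_A) (auto simp: cut_zero_supp)

lemma pou_integral_add:
  assumes "\<And>c. c \<in> A \<Longrightarrow> continuous_on (chart_img c) (f c)" "\<And>c. c \<in> A \<Longrightarrow> continuous_on (chart_img c) (h c)"
  shows "pou_integral (\<lambda>c x. f c x + h c x) = pou_integral f + pou_integral h"
proof -
  have "(LINT x:chart_img c|lborel. cut c c x * (f c x + h c x) * sqrt (det (g c x))) =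
    (LINT x:chart_img c|lborel. cut c c x * f c x * sqrt (det (g c x))) +
    (LINT x:chart_img c|lborel. cut c c x * h c x * sqrt (det (g c x)))" if "c \<in> F" for c
    using set_integral_add(2)[OF integrable_F[OF that assms(1)[OF F_A[OF that]]] integrable_F[OF that assms(2)[OF F_A[OF that]]]]
    by (simp add: distrib_left distrib_right)
  then show ?thesis by (simp add: pou_integral_def sum.distrib)
qed

lemma pou_integral_cmult: "pou_integral (\<lambda>c x. a * f c x) = a * pou_integral f"
proof -
  have "(LINT x:chart_img c|lborel. cut c c x * (a * f c x) * sqrt (det (g c x))) =
    a * (LINT x:chart_img c|lborel. cut c c x * f c x * sqrt (det (g c x)))" for c
    by (subst set_integral_mult_right[symmetric]) (simp add: mult_ac)
  then show ?thesis by (simp add: pou_integral_def sum_distrib_left)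
qed

lemma pou_integral_cong:
  assumes "\<And>c x. c \<in> A \<Longrightarrow> x \<in> chart_img c \<Longrightarrow> f c x = h c x"
  shows "pou_integral f = pou_integral h"
  unfolding pou_integral_def set_lebesgue_integral_def
  by (intro sum.cong refl Bochner_Integration.integral_cong) (use assms F_A in \<open>auto simp: indicator_def\<close>)

lemma pou_integral_nonneg:
  assumes "\<And>c x. c \<in> A \<Longrightarrow> x \<in> chart_img c \<Longrightarrow> f c x \<ge> 0"
  shows "pou_integral f \<ge> 0"
  unfolding pou_integral_def set_lebesgue_integral_def
proof (intro sum_nonneg Bochner_Integration.integral_nonneg)
  fix c x assume c: "c \<in> F"
  have "sqrt (det (g c x)) \<ge> 0" if "x \<in> chart_img c"
    using chart_metric.det_pos[OF metric_A[OF F_A[OF c]] that] by simp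
  then show "0 \<le> indicator (chart_img c) x *\<^sub>R (cut c c x * f c x * sqrt (det (g c x)))"
    using assms[OF F_A[OF c]] cut_nonneg[OF c F_A[OF c]] by (auto simp: indicator_def)
qed

definition cut_deriv :: "(('m, 'n) chart \<Rightarrow> real^'n \<Rightarrow> real^'n) \<Rightarrow> ('m, 'n) chart \<Rightarrow> ('m, 'n) chart \<Rightarrow> real^'n \<Rightarrow> real" where
  "cut_deriv Y d c x = diff_vec (cut d c) x \<bullet> Y c x"

context
  fixes Y :: "('m, 'n) chart \<Rightarrow> real^'n \<Rightarrow> real^'n"
  assumes Y: "smooth_vector_field A Y"
begin

lemma smooth_Y: "c \<in> A \<Longrightarrow> smooth_on (Y c) (chart_img c)"
  using Y by (simp add: smooth_vector_field_def)

lemma continuous_cut_deriv: "d \<in> F \<Longrightarrow> c \<in> A \<Longrightarrow> continuous_on (chart_img c) (cut_deriv Y d c)"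
  unfolding cut_deriv_def
  by (intro continuous_on_inner smooth_on_imp_continuous_on chart_metric.smooth_diff_vec[OF metric_A] smooth_cut smooth_Y)

lemma cut_deriv_zero:
  assumes c: "c \<in> F" and x: "x \<in> chart_img c - supp c"
  shows "cut_deriv Y c c x = 0"
proof -
  interpret compact_support "chart_img c" "supp c" by (rule support_F[OF c])
  have "open (chart_img c - supp c)" using open_U compact_K by (simp add: compact_imp_closed open_Diff)
  then have "pd i (cut c c) x = pd i (\<lambda>_. 0) x" for i
    by (rule pd_cong) (use x cut_zero_supp[OF c] in auto)
  then show ?thesis by (simp add: cut_deriv_def diff_vec_def zero_vec_def[symmetric])
qed

text \<open>A derivative vanishes where the function is 0 in a neighbourhood. The neighbourhood
  exists because the support of \<rho>_c is closed and lies in the domain of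
  \<open>c\<close>.\<close>

lemma cut_deriv_zero_overlap:
  assumes c: "c \<in> F" and d: "d \<in> A" and y: "y \<in> chart_img d" "y \<notin> overlap d c"
  shows "cut_deriv Y c d y = 0"
proof -
  interpret d: one_chart M d by unfold_locales (rule chart_A[OF d])
  let ?S = "M closure_of {p \<in> topspace M. \<rho> c p \<noteq> 0}"
  let ?N = "chart_map d ` (chart_dom d - ?S)"
  have N: "open ?N"
    using openin_diff[OF d.openin_dom closedin_closure_of] by (rule d.open_chart_image) auto
  have "chart_inv d y \<notin> chart_dom c" using overlap_memI[OF chart_A[OF d] y(1)] y(2) by blast
  then have yN: "y \<in> ?N"
    using y(1) supp_dom[OF c] by (intro image_eqI[of _ _ "chart_inv d y"]) auto
  have "cut c d z = 0" if "z \<in> ?N" for z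
  proof -
    obtain q where q: "q \<in> chart_dom d" "q \<notin> ?S" "z = chart_map d q" using \<open>z \<in> ?N\<close> by auto
    have "q \<notin> {p \<in> topspace M. \<rho> c p \<noteq> 0}"
      using q(2) closure_of_subset[of "{p \<in> topspace M. \<rho> c p \<noteq> 0}" M] by blast
    then show ?thesis using q d.dom_subset by (auto simp: cut_def)
  qed
  then have "pd i (cut c d) y = pd i (\<lambda>_. 0) y" for i by (rule pd_cong[OF N yN])
  then show ?thesis by (simp add: cut_deriv_def diff_vec_def zero_vec_def[symmetric])
qed

text \<open>The divergence of \<rho>_c Y integrates to 0 within one chart, by the Voss-Weyl formula
  and compact support; the product rule leaves the derivative of the weight.\<close>

lemma integral_cut_divergence:
  assumes c: "c \<in> F"
  shows "(LINT x:chart_img c|lborel. cut c c x * divergence (g c) (Y c) x * sqrt (det (g c x))) =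
    - (LINT x:chart_img c|lborel. cut_deriv Y c c x * sqrt (det (g c x)))"
proof -
  note cA = F_A[OF c]
  interpret chart_metric "chart_img c" "g c" by (rule metric_A[OF cA])
  interpret compact_support "chart_img c" "supp c" by (rule support_F[OF c])
  note sc = smooth_cut[OF c cA] and sY = smooth_nth[OF smooth_Y[OF cA]]
  have sf: "smooth_on (\<lambda>x. cut c c x * (vol x * Y c x $ i)) (chart_img c)" for i
    by (intro smooth_mult sc smooth_vol sY)
  have z: "(LINT x:chart_img c|lborel. pd i (\<lambda>x. cut c c x * (vol x * Y c x $ i)) x) = 0" for i
    by (rule set_integral_pd[OF sf]) (simp add: cut_zero_supp[OF c])
  have z': "pd i (\<lambda>x. cut c c x * (vol x * Y c x $ i)) x = 0" if "x \<in> chart_img c - supp c" for i x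
    using pd_cong[of "chart_img c - supp c" x "\<lambda>x. cut c c x * (vol x * Y c x $ i)" "\<lambda>_. 0" i] that
      open_U compact_K by (simp add: compact_imp_closed open_Diff cut_zero_supp[OF c])
  have int: "set_integrable lborel (chart_img c) (pd i (\<lambda>x. cut c c x * (vol x * Y c x $ i)))" for i
    by (rule set_integrable_support[OF smooth_on_imp_continuous_on[OF smooth_pd[OF sf]] z'])
  have e: "(\<Sum>i\<in>UNIV. pd i (\<lambda>x. cut c c x * (vol x * Y c x $ i)) x) =
      cut c c x * divergence (g c) (Y c) x * vol x + cut_deriv Y c c x * vol x" if x: "x \<in> chart_img c" for x
  proof -
    have "pd i (\<lambda>x. cut c c x * (vol x * Y c x $ i)) x =
        cut c c x * pd i (\<lambda>x. vol x * Y c x $ i) x + pd i (cut c c) x * (vol x * Y c x $ i)" for i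
      by (rule pd_mult[OF smooth_differentiable[OF sc x] smooth_differentiable[OF smooth_mult[OF smooth_vol sY] x]])
    then show ?thesis
      using sum_pd_vol[OF smooth_Y[OF cA] x]
      by (simp add: sum.distrib sum_distrib_left[symmetric] cut_deriv_def diff_vec_def
          Finite_Cartesian_Product.inner_vec_def sum_distrib_right mult_ac)
  qed
  have "0 = (\<Sum>i\<in>UNIV. LINT x:chart_img c|lborel. pd i (\<lambda>x. cut c c x * (vol x * Y c x $ i)) x)"
    by (simp add: z)
  also have "\<dots> = (LINT x:chart_img c|lborel. \<Sum>i\<in>UNIV. pd i (\<lambda>x. cut c c x * (vol x * Y c x $ i)) x)"
    using int unfolding set_lebesgue_integral_def set_integrable_def scaleR_sum_right
    by (subst Bochner_Integration.integral_sum) auto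
  also have "\<dots> = (LINT x:chart_img c|lborel. cut c c x * divergence (g c) (Y c) x * vol x + cut_deriv Y c c x * vol x)"
    unfolding set_lebesgue_integral_def
    by (rule Bochner_Integration.integral_cong) (auto simp: indicator_def e)
  also have "\<dots> = (LINT x:chart_img c|lborel. cut c c x * divergence (g c) (Y c) x * vol x) +
      (LINT x:chart_img c|lborel. cut_deriv Y c c x * vol x)"
  proof (rule set_integral_add(2))
    show "set_integrable lborel (chart_img c) (\<lambda>x. cut c c x * divergence (g c) (Y c) x * vol x)"
      unfolding vol_def by (rule integrable_F[OF c smooth_on_imp_continuous_on[OF smooth_divergence[OF smooth_Y[OF cA]]]])
    show "set_integrable lborel (chart_img c) (\<lambda>x. cut_deriv Y c c x * vol x)"
      by (rule set_integrable_support[OF continuous_on_mult[OF continuous_cut_deriv[OF c cA] smooth_on_imp_continuous_on[OF smooth_vol]]])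
        (simp add: cut_deriv_zero[OF c])
  qed
  finally show ?thesis by (simp add: vol_def)
qed

text \<open>Both sides are the integral over the overlap of the scalar \<open>\<rho>\<^sub>d Y(\<rho>\<^sub>c)\<close>.\<close>

lemma integral_cut_deriv_change:
  assumes c: "c \<in> F" and d: "d \<in> F"
  shows "(LINT x:chart_img c|lborel. cut d c x * cut_deriv Y c c x * sqrt (det (g c x))) =
    (LINT x:chart_img d|lborel. cut d d x * cut_deriv Y c d x * sqrt (det (g d x)))"
proof -
  note cA = F_A[OF c] and dA = F_A[OF d]
  note ch = chart_A[OF cA] chart_A[OF dA]
  let ?\<tau> = "transition c d" and ?S = "overlap c d"
  interpret chart_change ?S "chart_img d" "g c" "g d" ?\<tau> by (rule change_A[OF cA dA])
  interpret c: compact_support "chart_img c" "supp c" by (rule support_F[OF c])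
  define hc where "hc x = cut d c x * cut_deriv Y c c x * sqrt (det (g c x))" for x
  define hd where "hd x = cut d d x * cut_deriv Y c d x * sqrt (det (g d x))" for x
  have rel: "hc x = \<bar>det (matrix (frechet_derivative ?\<tau> (at x)))\<bar> * hd (?\<tau> x)" if x: "x \<in> ?S" for x
  proof -
    have cut: "cut e d (?\<tau> y) = cut e c y" if "y \<in> ?S" for e y
      using transition_overlap(4)[OF ch that] by (simp add: cut_def)
    have "cut_deriv Y c c x = cut_deriv Y c d (?\<tau> x)"
    proof -
      have "Y d (?\<tau> x) = J x *v Y c x"
        using Y cA dA x by (simp add: smooth_vector_field_def J_mult)
      moreover have "diff_vec (cut c c) x = transpose (J x) *v diff_vec (cut c d) (?\<tau> x)"
        by (rule diff_vec_transform[OF smooth_cut[OF c dA] cut x])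
      ultimately show ?thesis
        by (simp add: cut_deriv_def dot_lmul_matrix)
    qed
    moreover have "sqrt (det (g c x)) = \<bar>det (J x)\<bar> * sqrt (det (g d (?\<tau> x)))"
      by (simp add: G_eq[OF x] det_mul real_sqrt_mult)
    moreover have "matrix (frechet_derivative ?\<tau> (at x)) = J x"
      using J_mult[OF x] by (metis matrix_of_matrix_vector_mul ext)
    ultimately show ?thesis by (simp add: hc_def hd_def cut[OF x])
  qed
  have ic: "set_integrable lborel (chart_img c) hc"
    unfolding hc_def
    by (rule c.set_integrable_support)
      (auto intro!: continuous_on_mult continuous_cut_deriv continuous_cut continuous_vol c d cA dA simp: cut_deriv_zero[OF c])
  have id: "set_integrable lborel (chart_img d) hd"
    unfolding hd_def by (rule integrable_F[OF d continuous_cut_deriv[OF c dA]])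
  \<comment> \<open>Both integrands live on the overlap, for different reasons: in chart
    \<open>c\<close> because of the weight \<rho>_d, in chart \<open>d\<close> because of the
    derivative of \<rho>_c.\<close>
  have zc: "indicator (chart_img c) x *\<^sub>R hc x = indicator ?S x *\<^sub>R hc x" for x
    using cut_zero_overlap[OF d cA, of x] transition_overlap(5)[OF ch, of x] by (auto simp: indicator_def hc_def)
  have zd: "indicator (chart_img d) y *\<^sub>R hd y = indicator (overlap d c) y *\<^sub>R hd y" for y
    using cut_deriv_zero_overlap[OF c dA, of y] transition_overlap(5)[OF ch(2,1), of y] by (auto simp: indicator_def hd_def)
  have "(LINT y:?\<tau> ` ?S|lborel. hd y) = (LINT x:?S|lborel. \<bar>det (matrix (frechet_derivative ?\<tau> (at x)))\<bar> * hd (?\<tau> x))"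
  proof (rule set_integral_change_of_variables)
    show "(?\<tau> has_derivative frechet_derivative ?\<tau> (at x)) (at x)" if "x \<in> ?S" for x
      by (rule A.smooth_der[OF smooth_\<tau> that])
    show "set_integrable lborel (?\<tau> ` ?S) hd"
      using id unfolding set_integrable_def zd transition_image(1)[OF ch] .
    have "(\<lambda>x. indicator ?S x *\<^sub>R (\<bar>det (matrix (frechet_derivative ?\<tau> (at x)))\<bar> * hd (?\<tau> x))) =
        (\<lambda>x. indicator ?S x *\<^sub>R hc x)"
      by (auto simp: rel indicator_def)
    then show "set_integrable lborel ?S (\<lambda>x. \<bar>det (matrix (frechet_derivative ?\<tau> (at x)))\<bar> * hd (?\<tau> x))"
      using ic unfolding set_integrable_def zc by simp
  qed (rule A.open_U, rule transition_image(2)[OF ch])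
  also have "\<dots> = (LINT x:?S|lborel. hc x)"
    unfolding set_lebesgue_integral_def
    by (rule Bochner_Integration.integral_cong) (auto simp: indicator_def rel)
  finally have fin: "(LINT y:?\<tau> ` ?S|lborel. hd y) = (LINT x:?S|lborel. hc x)" .
  show ?thesis
    using fin unfolding transition_image(1)[OF ch] set_lebesgue_integral_def hc_def[symmetric] hd_def[symmetric] zc zd
    by simp
qed

text \<open>The derivatives of the weights cancel once they are compared in the same chart. Split
  Y(\<rho>_c) by the sum of all \<rho>_d, move each piece to chart \<open>d\<close>, and sum over
  \<open>c\<close> there: this differentiates the constant 1.\<close>

lemma pou_integral_divergence: "pou_integral (\<lambda>c. divergence (g c) (Y c)) = 0"
proof -
  have s1: "(LINT x:chart_img c|lborel. cut_deriv Y c c x * sqrt (det (g c x))) =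
      (\<Sum>d\<in>F. LINT x:chart_img c|lborel. cut d c x * cut_deriv Y c c x * sqrt (det (g c x)))" if c: "c \<in> F" for c
  proof -
    interpret c: compact_support "chart_img c" "supp c" by (rule support_F[OF c])
    have int: "set_integrable lborel (chart_img c) (\<lambda>x. cut d c x * cut_deriv Y c c x * sqrt (det (g c x)))" if "d \<in> F" for d
      by (rule c.set_integrable_support)
        (use c that F_A[OF c] in \<open>auto intro!: continuous_on_mult continuous_cut_deriv continuous_cut continuous_vol simp: cut_deriv_zero[OF c]\<close>)
    have "(LINT x:chart_img c|lborel. cut_deriv Y c c x * sqrt (det (g c x))) =
      (LINT x:chart_img c|lborel. \<Sum>d\<in>F. cut d c x * cut_deriv Y c c x * sqrt (det (g c x)))"
      unfolding set_lebesgue_integral_def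
      by (rule Bochner_Integration.integral_cong)
        (auto simp: indicator_def sum_distrib_right[symmetric] sum_cut F_A c)
    also have "\<dots> = (\<Sum>d\<in>F. LINT x:chart_img c|lborel. cut d c x * cut_deriv Y c c x * sqrt (det (g c x)))"
      using int unfolding set_lebesgue_integral_def set_integrable_def scaleR_sum_right
      by (subst Bochner_Integration.integral_sum) auto
    finally show ?thesis .
  qed
  have s2: "(\<Sum>c\<in>F. LINT x:chart_img d|lborel. cut d d x * cut_deriv Y c d x * sqrt (det (g d x))) = 0" if d: "d \<in> F" for d
  proof -
    have z: "(\<Sum>c\<in>F. cut_deriv Y c d x) = 0" if x: "x \<in> chart_img d" for x
    proof -
      interpret chart_metric "chart_img d" "g d" by (rule metric_A[OF F_A[OF d]])
      have "(\<Sum>c\<in>F. pd i (cut c d) x) = 0" for i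
      proof -
        have "(\<Sum>c\<in>F. pd i (cut c d) x) = pd i (\<lambda>y. \<Sum>c\<in>F. cut c d y) x"
          by (rule pd_sum[symmetric]) (rule smooth_differentiable[OF smooth_cut[OF _ F_A[OF d]] x])
        also have "\<dots> = pd i (\<lambda>y. 1) x"
          by (rule pd_cong[OF open_U x]) (rule sum_cut[OF F_A[OF d]])
        finally show ?thesis by simp
      qed
      then have "(\<Sum>c\<in>F. diff_vec (cut c d) x) = 0"
        by (simp add: vec_eq_iff diff_vec_def)
      then show ?thesis by (simp add: cut_deriv_def inner_sum_left[symmetric])
    qed
    have int: "set_integrable lborel (chart_img d) (\<lambda>x. cut d d x * cut_deriv Y c d x * sqrt (det (g d x)))" if "c \<in> F" for c
      by (rule integrable_F[OF d continuous_cut_deriv[OF that F_A[OF d]]])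
    have "(\<Sum>c\<in>F. LINT x:chart_img d|lborel. cut d d x * cut_deriv Y c d x * sqrt (det (g d x))) =
      (LINT x:chart_img d|lborel. \<Sum>c\<in>F. cut d d x * cut_deriv Y c d x * sqrt (det (g d x)))"
      using int unfolding set_lebesgue_integral_def set_integrable_def scaleR_sum_right
      by (subst Bochner_Integration.integral_sum) auto
    also have "\<dots> = (LINT x:chart_img d|lborel. 0)"
      unfolding set_lebesgue_integral_def
      by (rule Bochner_Integration.integral_cong)
        (auto simp: indicator_def sum_distrib_right[symmetric] sum_distrib_left[symmetric] z)
    finally show ?thesis by (simp add: set_lebesgue_integral_def)
  qed
  have "pou_integral (\<lambda>c. divergence (g c) (Y c)) = - (\<Sum>c\<in>F. LINT x:chart_img c|lborel. cut_deriv Y c c x * sqrt (det (g c x)))"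
    by (simp add: pou_integral_def integral_cut_divergence sum_negf)
  also have "\<dots> = - (\<Sum>c\<in>F. \<Sum>d\<in>F. LINT x:chart_img d|lborel. cut d d x * cut_deriv Y c d x * sqrt (det (g d x)))"
    by (simp add: s1) (intro sum.cong refl integral_cut_deriv_change)
  also have "\<dots> = - (\<Sum>d\<in>F. \<Sum>c\<in>F. LINT x:chart_img d|lborel. cut d d x * cut_deriv Y c d x * sqrt (det (g d x)))"
    by (subst sum.swap) simp
  finally show ?thesis by (simp add: s2)
qed

end

end

section \<open>The flow\<close>

text \<open>By the mean value theorem f(t+1) - f(t) is a value of \<open>a\<close> shortly after
  \<open>t\<close>. It is small because \<open>f\<close> is Cauchy, and \<open>a\<close> hardly
  varies from there to \<open>t\<close>.\<close>

lemma tendsto_0_if_Cauchy: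
  fixes f a :: "real \<Rightarrow> real"
  assumes der: "\<And>t. t > 0 \<Longrightarrow> (f has_real_derivative a t) (at t)"
    and f: "\<And>e. e > 0 \<Longrightarrow> \<exists>t0. \<forall>t\<ge>t0. \<forall>s\<ge>t0. \<bar>f t - f s\<bar> < e"
    and a: "\<And>e. e > 0 \<Longrightarrow> \<exists>t0. \<forall>t\<ge>t0. \<forall>s\<ge>t0. \<bar>a t - a s\<bar> < e"
  shows "(a \<longlongrightarrow> 0) at_top"
proof (rule tendstoI)
  fix e :: real assume "e > 0"
  then have "e / 2 > 0" by simp
  then obtain t0 t1 where t0: "\<And>t s. t \<ge> t0 \<Longrightarrow> s \<ge> t0 \<Longrightarrow> \<bar>f t - f s\<bar> < e / 2"
    and t1: "\<And>t s. t \<ge> t1 \<Longrightarrow> s \<ge> t1 \<Longrightarrow> \<bar>a t - a s\<bar> < e / 2"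
    using f a by meson
  have "dist (a t) 0 < e" if t: "t \<ge> max 1 (max t0 t1)" for t
  proof -
    have "\<exists>z. t < z \<and> z < t + 1 \<and> f (t + 1) - f t = (t + 1 - t) * a z"
      by (rule MVT2) (use t der in auto)
    then obtain z where z: "t < z" "f (t + 1) - f t = a z" by auto
    show ?thesis
      using t0[of "t + 1" t] t1[of t z] z t abs_triangle_ineq[of "a t - a z" "a z"] by (simp add: dist_real_def)
  qed
  then show "\<forall>\<^sub>F t in at_top. dist (a t) 0 < e"
    unfolding eventually_at_top_linorder by blast
qed

section \<open>Regularity of the integrands\<close>

context chart_metric
begin

lemma smooth_div_mat: "smooth_on T U \<Longrightarrow> smooth_on (div_mat G T) U"
  unfolding div_mat_def by (rule smooth_vec) (simp add: smooth_sum smooth_nth smooth_cov)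

lemma smooth_flow_op:
  assumes X: "smooth_on X U"
  shows "smooth_on (flow_op G X) U"
proof -
  have "flow_op G X x = P x *v div_mat G (\<lambda>y. nabla_mat G X y + adj_mat G (nabla_mat G X) y) x" if x: "x \<in> U" for x
    unfolding flow_op_eq[OF X x, symmetric] by (simp add: matrix_vector_mul_assoc PG[OF x])
  moreover have "smooth_on (\<lambda>x. P x *v div_mat G (\<lambda>y. nabla_mat G X y + adj_mat G (nabla_mat G X) y) x) U"
    by (intro smooth_matrix_vector_mult smooth_P smooth_div_mat smooth_add smooth_nabla_mat smooth_adj X)
  ultimately show ?thesis
    by (subst smooth_on_cong) auto
qed

lemma smooth_inner_vec: "smooth_on X U \<Longrightarrow> smooth_on Y U \<Longrightarrow> smooth_on (inner_vec G X Y) U"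
  unfolding inner_vec_eq[abs_def] by (intro smooth_on_inner smooth_matrix_vector_mult smooth_G open_U)

lemma smooth_def_form: "smooth_on X U \<Longrightarrow> smooth_on Y U \<Longrightarrow> smooth_on (def_form X Y) U"
  unfolding def_form_def by (intro smooth_trace smooth_matrix_mult smooth_add smooth_nabla_mat smooth_adj)

lemma inner_vec_nonneg: "x \<in> U \<Longrightarrow> inner_vec G X X x \<ge> 0"
  by (simp add: inner_vec_eq psd_G)

end

lemma has_derivative_inner_vec:
  assumes "\<And>i. ((\<lambda>s. V s x $ i) has_real_derivative V' x $ i) (at t within T)"
    and "\<And>i. ((\<lambda>s. W s x $ i) has_real_derivative W' x $ i) (at t within T)"
  shows "((\<lambda>s. inner_vec G (V s) (W s) x) has_real_derivative
    inner_vec G V' (W t) x + inner_vec G (V t) W' x) (at t within T)"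
proof -
  have "((\<lambda>s. \<Sum>i\<in>UNIV. \<Sum>j\<in>UNIV. G x $ i $ j * V s x $ i * W s x $ j) has_real_derivative
    (\<Sum>i\<in>UNIV. \<Sum>j\<in>UNIV. G x $ i $ j * V' x $ i * W t x $ j + G x $ i $ j * V t x $ i * W' x $ j)) (at t within T)"
    by (intro DERIV_sum) (auto intro!: derivative_eq_intros assms simp: algebra_simps)
  then show ?thesis by (simp add: Defs.inner_vec_def sum.distrib)
qed

lemma continuous_on_inner_vec:
  assumes "continuous_on S G" "\<And>i. continuous_on (T \<times> S) (\<lambda>(s, x). V s x $ i)" "\<And>i. continuous_on (T \<times> S) (\<lambda>(s, x). W s x $ i)"
  shows "continuous_on (T \<times> S) (\<lambda>(s, x). inner_vec G (V s) (W s) x)"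
proof -
  have "continuous_on (T \<times> S) (\<lambda>z. G (snd z))"
    by (rule continuous_on_compose2[OF assms(1) continuous_on_snd[OF continuous_on_id]]) auto
  then have "continuous_on (T \<times> S) (\<lambda>z. G (snd z) $ i $ j)" for i j
    by (intro continuous_on_component)
  then have "continuous_on (T \<times> S) (\<lambda>z. \<Sum>i\<in>UNIV. \<Sum>j\<in>UNIV. G (snd z) $ i $ j * V (fst z) (snd z) $ i * W (fst z) (snd z) $ j)"
    using assms(2,3) unfolding case_prod_beta by (intro continuous_on_sum continuous_on_mult)
  then show ?thesis by (simp add: Defs.inner_vec_def case_prod_beta)
qed

section \<open>The L2 product and the flow operator\<close>

context riemannian_pou
begin

lemma has_derivative_pou_integral:
  assumes der: "\<And>c s x. c \<in> A \<Longrightarrow> s \<in> T \<Longrightarrow> x \<in> chart_img c \<Longrightarrow>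
      ((\<lambda>s. f s c x) has_real_derivative f' s c x) (at s within T)"
    and f: "\<And>c s. c \<in> A \<Longrightarrow> s \<in> T \<Longrightarrow> continuous_on (chart_img c) (f s c)"
    and f': "\<And>c. c \<in> A \<Longrightarrow> continuous_on (T \<times> chart_img c) (\<lambda>(s, x). f' s c x)"
    and t: "t \<in> T" "convex T"
  shows "((\<lambda>s. pou_integral (f s)) has_real_derivative pou_integral (f' t)) (at t within T)"
  unfolding pou_integral_def
proof (rule DERIV_sum)
  fix c assume c: "c \<in> F"
  note cA = F_A[OF c]
  interpret compact_support "chart_img c" "supp c" by (rule support_F[OF c])
  show "((\<lambda>s. LINT x:chart_img c|lborel. cut c c x * f s c x * sqrt (det (g c x))) has_real_derivative
      (LINT x:chart_img c|lborel. cut c c x * f' t c x * sqrt (det (g c x)))) (at t within T)"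
  proof (rule has_derivative_set_integral[OF _ _ _ _ _ t])
    show "((\<lambda>s. cut c c x * f s c x * sqrt (det (g c x))) has_real_derivative
        cut c c x * f' s c x * sqrt (det (g c x))) (at s within T)" if "s \<in> T" "x \<in> chart_img c" for s x
      by (intro DERIV_cmult_right DERIV_cmult der cA that)
    show "continuous_on (chart_img c) (\<lambda>x. cut c c x * f s c x * sqrt (det (g c x)))" if "s \<in> T" for s
      by (intro continuous_on_mult continuous_cut continuous_vol f c cA that)
    have snd: "continuous_on (T \<times> chart_img c) (\<lambda>z. h (snd z))" if "continuous_on (chart_img c) h" for h :: "real^'n \<Rightarrow> real"
      by (rule continuous_on_compose2[OF that continuous_on_snd[OF continuous_on_id]]) auto
    show "continuous_on (T \<times> chart_img c) (\<lambda>(s, x). cut c c x * f' s c x * sqrt (det (g c x)))"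
      using f'[OF cA] unfolding case_prod_beta
      by (intro continuous_on_mult snd continuous_cut continuous_vol c cA)
  qed (simp_all add: cut_zero_supp[OF c])
qed

definition prod_int :: "(('m, 'n) chart \<Rightarrow> real^'n \<Rightarrow> real^'n) \<Rightarrow> (('m, 'n) chart \<Rightarrow> real^'n \<Rightarrow> real^'n) \<Rightarrow> real" where
  "prod_int V W = pou_integral (\<lambda>c. inner_vec (g c) (V c) (W c))"

definition flow_field :: "(('m, 'n) chart \<Rightarrow> real^'n \<Rightarrow> real^'n) \<Rightarrow> ('m, 'n) chart \<Rightarrow> real^'n \<Rightarrow> real^'n" where
  "flow_field V c = flow_op (g c) (V c)"

text \<open>Smoothness in each chart without a transformation law. Linearity and Cauchy-Schwarz are
  stated on this level, so that differences and \<open>flow_field V\<close> are admissible; the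
  divergence theorem asks for \<open>smooth_vector_field\<close>.\<close>

definition smooth_comps :: "(('m, 'n) chart \<Rightarrow> real^'n \<Rightarrow> real^'n) \<Rightarrow> bool" where
  "smooth_comps V \<longleftrightarrow> (\<forall>c\<in>A. smooth_on (V c) (chart_img c))"

lemma smooth_compsD: "smooth_comps V \<Longrightarrow> c \<in> A \<Longrightarrow> smooth_on (V c) (chart_img c)"
  by (simp add: smooth_comps_def)

lemma smooth_vector_field_comps: "smooth_vector_field A V \<Longrightarrow> smooth_comps V"
  by (simp add: smooth_comps_def smooth_vector_field_def)

lemma smooth_comps_flow_field: "smooth_comps V \<Longrightarrow> smooth_comps (flow_field V)"
  by (simp add: smooth_comps_def flow_field_def chart_metric.smooth_flow_op[OF metric_A])

lemma continuous_inner: "smooth_comps V \<Longrightarrow> smooth_comps W \<Longrightarrow> c \<in> A \<Longrightarrow> continuous_on (chart_img c) (inner_vec (g c) (V c) (W c))"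
  by (intro smooth_on_imp_continuous_on chart_metric.smooth_inner_vec[OF metric_A] smooth_compsD)

lemma prod_int_sym: "prod_int V W = prod_int W V"
  unfolding prod_int_def by (rule pou_integral_cong) (rule chart_metric.inner_vec_sym[OF metric_A])

lemma prod_int_diff:
  assumes "smooth_comps V" "smooth_comps W" "smooth_comps W'"
  shows "prod_int V (\<lambda>c x. W c x - W' c x) = prod_int V W - prod_int V W'"
proof -
  have "prod_int V (\<lambda>c x. W c x - W' c x) =
      pou_integral (\<lambda>c x. inner_vec (g c) (V c) (W c) x + (-1) * inner_vec (g c) (V c) (W' c) x)"
    unfolding prod_int_def
    by (rule pou_integral_cong) (simp add: inner_vec_eq matrix_vector_mult_diff_distrib inner_diff_right)
  also have "\<dots> = prod_int V W + pou_integral (\<lambda>c x. (-1) * inner_vec (g c) (V c) (W' c) x)"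
    unfolding prod_int_def
    by (rule pou_integral_add) (intro continuous_intros continuous_inner assms; assumption)+
  finally show ?thesis by (simp only: pou_integral_cmult prod_int_def)
qed

lemma smooth_comps_diff:
  assumes "smooth_comps V" "smooth_comps W"
  shows "smooth_comps (\<lambda>c x. V c x - W c x)"
  unfolding smooth_comps_def
proof
  fix c assume c: "c \<in> A"
  interpret chart_metric "chart_img c" "g c" by (rule metric_A[OF c])
  show "smooth_on (\<lambda>x. V c x - W c x) (chart_img c)" by (intro smooth_diff smooth_compsD assms c)
qed

lemma prod_int_nonneg: "prod_int V V \<ge> 0"
  unfolding prod_int_def by (rule pou_integral_nonneg) (rule chart_metric.inner_vec_nonneg[OF metric_A])

text \<open>The integral of |tV + W|^2 is a nonnegative quadratic polynomial in
  \<open>t\<close>.\<close>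

lemma prod_int_cauchy_schwarz:
  assumes V: "smooth_comps V" and W: "smooth_comps W"
  shows "(prod_int V W)\<^sup>2 \<le> prod_int V V * prod_int W W"
proof (rule quadratic_nonneg_imp_discriminant)
  fix t
  have "0 \<le> pou_integral (\<lambda>c. inner_vec (g c) (\<lambda>x. t *\<^sub>R V c x + W c x) (\<lambda>x. t *\<^sub>R V c x + W c x))"
    by (rule pou_integral_nonneg) (rule chart_metric.inner_vec_nonneg[OF metric_A])
  also have "\<dots> = pou_integral (\<lambda>c x. t\<^sup>2 * inner_vec (g c) (V c) (V c) x +
      (2 * t * inner_vec (g c) (V c) (W c) x + inner_vec (g c) (W c) (W c) x))"
  proof (rule pou_integral_cong)
    fix c x assume c: "c \<in> A" and x: "x \<in> chart_img c"
    have "inner_vec (g c) (W c) (V c) x = inner_vec (g c) (V c) (W c) x"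
      by (rule chart_metric.inner_vec_sym[OF metric_A[OF c] x])
    then show "inner_vec (g c) (\<lambda>x. t *\<^sub>R V c x + W c x) (\<lambda>x. t *\<^sub>R V c x + W c x) x =
      t\<^sup>2 * inner_vec (g c) (V c) (V c) x + (2 * t * inner_vec (g c) (V c) (W c) x + inner_vec (g c) (W c) (W c) x)"
      by (simp add: inner_vec_eq matrix_vector_right_distrib matrix_vector_mult_scaleR inner_add_left inner_add_right
          power2_eq_square algebra_simps)
  qed
  also have "\<dots> = t\<^sup>2 * prod_int V V + (2 * t * prod_int V W + prod_int W W)"
  proof -
    have "pou_integral (\<lambda>c x. 2 * t * inner_vec (g c) (V c) (W c) x + inner_vec (g c) (W c) (W c) x) =
        pou_integral (\<lambda>c x. 2 * t * inner_vec (g c) (V c) (W c) x) + prod_int W W"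
      unfolding prod_int_def by (rule pou_integral_add) (intro continuous_intros continuous_inner V W; assumption)+
    moreover have "pou_integral (\<lambda>c x. t\<^sup>2 * inner_vec (g c) (V c) (V c) x +
      (2 * t * inner_vec (g c) (V c) (W c) x + inner_vec (g c) (W c) (W c) x)) =
      pou_integral (\<lambda>c x. t\<^sup>2 * inner_vec (g c) (V c) (V c) x) +
      pou_integral (\<lambda>c x. 2 * t * inner_vec (g c) (V c) (W c) x + inner_vec (g c) (W c) (W c) x)"
      by (rule pou_integral_add) (intro continuous_intros continuous_inner V W; assumption)+
    ultimately show ?thesis by (simp only: pou_integral_cmult prod_int_def)
  qed
  finally show "0 \<le> prod_int V V * t\<^sup>2 + 2 * prod_int V W * t + prod_int W W"
    by (simp add: mult_ac)
qed

lemma overlap_smooth: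
  assumes "smooth_vector_field A V" "c \<in> A" "d \<in> A"
  shows "smooth_on (V c) (overlap c d)"
proof -
  interpret chart_metric "chart_img c" "g c" by (rule metric_A[OF assms(2)])
  show ?thesis
    using assms transition_overlap(5)[OF chart_A[OF assms(2)] chart_A[OF assms(3)]]
    by (intro smooth_on_subset[OF _ open_U open_overlap[OF chart_A chart_A]])
      (auto simp: smooth_vector_field_def)
qed

text \<open>The transformation law admits this field to the divergence theorem;
  \<open>smooth_vector_field_flux\<close> does the same for the flux.\<close>

lemma smooth_vector_field_def_vec:
  assumes V: "smooth_vector_field A V" and W: "smooth_vector_field A W"
  shows "smooth_vector_field A (\<lambda>c. def_vec (g c) (V c) (W c))"
  unfolding smooth_vector_field_def
proof (intro conjI ballI)
  show "smooth_on (def_vec (g c) (V c) (W c)) (chart_img c)" if c: "c \<in> A" for c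
    by (rule chart_metric.smooth_def_vec[OF metric_A[OF c]]) (use V W c in \<open>auto simp: smooth_vector_field_def\<close>)
  fix c d x assume c: "c \<in> A" and d: "d \<in> A" and x: "x \<in> overlap c d"
  interpret chart_change "overlap c d" "chart_img d" "g c" "g d" "transition c d" by (rule change_A[OF c d])
  have rel: "V d (transition c d y) = J y *v V c y" "W d (transition c d y) = J y *v W c y" if "y \<in> overlap c d" for y
    using V W c d that by (auto simp: smooth_vector_field_def J_mult)
  have "smooth_on (V d) (chart_img d)" using V d by (simp add: smooth_vector_field_def)
  then have "def_vec (g d) (V d) (W d) (transition c d x) = J x *v def_vec (g c) (V c) (W c) x"
    by (intro def_vec_transform overlap_smooth[OF V c d] rel x)
  then show "def_vec (g d) (V d) (W d) (transition c d x) =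
      frechet_derivative (transition c d) (at x) (def_vec (g c) (V c) (W c) x)"
    by (simp add: J_mult[OF x])
qed

definition grad_R :: "('m, 'n) chart \<Rightarrow> real^'n \<Rightarrow> real^'n" where
  "grad_R c = grad (g c) (scalar_curvature (g c))"

lemma smooth_vector_field_grad_R: "smooth_vector_field A grad_R"
  unfolding smooth_vector_field_def
proof (intro conjI ballI)
  show "smooth_on (grad_R c) (chart_img c)" if c: "c \<in> A" for c
  proof -
    interpret chart_metric "chart_img c" "g c" by (rule metric_A[OF c])
    show ?thesis unfolding grad_R_def by (intro smooth_grad smooth_scalar_curvature)
  qed
  fix c d x assume c: "c \<in> A" and d: "d \<in> A" and x: "x \<in> overlap c d"
  interpret chart_change "overlap c d" "chart_img d" "g c" "g d" "transition c d" by (rule change_A[OF c d])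
  show "grad_R d (transition c d x) = frechet_derivative (transition c d) (at x) (grad_R c x)"
    unfolding grad_R_def J_mult[OF x, symmetric]
    by (rule grad_transform[OF B.smooth_scalar_curvature scalar_curvature_transform x])
qed

lemma smooth_vector_field_flux:
  assumes V: "smooth_vector_field A V"
  shows "smooth_vector_field A (\<lambda>c. chart_metric.flux (g c) (V c))"
  unfolding smooth_vector_field_def
proof (intro conjI ballI)
  show "smooth_on (chart_metric.flux (g c) (V c)) (chart_img c)" if c: "c \<in> A" for c
    by (rule chart_metric.smooth_flux[OF metric_A[OF c]]) (use V c in \<open>simp add: smooth_vector_field_def\<close>)
  fix c d x assume c: "c \<in> A" and d: "d \<in> A" and x: "x \<in> overlap c d"
  interpret chart_change "overlap c d" "chart_img d" "g c" "g d" "transition c d" by (rule change_A[OF c d])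
  have "V d (transition c d x) = J x *v V c x"
    using V c d x by (simp add: smooth_vector_field_def J_mult)
  then show "B.flux (V d) (transition c d x) = frechet_derivative (transition c d) (at x) (A.flux (V c) x)"
    unfolding J_mult[OF x, symmetric] by (rule flux_transform[OF _ x])
qed

lemma prod_int_flow_field:
  assumes V: "smooth_vector_field A V" and W: "smooth_vector_field A W"
  shows "prod_int (flow_field V) W = - pou_integral (\<lambda>c. chart_metric.def_form (g c) (V c) (W c))"
proof -
  note sV = smooth_vector_field_comps[OF V] and sW = smooth_vector_field_comps[OF W]
  have "0 = pou_integral (\<lambda>c. divergence (g c) (def_vec (g c) (V c) (W c)))"
    by (rule pou_integral_divergence[OF smooth_vector_field_def_vec[OF V W], symmetric])
  also have "\<dots> = pou_integral (\<lambda>c x. inner_vec (g c) (flow_field V c) (W c) x + chart_metric.def_form (g c) (V c) (W c) x)"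
    unfolding flow_field_def
    by (rule pou_integral_cong)
      (intro chart_metric.divergence_def_vec[OF metric_A] smooth_compsD sV sW; assumption)
  also have "\<dots> = prod_int (flow_field V) W + pou_integral (\<lambda>c. chart_metric.def_form (g c) (V c) (W c))"
    unfolding prod_int_def
  proof (rule pou_integral_add)
    show "continuous_on (chart_img c) (inner_vec (g c) (flow_field V c) (W c))" if "c \<in> A" for c
      by (intro continuous_inner smooth_comps_flow_field sV sW that)
    show "continuous_on (chart_img c) (chart_metric.def_form (g c) (V c) (W c))" if c: "c \<in> A" for c
      by (intro smooth_on_imp_continuous_on chart_metric.smooth_def_form[OF metric_A[OF c]] smooth_compsD sV sW c)
  qed
  finally show ?thesis by simp
qed

lemma prod_int_flow_field_sym:
  assumes V: "smooth_vector_field A V" and W: "smooth_vector_field A W"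
  shows "prod_int (flow_field V) W = prod_int V (flow_field W)"
proof -
  have "pou_integral (\<lambda>c. chart_metric.def_form (g c) (V c) (W c)) =
      pou_integral (\<lambda>c. chart_metric.def_form (g c) (W c) (V c))"
    by (rule pou_integral_cong) (rule chart_metric.def_form_sym[OF metric_A])
  then show ?thesis
    using prod_int_flow_field[OF V W] prod_int_flow_field[OF W V] prod_int_sym[of V] by simp
qed

lemma prod_int_flow_field_nonpos:
  assumes V: "smooth_vector_field A V"
  shows "prod_int (flow_field V) V \<le> 0"
proof -
  have "pou_integral (\<lambda>c. chart_metric.def_form (g c) (V c) (V c)) \<ge> 0"
    by (rule pou_integral_nonneg) (rule chart_metric.def_form_nonneg[OF metric_A])
  then show ?thesis using prod_int_flow_field[OF V V] by simp
qed

text \<open>Pointwise the two sides differ by the divergence of \<open>flux\<close>, which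
  integrates to 0.\<close>

lemma prod_int_flow_field_grad_R:
  assumes V: "smooth_vector_field A V"
  shows "prod_int (flow_field grad_R) V =
    2 * pou_integral (\<lambda>c x. (- laplace_fun (g c) (scalar_curvature (g c)) x + (scalar_curvature (g c) x)\<^sup>2 / 4)
        * divergence (g c) (V c) x)
    - 2 * pou_integral (\<lambda>c x. scalar_curvature (g c) x * inner_tensor (g c) (ricci (g c)) (Def (g c) (V c)) x)"
proof -
  note sV = smooth_compsD[OF smooth_vector_field_comps[OF V]]
  define a where "a c x = (- laplace_fun (g c) (scalar_curvature (g c)) x + (scalar_curvature (g c) x)\<^sup>2 / 4)
        * divergence (g c) (V c) x" for c x
  define b where "b c x = scalar_curvature (g c) x * inner_tensor (g c) (ricci (g c)) (Def (g c) (V c)) x" for c x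
  have ca: "continuous_on (chart_img c) (a c)" if c: "c \<in> A" for c
  proof -
    interpret chart_metric "chart_img c" "g c" by (rule metric_A[OF c])
    show ?thesis
      unfolding a_def
      by (intro continuous_intros smooth_on_imp_continuous_on smooth_laplace_fun smooth_scalar_curvature
          smooth_divergence sV c) auto
  qed
  have cb: "continuous_on (chart_img c) (b c)" if c: "c \<in> A" for c
  proof -
    interpret chart_metric "chart_img c" "g c" by (rule metric_A[OF c])
    have "smooth_on (\<lambda>x. scalar_curvature (g c) x * trace (ricci_end (g c) x ** nabla_mat (g c) (V c) x)) (chart_img c)"
      by (intro smooth_mult smooth_scalar_curvature smooth_trace smooth_matrix_mult smooth_ricci_end smooth_nabla_mat sV c)
    then show ?thesis
      by (intro smooth_on_imp_continuous_on)
        (subst smooth_on_cong[where h = "\<lambda>x. scalar_curvature (g c) x * trace (ricci_end (g c) x ** nabla_mat (g c) (V c) x)"],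
          auto simp: b_def inner_ricci_Def[OF sV[OF c]])
  qed
  have cf: "continuous_on (chart_img c) (divergence (g c) (chart_metric.flux (g c) (V c)))" if c: "c \<in> A" for c
  proof -
    interpret chart_metric "chart_img c" "g c" by (rule metric_A[OF c])
    show ?thesis by (intro smooth_on_imp_continuous_on smooth_divergence smooth_flux sV c)
  qed
  have "prod_int (flow_field grad_R) V =
      pou_integral (\<lambda>c x. 2 * a c x + ((-2) * b c x + divergence (g c) (chart_metric.flux (g c) (V c)) x))"
    unfolding prod_int_def
  proof (rule pou_integral_cong)
    fix c x assume c: "c \<in> A" and x: "x \<in> chart_img c"
    interpret chart_metric "chart_img c" "g c" by (rule metric_A[OF c])
    show "inner_vec (g c) (flow_field grad_R c) (V c) x = 2 * a c x + ((-2) * b c x + divergence (g c) (flux (V c)) x)"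
      unfolding flow_field_def grad_R_def using inner_flow_op_grad_scalar_curvature[OF sV[OF c] x]
      by (simp add: a_def b_def)
  qed
  also have "\<dots> = pou_integral (\<lambda>c x. 2 * a c x) +
      pou_integral (\<lambda>c x. (-2) * b c x + divergence (g c) (chart_metric.flux (g c) (V c)) x)"
    by (rule pou_integral_add) (intro continuous_intros ca cb cf; assumption)+
  also have "pou_integral (\<lambda>c x. (-2) * b c x + divergence (g c) (chart_metric.flux (g c) (V c)) x) =
      pou_integral (\<lambda>c x. (-2) * b c x) + pou_integral (\<lambda>c. divergence (g c) (chart_metric.flux (g c) (V c)))"
    by (rule pou_integral_add) (intro continuous_intros cb cf; assumption)+
  also have "pou_integral (\<lambda>c. divergence (g c) (chart_metric.flux (g c) (V c))) = 0"
    by (rule pou_integral_divergence[OF smooth_vector_field_flux[OF V]])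
  finally show ?thesis
    unfolding pou_integral_cmult a_def b_def by simp
qed

end

text \<open>The flow equation gives time derivatives for each \<open>x\<close> separately.
  Identifying them with a partial derivative of the jointly smooth map yields continuity in (t, x)
  up to t = 0, as differentiation under the integral requires.\<close>

lemma smooth_on_Ici_times_derivative:
  fixes h :: "real \<Rightarrow> 'a::euclidean_space \<Rightarrow> real^'n::finite"
  assumes sm: "smooth_on (\<lambda>(t, x). h t x) ({0..} \<times> S)"
    and der: "\<And>t x i. t \<ge> 0 \<Longrightarrow> x \<in> S \<Longrightarrow> ((\<lambda>s. h s x $ i) has_real_derivative h' t x $ i) (at t within {0..})"
  shows "continuous_on ({0..} \<times> S) (\<lambda>(t, x). h' t x $ i)"
proof -
  let ?S = "{0..} \<times> S" and ?h = "\<lambda>(t, x). h t x"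
  have C1: "Ck_on (Suc 0) ?h ?S" using smooth_onD[OF sm] by blast
  then have diff: "?h differentiable_on ?S"
    and cont: "continuous_on ?S (\<lambda>z. frechet_derivative ?h (at z within ?S) (1, 0))"
    by (auto simp: Basis_prod_def)
  have "h' t x $ i = frechet_derivative ?h (at (t, x) within ?S) (1, 0) $ i" if t: "t \<ge> 0" and x: "x \<in> S" for t x
  proof -
    let ?D = "frechet_derivative ?h (at (t, x) within ?S)"
    have D: "(?h has_derivative ?D) (at (t, x) within ?S)"
      using diff t x by (auto simp: differentiable_on_def frechet_derivative_works)
    have "((\<lambda>s. (s, x)) has_derivative (\<lambda>v. (v, 0))) (at t within {0..})"
      by (auto intro!: derivative_eq_intros)
    moreover have "(?h has_derivative ?D) (at (t, x) within (\<lambda>s. (s, x)) ` {0..})"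
      by (rule has_derivative_subset[OF D]) (use x in auto)
    ultimately have "((\<lambda>s. h s x) has_derivative (\<lambda>v. ?D (v, 0))) (at t within {0..})"
      using diff_chain_within[of "\<lambda>s. (s, x)" "\<lambda>v. (v, 0)" t "{0..}" ?h ?D] by (simp add: o_def)
    then have hi: "((\<lambda>s. h s x $ i) has_derivative (\<lambda>v. ?D (v, 0) $ i)) (at t within {0..})"
      by (rule bounded_linear.has_derivative[OF bounded_linear_vec_nth])
    have lin: "?D (v, 0) = v *\<^sub>R ?D (1, 0)" for v
    proof -
      have "?D (v *\<^sub>R (1, 0)) = v *\<^sub>R ?D (1, 0)"
        using has_derivative_linear[OF D] by (rule linear_cmul)
      then show ?thesis by simp
    qed
    have "(\<lambda>v. ?D (v, 0) $ i) = (*) (?D (1, 0) $ i)"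
    proof
      show "?D (v, 0) $ i = ?D (1, 0) $ i * v" for v by (simp add: lin[of v])
    qed
    then have "((\<lambda>s. h s x $ i) has_real_derivative ?D (1, 0) $ i) (at t within {0..})"
      using hi by (simp only: has_field_derivative_def)
    \<comment> \<open>Uniqueness of the derivative within the half line rests on \<open>t\<close>
      being a limit point of it, also for t = 0.\<close>
    moreover have "at t within {0..} \<noteq> bot"
    proof -
      have "t islimpt {t..}" using islimpt_Icc[of t "t + 1" t] islimpt_subset[of t "{t..t+1}" "{t..}"] by auto
      then have "t islimpt {0..}" by (rule islimpt_subset) (use t in auto)
      then show ?thesis by (simp add: trivial_limit_within)
    qed
    ultimately show ?thesis
      using der[OF t x, of i] vector_derivative_unique_within[of t "{0..}" "\<lambda>s. h s x $ i"]
      by (simp add: has_real_derivative_iff_has_vector_derivative)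
  qed
  then have "continuous_on ?S (\<lambda>(t, x). h' t x $ i) \<longleftrightarrow>
      continuous_on ?S (\<lambda>z. frechet_derivative ?h (at z within ?S) (1, 0) $ i)"
    by (intro continuous_on_cong) auto
  then show ?thesis using continuous_on_component[OF cont] by blast
qed

text \<open>Existence ensures that \<open>SOME\<close> returns a genuine partition of unity. The
  choice depends only on \<open>M\<close> and \<open>A\<close>, so one partition serves all
  integrands.\<close>

lemma manifold_integral_eq_pou_integral:
  assumes "closed_riemannian_manifold M A g"
  obtains F \<rho> where "riemannian_pou M A g F \<rho>"
    "\<And>f. manifold_integral M A g f = riemannian_pou.pou_integral g F \<rho> f"
proof -
  define p where "p = (SOME (F, \<rho>). partition_of_unity M A F \<rho>)"
  have "\<exists>p. case p of (F, \<rho>) \<Rightarrow> partition_of_unity M A F \<rho>"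
    using partition_of_unity_exists[of M A] assms by (auto simp: closed_riemannian_manifold_def)
  then have "case p of (F, \<rho>) \<Rightarrow> partition_of_unity M A F \<rho>"
    unfolding p_def by (rule someI_ex)
  then obtain F \<rho> where p: "p = (F, \<rho>)" "partition_of_unity M A F \<rho>" by auto
  interpret riemannian_pou M A g F \<rho> by unfold_locales (rule assms p(2))+
  have "manifold_integral M A g f = pou_integral f" for f
    unfolding manifold_integral_def p_def[symmetric] p(1) by (simp add: pou_integral_def cut_def)
  then show thesis using that riemannian_pou_axioms by blast
qed

section \<open>Evolution along the flow\<close>

locale flow = riemannian_pou M A g F \<rho>
  for M :: "'m topology" and A :: "('m, 'n::finite) chart set" and g F \<rho> +
  fixes X0 and X :: "real \<Rightarrow> ('m, 'n) chart \<Rightarrow> real^'n \<Rightarrow> real^'n"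
  assumes flow: "flow_solution A g X0 X"
begin

lemma smooth_X: "t \<ge> 0 \<Longrightarrow> smooth_vector_field A (X t)"
  using flow by (simp add: flow_solution_def smooth_vector_field_family_def)

lemmas comps_X = smooth_vector_field_comps[OF smooth_X]

lemma X_derivative:
  assumes "t \<ge> 0" "c \<in> A" "x \<in> chart_img c"
  shows "((\<lambda>s. X s c x $ i) has_real_derivative flow_field (X t) c x $ i) (at t within {0..})"
  using flow assms by (simp add: flow_solution_def flow_field_def flow_op_def)

lemma X_smooth_joint: "c \<in> A \<Longrightarrow> smooth_on (\<lambda>(t, x). X t c x) ({0..} \<times> chart_img c)"
  using flow by (simp add: flow_solution_def smooth_vector_field_family_def)

lemma X_continuous:
  assumes "c \<in> A"
  shows "continuous_on ({0..} \<times> chart_img c) (\<lambda>(t, x). X t c x $ i)"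
  using continuous_on_component[OF smooth_on_imp_continuous_on[OF X_smooth_joint[OF assms]], of i]
  by (simp add: case_prod_beta)

lemma flow_field_continuous:
  assumes "c \<in> A"
  shows "continuous_on ({0..} \<times> chart_img c) (\<lambda>(t, x). flow_field (X t) c x $ i)"
  by (rule smooth_on_Ici_times_derivative[OF X_smooth_joint[OF assms]]) (rule X_derivative[OF _ assms])

text \<open>The time set \<open>T\<close> is left general because two are used: the half line, and
  the interval from 0 to t + s on which one argument runs backwards.\<close>

lemma prod_int_derivative:
  assumes T: "t \<in> T" "convex T"
    and V: "\<And>s. s \<in> T \<Longrightarrow> smooth_comps (V s)" and W: "\<And>s. s \<in> T \<Longrightarrow> smooth_comps (W s)"
    and dV: "\<And>s c x i. s \<in> T \<Longrightarrow> c \<in> A \<Longrightarrow> x \<in> chart_img c \<Longrightarrow>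
        ((\<lambda>s. V s c x $ i) has_real_derivative V' s c x $ i) (at s within T)"
    and dW: "\<And>s c x i. s \<in> T \<Longrightarrow> c \<in> A \<Longrightarrow> x \<in> chart_img c \<Longrightarrow>
        ((\<lambda>s. W s c x $ i) has_real_derivative W' s c x $ i) (at s within T)"
    and V': "smooth_comps (V' t)" and W': "smooth_comps (W' t)"
    and cont: "\<And>c i. c \<in> A \<Longrightarrow> continuous_on (T \<times> chart_img c) (\<lambda>(s, x). V s c x $ i)"
      "\<And>c i. c \<in> A \<Longrightarrow> continuous_on (T \<times> chart_img c) (\<lambda>(s, x). W s c x $ i)"
      "\<And>c i. c \<in> A \<Longrightarrow> continuous_on (T \<times> chart_img c) (\<lambda>(s, x). V' s c x $ i)"
      "\<And>c i. c \<in> A \<Longrightarrow> continuous_on (T \<times> chart_img c) (\<lambda>(s, x). W' s c x $ i)"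
  shows "((\<lambda>s. prod_int (V s) (W s)) has_real_derivative prod_int (V' t) (W t) + prod_int (V t) (W' t)) (at t within T)"
proof -
  have gc: "continuous_on (chart_img c) (g c)" if "c \<in> A" for c
    by (rule smooth_on_imp_continuous_on[OF chart_metric.smooth_G[OF metric_A[OF that]]])
  have "((\<lambda>s. pou_integral (\<lambda>c. inner_vec (g c) (V s c) (W s c))) has_real_derivative
      pou_integral (\<lambda>c x. inner_vec (g c) (V' t c) (W t c) x + inner_vec (g c) (V t c) (W' t c) x)) (at t within T)"
  proof (rule has_derivative_pou_integral[where f' = "\<lambda>s c x. inner_vec (g c) (V' s c) (W s c) x + inner_vec (g c) (V s c) (W' s c) x", OF _ _ _ T])
    show "((\<lambda>s. inner_vec (g c) (V s c) (W s c) x) has_real_derivative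
        inner_vec (g c) (V' s c) (W s c) x + inner_vec (g c) (V s c) (W' s c) x) (at s within T)"
      if "c \<in> A" "s \<in> T" "x \<in> chart_img c" for c s x
      by (rule has_derivative_inner_vec[where V = "\<lambda>s. V s c" and W = "\<lambda>s. W s c"]) (rule dV dW that)+
    show "continuous_on (chart_img c) (inner_vec (g c) (V s c) (W s c))" if "c \<in> A" "s \<in> T" for c s
      by (rule continuous_inner) (use V W that in auto)
    show "continuous_on (T \<times> chart_img c) (\<lambda>(s, x). inner_vec (g c) (V' s c) (W s c) x + inner_vec (g c) (V s c) (W' s c) x)"
      if c: "c \<in> A" for c
      using continuous_on_add[OF
          continuous_on_inner_vec[where V = "\<lambda>s. V' s c" and W = "\<lambda>s. W s c", OF gc[OF c] cont(3)[OF c] cont(2)[OF c]]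
          continuous_on_inner_vec[where V = "\<lambda>s. V s c" and W = "\<lambda>s. W' s c", OF gc[OF c] cont(1)[OF c] cont(4)[OF c]]]
      by (simp add: case_prod_beta)
  qed
  also have "pou_integral (\<lambda>c x. inner_vec (g c) (V' t c) (W t c) x + inner_vec (g c) (V t c) (W' t c) x) =
      prod_int (V' t) (W t) + prod_int (V t) (W' t)"
    unfolding prod_int_def
    by (rule pou_integral_add) (intro continuous_inner V W V' W' T(1); assumption)+
  finally show ?thesis unfolding prod_int_def .
qed

text \<open>Symmetry moves the flow operator to the fixed field \<open>V\<close>, so the derivative
  is again a pairing of \<open>X t\<close> with a fixed field. The limit argument depends on this
  form.\<close>

lemma prod_int_fixed_derivative:
  assumes V: "smooth_vector_field A V" and t: "t \<ge> 0"
  shows "((\<lambda>s. prod_int V (X s)) has_real_derivative prod_int (flow_field V) (X t)) (at t within {0..})"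
proof -
  have cV: "continuous_on ({0..} \<times> chart_img c) (\<lambda>(s, x). V c x $ i)" if "c \<in> A" for c i
    unfolding case_prod_beta
    by (rule continuous_on_compose2[OF continuous_on_component[OF smooth_on_imp_continuous_on[OF smooth_compsD[OF smooth_vector_field_comps[OF V] that]]]
          continuous_on_snd[OF continuous_on_id]]) auto
  have z: "smooth_comps (\<lambda>c x. 0)"
    unfolding smooth_comps_def
  proof
    fix c assume "c \<in> A"
    then interpret one_chart M c by unfold_locales (rule chart_A)
    show "smooth_on (\<lambda>x. 0 :: real^'n) (chart_img c)" by (rule smooth_on_const[OF open_img])
  qed
  have "((\<lambda>s. prod_int V (X s)) has_real_derivative prod_int (\<lambda>c x. 0) (X t) + prod_int V (flow_field (X t))) (at t within {0..})"
    by (rule prod_int_derivative[where V = "\<lambda>s. V" and V' = "\<lambda>s c x. 0" and W = X and W' = "\<lambda>s. flow_field (X s)"])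
      (use t in \<open>auto intro!: cV z smooth_vector_field_comps[OF V] comps_X X_derivative X_continuous
        flow_field_continuous smooth_comps_flow_field\<close>)
  moreover have "prod_int (\<lambda>c x. 0) (X t) = 0"
    using prod_int_diff[OF comps_X[OF t] z z] by (simp add: prod_int_sym[of _ "X t"])
  ultimately show ?thesis by (simp add: prod_int_flow_field_sym[OF V smooth_X[OF t]])
qed

lemma energy_derivative:
  assumes t: "t \<ge> 0"
  shows "((\<lambda>s. prod_int (X s) (X s)) has_real_derivative 2 * prod_int (flow_field (X t)) (X t)) (at t within {0..})"
proof -
  have "((\<lambda>s. prod_int (X s) (X s)) has_real_derivative
      prod_int (flow_field (X t)) (X t) + prod_int (X t) (flow_field (X t))) (at t within {0..})"
    by (rule prod_int_derivative[where V' = "\<lambda>s. flow_field (X s)" and W' = "\<lambda>s. flow_field (X s)"])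
      (use t in \<open>auto intro!: comps_X X_derivative X_continuous flow_field_continuous smooth_comps_flow_field\<close>)
  then show ?thesis by (simp add: prod_int_sym[of "X t"])
qed

lemma at_within_Ici: "(t::real) > 0 \<Longrightarrow> at t within {0..} = at t"
  by (rule at_within_interior) simp

lemma energy_antimono:
  assumes "0 \<le> s" "s \<le> t"
  shows "prod_int (X t) (X t) \<le> prod_int (X s) (X s)"
proof (cases "s = t")
  case False
  let ?\<phi> = "\<lambda>s. prod_int (X s) (X s)"
  show ?thesis
  proof (rule DERIV_nonpos_imp_decreasing_open[of s t ?\<phi>])
    show "\<exists>y. (?\<phi> has_real_derivative y) (at x) \<and> y \<le> 0" if "s < x" "x < t" for x
      using energy_derivative[of x] prod_int_flow_field_nonpos[OF smooth_X, of x] at_within_Ici[of x] that assms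
      by (intro exI[of _ "2 * prod_int (flow_field (X x)) (X x)"]) auto
    have "continuous_on {0..} ?\<phi>"
      using energy_derivative by (intro DERIV_continuous_on) auto
    then show "continuous_on {s..t} ?\<phi>" by (rule continuous_on_subset) (use assms in auto)
  qed (use assms False in auto)
qed simp

text \<open>Since the flow operator is symmetric, the inner product of \<open>X u\<close> and \<open>X (t + s - u)\<close> is constant in \<open>u\<close>.\<close>

lemma prod_int_midpoint:
  assumes ts: "t \<ge> 0" "s \<ge> 0"
  shows "prod_int (X t) (X s) = prod_int (X ((t + s) / 2)) (X ((t + s) / 2))"
proof -
  let ?T = "{0..t + s}"
  \<comment> \<open>The reflection of the time interval produces the minus sign by which the two
    terms of the product rule will cancel.\<close>
  have rX: "((\<lambda>u. X (t + s - u) c x $ i) has_real_derivative - flow_field (X (t + s - u)) c x $ i) (at u within ?T)"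
    if u: "u \<in> ?T" and c: "c \<in> A" and x: "x \<in> chart_img c" for u c x i
  proof -
    have "((\<lambda>v. X v c x $ i) has_real_derivative flow_field (X (t + s - u)) c x $ i) (at (t + s - u) within (\<lambda>u. t + s - u) ` ?T)"
      using X_derivative[OF _ c x, of "t + s - u"] by (rule has_field_derivative_subset) (use u in auto)
    moreover have "((\<lambda>u. t + s - u) has_real_derivative - 1) (at u within ?T)"
      by (auto intro!: derivative_eq_intros)
    ultimately show ?thesis
      using DERIV_image_chain[of "\<lambda>v. X v c x $ i" "flow_field (X (t + s - u)) c x $ i" "\<lambda>u. t + s - u" u ?T "- 1"]
      by (simp add: o_def)
  qed
  have fX: "((\<lambda>u. X u c x $ i) has_real_derivative flow_field (X u) c x $ i) (at u within ?T)"
    if "u \<in> ?T" "c \<in> A" "x \<in> chart_img c" for u c x i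
    using X_derivative[OF _ that(2,3), of u] by (rule has_field_derivative_subset) (use that in auto)
  have refl: "continuous_on (?T \<times> S) (\<lambda>(u, x). h (t + s - u) x)"
    if "continuous_on ({0..} \<times> S) (\<lambda>(u, x). h u x)" for h :: "real \<Rightarrow> real^'n \<Rightarrow> real" and S
    using continuous_on_compose2[OF that, of "?T \<times> S" "\<lambda>z. (t + s - fst z, snd z)"]
    by (force intro!: continuous_intros simp: case_prod_beta)
  have sub: "continuous_on (?T \<times> S) (\<lambda>(u, x). h u x)"
    if "continuous_on ({0..} \<times> S) (\<lambda>(u, x). h u x)" for h :: "real \<Rightarrow> real^'n \<Rightarrow> real" and S
    by (rule continuous_on_subset[OF that]) auto
  have "((\<lambda>u. prod_int (X u) (X (t + s - u))) has_real_derivative 0) (at u within ?T)" if u: "u \<in> ?T" for u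
  proof -
    have sL: "smooth_comps (\<lambda>c x. - flow_field (X (t + s - u)) c x)"
      unfolding smooth_comps_def
    proof
      fix c assume c: "c \<in> A"
      interpret chart_metric "chart_img c" "g c" by (rule metric_A[OF c])
      show "smooth_on (\<lambda>x. - flow_field (X (t + s - u)) c x) (chart_img c)"
        by (intro smooth_minus smooth_compsD smooth_comps_flow_field comps_X c) (use u in simp)
    qed
    have "((\<lambda>u. prod_int (X u) (X (t + s - u))) has_real_derivative
      prod_int (flow_field (X u)) (X (t + s - u)) + prod_int (X u) (\<lambda>c x. - flow_field (X (t + s - u)) c x)) (at u within ?T)"
    proof (rule prod_int_derivative[where V' = "\<lambda>u. flow_field (X u)" and W = "\<lambda>u. X (t + s - u)"
          and W' = "\<lambda>u c x. - flow_field (X (t + s - u)) c x"])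
      show "continuous_on (?T \<times> chart_img c) (\<lambda>(u, x). X u c x $ i)"
        "continuous_on (?T \<times> chart_img c) (\<lambda>(u, x). flow_field (X u) c x $ i)"
        "continuous_on (?T \<times> chart_img c) (\<lambda>(u, x). X (t + s - u) c x $ i)" if "c \<in> A" for c i
        by (rule sub[where h = "\<lambda>u x. X u c x $ i"] sub[where h = "\<lambda>u x. flow_field (X u) c x $ i"]
            refl[where h = "\<lambda>u x. X u c x $ i"], intro X_continuous flow_field_continuous that)+
      show "continuous_on (?T \<times> chart_img c) (\<lambda>(u, x). (- flow_field (X (t + s - u)) c x) $ i)" if "c \<in> A" for c i
        using continuous_on_minus[OF refl[where h = "\<lambda>u x. flow_field (X u) c x $ i", OF flow_field_continuous[OF that, of i]]]
        by (simp add: case_prod_beta)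
    qed (use u in \<open>auto intro!: comps_X fX rX sL smooth_comps_flow_field\<close>)
    moreover have "prod_int (X u) (\<lambda>c x. - flow_field (X (t + s - u)) c x) = - prod_int (X u) (flow_field (X (t + s - u)))"
    proof -
      have "(\<lambda>c. inner_vec (g c) (X u c) (\<lambda>x. - flow_field (X (t + s - u)) c x)) =
          (\<lambda>c x. (-1) * inner_vec (g c) (X u c) (flow_field (X (t + s - u)) c) x)"
        by (intro ext) (simp add: Defs.inner_vec_def sum_negf)
      then show ?thesis by (simp only: prod_int_def pou_integral_cmult)
    qed
    ultimately show ?thesis
      using prod_int_flow_field_sym[OF smooth_X smooth_X, of u "t + s - u"] u by simp
  qed
  then obtain k where "\<And>u. u \<in> ?T \<Longrightarrow> prod_int (X u) (X (t + s - u)) = k"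
    using has_field_derivative_zero_constant[of ?T "\<lambda>u. prod_int (X u) (X (t + s - u))"] by auto
  \<comment> \<open>At u = t the constant is the product of \<open>X t\<close> and
    \<open>X s\<close>; at the midpoint both arguments coincide.\<close>
  from this[of t] this[of "(t + s) / 2"] show ?thesis
    using ts by (simp add: field_simps)
qed

text \<open>Cauchy-Schwarz transfers the L2 Cauchy property of the flow to its pairing with any
  fixed field.\<close>

lemma prod_int_Cauchy:
  assumes V: "smooth_comps V" and e: "e > 0"
  shows "\<exists>t0. \<forall>t\<ge>t0. \<forall>s\<ge>t0. \<bar>prod_int V (X t) - prod_int V (X s)\<bar> < e"
proof -
  let ?\<phi> = "\<lambda>t. prod_int (X t) (X t)"
  define m where "m = Inf (?\<phi> ` {0..})"
  \<comment> \<open>The summand 1 keeps \<open>q\<close> positive when \<open>V\<close> has norm 0;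
    \<open>d\<close> is then chosen so that q times 2d is e^2.\<close>
  define q where "q = prod_int V V + 1"
  have q: "q > 0" using prod_int_nonneg[of V] by (simp add: q_def)
  define d where "d = e\<^sup>2 / (2 * q)"
  have d: "d > 0" using e q by (simp add: d_def)
  have bdd: "bdd_below (?\<phi> ` {0..})" by (rule bdd_belowI[of _ 0]) (auto simp: prod_int_nonneg)
  have m: "m \<le> ?\<phi> t" if "t \<ge> 0" for t unfolding m_def by (rule cInf_lower[OF _ bdd]) (use that in auto)
  \<comment> \<open>From \<open>t0\<close> on the energy is within \<open>d\<close> of its infimum
    \<open>m\<close>, while at the midpoint it is at least \<open>m\<close>; hence squared distances
    stay below 2d.\<close>
  obtain t0 where t0: "t0 \<ge> 0" "?\<phi> t0 < m + d"
    using cInf_lessD[of "?\<phi> ` {0..}" "m + d"] d by (auto simp: m_def)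
  have "\<bar>prod_int V (X t) - prod_int V (X s)\<bar> < e" if ts: "t \<ge> t0" "s \<ge> t0" for t s
  proof -
    have pos: "t \<ge> 0" "s \<ge> 0" using ts t0 by auto
    let ?D = "\<lambda>c x. X t c x - X s c x"
    have sD: "smooth_comps ?D" by (intro smooth_comps_diff comps_X pos)
    have "prod_int ?D ?D = prod_int ?D (X t) - prod_int ?D (X s)"
      by (rule prod_int_diff) (intro sD comps_X pos)+
    also have "\<dots> = ?\<phi> t + ?\<phi> s - 2 * prod_int (X t) (X s)"
      using prod_int_diff[OF comps_X[OF pos(1)] comps_X[OF pos(1)] comps_X[OF pos(2)]]
        prod_int_diff[OF comps_X[OF pos(2)] comps_X[OF pos(1)] comps_X[OF pos(2)]]
      by (simp add: prod_int_sym[of ?D] prod_int_sym[of "X s" "X t"])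
    also have "\<dots> < 2 * d"
      using energy_antimono[OF t0(1) ts(1)] energy_antimono[OF t0(1) ts(2)] t0(2) m[of "(t + s) / 2"] pos
        prod_int_midpoint[OF pos] by simp
    finally have D: "prod_int ?D ?D < 2 * d" .
    have "(prod_int V (X t) - prod_int V (X s))\<^sup>2 = (prod_int V ?D)\<^sup>2"
      by (simp add: prod_int_diff V comps_X pos)
    also have "\<dots> \<le> prod_int V V * prod_int ?D ?D" by (rule prod_int_cauchy_schwarz[OF V sD])
    also have "\<dots> \<le> prod_int V V * (2 * d)" using D prod_int_nonneg[of V] by (intro mult_left_mono) auto
    also have "\<dots> < q * (2 * d)" using d by (intro mult_strict_right_mono) (auto simp: q_def)
    also have "\<dots> = e\<^sup>2" using q by (simp add: d_def)
    finally have "\<bar>prod_int V (X t) - prod_int V (X s)\<bar>\<^sup>2 < e\<^sup>2" by simp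
    then show ?thesis by (rule power2_less_imp_less) (use e in simp)
  qed
  then show ?thesis by blast
qed

end

theorem proposition1p14:
  fixes M :: "'m topology"
    and A :: "('m, 'n::finite) chart set"
    and g :: "('m, 'n) chart \<Rightarrow> real^'n \<Rightarrow> real^'n^'n"
    and X0 :: "('m, 'n) chart \<Rightarrow> real^'n \<Rightarrow> real^'n"
    and X :: "real \<Rightarrow> ('m, 'n) chart \<Rightarrow> real^'n \<Rightarrow> real^'n"
  assumes "closed_riemannian_manifold M A g"
    and "smooth_vector_field A X0"
    and "flow_solution A g X0 X"
  shows "(\<forall>t\<ge>0. ((\<lambda>s. I_functional M A g (X s)) has_real_derivative
            (2 * manifold_integral M A g
                   (\<lambda>c x. (- laplace_fun (g c) (scalar_curvature (g c)) x
                            + (scalar_curvature (g c) x)\<^sup>2 / 4)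
                          * divergence (g c) (X t c) x)
             - 2 * manifold_integral M A g
                   (\<lambda>c x. scalar_curvature (g c) x
                          * inner_tensor (g c) (ricci (g c)) (Def (g c) (X t c)) x)))
            (at t within {0..}))
         \<and> ((\<lambda>t. deriv (\<lambda>s. I_functional M A g (X s)) t) \<longlongrightarrow> 0) at_top"
proof -
  obtain F \<rho> where pou: "riemannian_pou M A g F \<rho>"
    and int: "\<And>f. manifold_integral M A g f = riemannian_pou.pou_integral g F \<rho> f"
    using manifold_integral_eq_pou_integral[OF assms(1)] by metis
  interpret flow M A g F \<rho> X0 X
    by (rule flow.intro[OF pou]) (unfold_locales, rule assms(3))
  note R = smooth_vector_field_grad_R
  have I: "I_functional M A g (X s) = prod_int grad_R (X s)" for s
    by (simp add: I_functional_def int prod_int_def grad_R_def)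
  let ?I = "\<lambda>s. prod_int grad_R (X s)" and ?a = "\<lambda>t. prod_int (flow_field grad_R) (X t)"
  have der: "(?I has_real_derivative ?a t) (at t within {0..})" if "t \<ge> 0" for t
    by (rule prod_int_fixed_derivative[OF R that])
  \<comment> \<open>\<open>deriv\<close> refers to the two-sided derivative, which the one within
    the half line supplies at positive times; these suffice for a limit at infinity.\<close>
  have der': "(?I has_real_derivative ?a t) (at t)" if "t > 0" for t
    using der[of t] at_within_Ici[OF that] that by simp
  \<comment> \<open>The two Cauchy conditions are \<open>prod_int_Cauchy\<close> for \<nabla>R and
    for L \<nabla>R.\<close>
  have "(?a \<longlongrightarrow> 0) at_top"
    by (rule tendsto_0_if_Cauchy[OF der' prod_int_Cauchy prod_int_Cauchy])
      (auto intro: smooth_vector_field_comps[OF R] smooth_comps_flow_field)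
  then have "((\<lambda>t. deriv ?I t) \<longlongrightarrow> 0) at_top"
    by (rule Lim_transform_eventually)
      (auto intro!: eventually_mono[OF eventually_gt_at_top[of 0]] DERIV_imp_deriv[symmetric] der')
  then show ?thesis
    unfolding I int using der prod_int_flow_field_grad_R[OF smooth_X] by simp
qed

end
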